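(* Let $1<p<q$ be coprime integers, $n\ge 2$, $d=npq$. For type III functions in $\operatorname{H}_{p,q}^{d}$, the analytic moduli space with fixed Henry-Parusiński invariant is determined by the images in $\mathbb{V}^{n-1}/\mathbb{Z}_n$ of the non-degenerate fibers of $\Upsilon_{III}:\mathbb{V}^{n-1}\to\mathbb{C}^{n-1}$. More precisely, for each $c\in\mathcal{HP}_{III}=\operatorname{Im}(\Upsilon_{III})$ there exist $\#[\Upsilon_{III}^{-1}(c)]$ analytic types of function-germs with the same Henry-Parusiński invariant $c$, where $[\Upsilon_{III}^{-1}(c)]$ is the set of $\mathbb{Z}_n$-orbits in the fiber $\Upsilon_{III}^{-1}(c)$, and $$\#[\Upsilon_{III}^{-1}(c)]\le n^{n-2}.$$ The equality $\#[\Upsilon_{III}^{-1}(c)]=n^{n-2}$ holds for (the invariant $c$ of) generic polynomials in the Zariski open set $\mathcal{Z}\subset\operatorname{H}_{p,q}^{d}$.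
   Context: Function germs $f,g:(\mathbb{C}^2,0)\to(\mathbb{C},0)$ are analytically equivalent if $g=f\circ\Phi$ for some germ of biholomorphism $\Phi\in\operatorname{Diff}(\mathbb{C}^2,0)$; an analytic type is an equivalence class. For coprime integers $1\le p<q$, $\operatorname{H}_{p,q}^{d}$ is the set of commode, monic, reduced quasi-homogeneous polynomials $f_\lambda(x,y)=\prod_{j=1}^n(y^p-\lambda_jx^q)$ with $\lambda_j\in\mathbb{C}^*$ pairwise distinct and $d=npq$; it is viewed in $\mathbb{C}^n$ through the coefficients $(\sigma_1(\lambda),\dots,\sigma_n(\lambda))$ of $Q_\lambda(t)=\prod_{j=1}^n(t-\lambda_j)$, where $\sigma_\ell$ is the $\ell$-th elementary symmetric polynomial. Type III means $p>1$. Let $\kappa_1,\dots,\kappa_{n-1}$ be the critical points of $Q_\lambda$ with multiplicity, so $Q_\lambda'(t)=n\prod_{j=1}^{n-1}(t-\kappa_j)$ and $\sigma_\ell(\kappa)=\frac{n-\ell}{n}\sigma_\ell(\lambda)$ for $0\le\ell\le n-1$. Put $\rho_0=(-1)^n\lambda_1\cdots\lambda_n$ and $\rho_\ell=\prod_{j=1}^n(\kappa_\ell-\lambda_j)$ for $1\le\ell\le n-1$. Henry-Parusiński invariant (type III): order the $\kappa_\ell$ so that $\kappa_1,\dots,\kappa_r$ are the nonzero ones. The polar arcs of $\partial_yf_\lambda=0$ are $\gamma_0(s)=(s,0)$ and $\gamma_\ell(s)=(s^p,\alpha_\ell s^q)$ with $\alpha_\ell^p=\kappa_\ell\ne0$,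 $1\le\ell\le r$, and $f_\lambda(\gamma_0(s))=\rho_0s^{nq}$, $f_\lambda(\gamma_\ell(s))=\rho_\ell s^{pqn}$. The invariant is the set of leading coefficients $\{c_0,c_1,\dots,c_r\}$, where two sets $\{c_0,\dots,c_r\}$, $\{c_0',\dots,c_r'\}$ define the same invariant if there is $\xi\in\mathbb{C}^*$ with $\{c_0',c_1',\dots,c_r'\}=\{c_0\xi^{qn},c_1\xi^{pqn},\dots,c_r\xi^{pqn}\}$. Normalization and the map $\Upsilon_{III}$: $\mathbb{V}^{n-1}$ is the set of (unordered) tuples $\lambda=(\lambda_1,\dots,\lambda_n)$ of pairwise distinct elements of $\mathbb{C}^*$ with $\lambda_1\cdots\lambda_n=1$, on which $\mathbb{Z}_n$ acts by multiplication by $n$-th roots of unity. Such $\lambda$ is determined by $\kappa=(\kappa_1,\dots,\kappa_{n-1})\in\mathbb{C}^{n-1}$ through $\sigma_\ell(\lambda)=\frac{n}{n-\ell}\sigma_\ell(\kappa)$ ($1\le\ell\le n-1$) and $\sigma_n(\lambda)=1$ (the $\mathbb{Z}_n$-action multiplies $\kappa$ by the same root of unity). In terms of $\kappa$, $\Upsilon_{III}:\mathbb{C}^{n-1}\to\mathbb{C}^{n-1}$, $\kappa\mapsto c=(c_1,\dots,c_{n-1})=(\rho_1/\rho_0,\dots,\rho_{n-1}/\rho_0)$, is given by $$\kappa_j^n+\sum_{\ell=1}^{n-1}(-1)^\ell\frac{n}{n-\ell}\sigma_\ell(\kappa)\kappa_j^{n-\ell}+(-1)^n=(-1)^nc_j,\quad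 j=1,\dots,n-1.$$ The analytic types of the functions $f_\lambda$ are represented by the $\mathbb{Z}_n$-orbits. Each $c\in\mathcal{HP}_{III}:=\operatorname{Im}(\Upsilon_{III})$ is taken to represent a Henry-Parusiński invariant, and "function-germs with Henry-Parusiński invariant $c$" are those represented by points of $\Upsilon_{III}^{-1}(c)$. A fiber $\Upsilon_{III}^{-1}(c)$ is degenerate if $c_j=0$ for some $j\in\{1,\dots,n-1\}$ or if the fiber has a multiple root; otherwise it is non-degenerate. The set $\mathcal{Z}$: the Zariski open set of those $f_\lambda\in\operatorname{H}_{p,q}^{d}$ such that $Q_\lambda'$ has $n-1$ distinct roots $\kappa_1,\dots,\kappa_{n-1}$ and the values $\rho_\ell=Q_\lambda(\kappa_\ell)$, $1\le\ell\le n-1$, are pairwise distinct. *)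

theory Defs
  imports "HOL-Complex_Analysis.Complex_Analysis" "HOL-Computational_Algebra.Polynomial"
begin

section \<open>Analytic types of function germs on $(\mathbb{C}^2,0)$\<close>

text \<open>
  Holomorphy in two variables is complex Frechet differentiability at every point of an open
  set, i.e. the real derivative exists and is of the complex-linear form \<open>(u, v) \<mapsto> a u + b v\<close>.
\<close>

definition holomorphic2_on :: "(complex \<times> complex \<Rightarrow> complex) \<Rightarrow> (complex \<times> complex) set \<Rightarrow> bool"
  where "holomorphic2_on f U \<longleftrightarrow>
    (\<forall>z\<in>U. \<exists>a b. (f has_derivative (\<lambda>(u, v). a * u + b * v)) (at z))"

definition holomorphic2_map_on ::
    "(complex \<times> complex \<Rightarrow> complex \<times> complex) \<Rightarrow> (complex \<times> complex) set \<Rightarrow> bool"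
  where "holomorphic2_map_on \<Phi> U \<longleftrightarrow>
    holomorphic2_on (\<lambda>z. fst (\<Phi> z)) U \<and> holomorphic2_on (\<lambda>z. snd (\<Phi> z)) U"

text \<open>
  Germs are handled through representatives: total functions that are only relevant near \<open>0\<close>.
  \<open>Diff0\<close> consists of the representatives of elements of $\mathrm{Diff}(\mathbb{C}^2,0)$.
\<close>

definition Diff0 :: "(complex \<times> complex \<Rightarrow> complex \<times> complex) set"
  where "Diff0 = {\<Phi>. \<Phi> 0 = 0 \<and>
    (\<exists>U V \<Psi>. open U \<and> open V \<and> 0 \<in> U \<and> bij_betw \<Phi> U V \<and> (\<forall>z\<in>U. \<Psi> (\<Phi> z) = z) \<and>
       holomorphic2_map_on \<Phi> U \<and> holomorphic2_map_on \<Psi> V)}"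

definition function_germs :: "(complex \<times> complex \<Rightarrow> complex) set"
  where "function_germs = {f. f 0 = 0 \<and> (\<exists>U. open U \<and> 0 \<in> U \<and> holomorphic2_on f U)}"

text \<open>
  Representatives of the same germ are related (take \<open>\<Phi> = id\<close>), so the classes of this
  relation correspond exactly to the classes of germs modulo right equivalence.
\<close>

definition analytic_equivalence ::
    "((complex \<times> complex \<Rightarrow> complex) \<times> (complex \<times> complex \<Rightarrow> complex)) set"
  where "analytic_equivalence = {(f, g). f \<in> function_germs \<and> g \<in> function_germs \<and>
    (\<exists>\<Phi>\<in>Diff0. \<forall>\<^sub>F z in nhds 0. g z = f (\<Phi> z))}"

definition analytic_type :: "(complex \<times> complex \<Rightarrow> complex) \<Rightarrow> (complex \<times> complex \<Rightarrow> complex) set"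
  where "analytic_type f = analytic_equivalence `` {f}"


section \<open>Quasi-homogeneous polynomials\<close>

text \<open>
  An unordered tuple of \<open>n\<close> pairwise distinct elements of $\mathbb{C}^*$ is an \<open>n\<close>-element set
  not containing \<open>0\<close>.
\<close>

definition root_sets :: "nat \<Rightarrow> complex set set"
  where "root_sets n = {\<Lambda>. finite \<Lambda> \<and> card \<Lambda> = n \<and> 0 \<notin> \<Lambda>}"

definition qh_poly :: "nat \<Rightarrow> nat \<Rightarrow> complex set \<Rightarrow> complex \<times> complex \<Rightarrow> complex"
  where "qh_poly p q \<Lambda> = (\<lambda>(x, y). \<Prod>l\<in>\<Lambda>. (y ^ p - l * x ^ q))"

definition H_pq :: "nat \<Rightarrow> nat \<Rightarrow> nat \<Rightarrow> (complex \<times> complex \<Rightarrow> complex) set"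
  where "H_pq p q d = {qh_poly p q \<Lambda> | \<Lambda> n. \<Lambda> \<in> root_sets n \<and> d = n * p * q}"

text \<open>The polynomial $Q_\lambda$.\<close>

definition Q_poly :: "complex set \<Rightarrow> complex poly"
  where "Q_poly \<Lambda> = (\<Prod>l\<in>\<Lambda>. [:- l, 1:])"

text \<open>The \<open>l\<close>-th elementary symmetric polynomial in the family \<open>(x\<^sub>i)\<^sub>i\<^sub>\<in>\<^sub>A\<close>.\<close>

definition esym :: "nat \<Rightarrow> ('i \<Rightarrow> complex) \<Rightarrow> 'i set \<Rightarrow> complex"
  where "esym l x A = (\<Sum>I\<in>{I. I \<subseteq> A \<and> card I = l}. \<Prod>i\<in>I. x i)"

definition sigma_set :: "nat \<Rightarrow> complex set \<Rightarrow> complex"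
  where "sigma_set l \<Lambda> = esym l (\<lambda>z. z) \<Lambda>"

definition sigma_tuple :: "nat \<Rightarrow> complex list \<Rightarrow> complex"
  where "sigma_tuple l \<kappa> = esym l (\<lambda>i. \<kappa> ! i) {..<length \<kappa>}"

definition rho0 :: "complex set \<Rightarrow> complex"
  where "rho0 \<Lambda> = (-1) ^ card \<Lambda> * (\<Prod>l\<in>\<Lambda>. l)"

text \<open>\<open>\<kappa>\<close> lists the critical points of $Q_\lambda$ with multiplicity, in some order.\<close>

definition critical_tuple :: "complex set \<Rightarrow> complex list \<Rightarrow> bool"
  where "critical_tuple \<Lambda> \<kappa> \<longleftrightarrow>
    pderiv (Q_poly \<Lambda>) = smult (of_nat (card \<Lambda>)) (\<Prod>k\<leftarrow>\<kappa>. [:- k, 1:])"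


section \<open>The Henry-Parusinski invariant (type III)\<close>

text \<open>
  The leading coefficients $c_1,\dots,c_r$ of $f_\lambda$ along the polar arcs $\gamma_\ell$ with
  $\kappa_\ell \neq 0$; the coefficient $c_0$ along $\gamma_0$ is \<open>rho0 \<Lambda>\<close>.
\<close>

definition polar_coeffs :: "complex set \<Rightarrow> complex set"
  where "polar_coeffs \<Lambda> = {poly (Q_poly \<Lambda>) k | k. k \<noteq> 0 \<and> poly (pderiv (Q_poly \<Lambda>)) k = 0}"

definition same_HP_invariant :: "nat \<Rightarrow> nat \<Rightarrow> nat \<Rightarrow> complex set \<Rightarrow> complex set \<Rightarrow> bool"
  where "same_HP_invariant p q n \<Lambda> \<Lambda>' \<longleftrightarrow>
    (\<exists>\<xi>. \<xi> \<noteq> 0 \<and> insert (rho0 \<Lambda>') (polar_coeffs \<Lambda>') =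
       insert (rho0 \<Lambda> * \<xi> ^ (q * n)) ((\<lambda>c. c * \<xi> ^ (p * q * n)) ` polar_coeffs \<Lambda>))"

text \<open>The tuple $(\rho_1/\rho_0,\dots,\rho_{n-1}/\rho_0)$ for the ordering \<open>\<kappa>\<close> of the critical points.\<close>

definition HP_tuple :: "complex set \<Rightarrow> complex list \<Rightarrow> complex list"
  where "HP_tuple \<Lambda> \<kappa> = map (\<lambda>k. poly (Q_poly \<Lambda>) k / rho0 \<Lambda>) \<kappa>"


section \<open>The normalized parameter space and the map $\Upsilon_{III}$\<close>

definition V_space :: "nat \<Rightarrow> complex set set"
  where "V_space n = {\<Lambda> \<in> root_sets n. (\<Prod>l\<in>\<Lambda>. l) = 1}"

text \<open>
  Ordered tuples in $\mathbb{C}^{n-1}$ are lists of length \<open>n - 1\<close>. The defining equation has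
  $(-1)^n c_j$ on one side; it is solved here for $c_j$ by multiplying with $(-1)^n$.
\<close>

definition Upsilon :: "nat \<Rightarrow> complex list \<Rightarrow> complex list"
  where "Upsilon n \<kappa> = map (\<lambda>k. (-1) ^ n *
    (k ^ n + (\<Sum>l = 1..n - 1. (-1) ^ l * (of_nat n / of_nat (n - l)) * sigma_tuple l \<kappa> * k ^ (n - l))
      + (-1) ^ n)) \<kappa>"

definition HP_III :: "nat \<Rightarrow> complex list set"
  where "HP_III n = Upsilon n ` {\<kappa>. length \<kappa> = n - 1}"

text \<open>
  The fiber over \<open>c\<close>, as a subset of $\mathbb{V}^{n-1}$: the unordered \<open>\<lambda>\<close> that are determined
  by some point \<open>\<kappa>\<close> of $\mathbb{C}^{n-1}$ that $\Upsilon_{III}$ maps to \<open>c\<close>. As \<open>\<lambda>\<close> is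
  unordered, it determines \<open>\<kappa>\<close> only up to order, whereas \<open>c\<close> is ordered.
\<close>

definition Upsilon_fiber :: "nat \<Rightarrow> complex list \<Rightarrow> complex set set"
  where "Upsilon_fiber n c = {\<Lambda> \<in> V_space n. \<exists>\<kappa>. length \<kappa> = n - 1 \<and>
    (\<forall>l\<in>{1..n - 1}. sigma_set l \<Lambda> = of_nat n / of_nat (n - l) * sigma_tuple l \<kappa>) \<and>
    Upsilon n \<kappa> = c}"

definition Zn_orbit :: "nat \<Rightarrow> complex set \<Rightarrow> complex set set"
  where "Zn_orbit n \<Lambda> = {(\<lambda>z. \<zeta> * z) ` \<Lambda> | \<zeta>. \<zeta> ^ n = 1}"

definition fiber_orbits :: "nat \<Rightarrow> complex list \<Rightarrow> complex set set set"
  where "fiber_orbits n c = Zn_orbit n ` Upsilon_fiber n c"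

definition germs_with_HP :: "nat \<Rightarrow> nat \<Rightarrow> nat \<Rightarrow> complex list \<Rightarrow> (complex \<times> complex \<Rightarrow> complex) set"
  where "germs_with_HP p q n c = qh_poly p q ` Upsilon_fiber n c"

definition analytic_types_with_HP ::
    "nat \<Rightarrow> nat \<Rightarrow> nat \<Rightarrow> complex list \<Rightarrow> (complex \<times> complex \<Rightarrow> complex) set set"
  where "analytic_types_with_HP p q n c = analytic_type ` germs_with_HP p q n c"


section \<open>The Zariski topology on $\mathbb{C}^n$ and the set $\mathcal{Z}$\<close>

text \<open>Points of $\mathbb{C}^n$ are lists of length \<open>n\<close>.\<close>

inductive polynomial_fun :: "nat \<Rightarrow> (complex list \<Rightarrow> complex) \<Rightarrow> bool" for n :: nat
  where
    const: "polynomial_fun n (\<lambda>_. a)"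
  | coord: "i < n \<Longrightarrow> polynomial_fun n (\<lambda>v. v ! i)"
  | add: "polynomial_fun n f \<Longrightarrow> polynomial_fun n g \<Longrightarrow> polynomial_fun n (\<lambda>v. f v + g v)"
  | mult: "polynomial_fun n f \<Longrightarrow> polynomial_fun n g \<Longrightarrow> polynomial_fun n (\<lambda>v. f v * g v)"

definition zariski_open :: "nat \<Rightarrow> complex list set \<Rightarrow> bool"
  where "zariski_open n A \<longleftrightarrow>
    (\<exists>F. (\<forall>f\<in>F. polynomial_fun n f) \<and> A = {v. length v = n \<and> \<not> (\<forall>f\<in>F. f v = 0)})"

text \<open>
  $\mathrm{H}_{p,q}^d$ sits in $\mathbb{C}^n$ via $f_\lambda \mapsto (\sigma_1(\lambda),\dots,\sigma_n(\lambda))$.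
\<close>

definition coeff_coords :: "nat \<Rightarrow> complex set \<Rightarrow> complex list"
  where "coeff_coords n \<Lambda> = map (\<lambda>l. sigma_set l \<Lambda>) [1..<Suc n]"

definition Z_roots :: "nat \<Rightarrow> complex set set"
  where "Z_roots n = {\<Lambda> \<in> root_sets n.
    card {k. poly (pderiv (Q_poly \<Lambda>)) k = 0} = n - 1 \<and>
    inj_on (poly (Q_poly \<Lambda>)) {k. poly (pderiv (Q_poly \<Lambda>)) k = 0}}"

text \<open>
  A property holds for generic members of $\mathcal{Z}$ if it holds on a nonempty Zariski open
  subset of $\mathcal{Z}$; since $\mathbb{C}^n$ is irreducible, such a subset is dense.
\<close>

definition generic_in_Z :: "nat \<Rightarrow> (complex set \<Rightarrow> bool) \<Rightarrow> bool"
  where "generic_in_Z n P \<longleftrightarrow>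
    (\<exists>U. zariski_open n U \<and> U \<noteq> {} \<and> U \<subseteq> coeff_coords n ` Z_roots n \<and>
      (\<forall>\<Lambda>\<in>Z_roots n. coeff_coords n \<Lambda> \<in> U \<longrightarrow> P \<Lambda>))"

end

theory Submission
  imports Defs "Jordan_Normal_Form.Determinant" "HOL-Computational_Algebra.Fundamental_Theorem_Algebra"
begin

text \<open>
  Put \<open>N = n - 1\<close>. A normalized \<open>\<Lambda>\<close> is encoded by the vector \<open>x\<close> of the critical points of
  \<open>Q_poly \<Lambda>\<close>: if \<open>R\<close> is the primitive, vanishing at \<open>0\<close>, of \<open>n \<Prod>(t - x\<^sub>i)\<close>, then
  \<open>Q_poly \<Lambda> = R + (-1)\<^sup>n\<close>, and \<open>Upsilon\<close> is, up to an affine change of each coordinate, the map that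
  sends \<open>x\<close> to the critical values \<open>R(x\<^sub>1), \<dots>, R(x\<^sub>N)\<close>. The theorem is a statement about the
  fibres of this polynomial map from \<open>\<complex>\<^sup>N\<close> to itself, about their symmetry under the \<open>n\<close>-th roots of
  unity, and about the passage from orbits to analytic types.

  The map is homogeneous of degree \<open>n\<close>, and it vanishes only at \<open>0\<close>: a polynomial of degree \<open>n\<close> that
  vanishes at all its critical points has a single root (\<open>crit_values_zero_imp_zero\<close>). Hence it is
  proper. Over a vector of pairwise distinct nonzero values its derivative is injective, because a
  vector in the kernel produces a polynomial of degree at most \<open>N\<close> with the \<open>N + 1\<close> zeros
  \<open>0, x\<^sub>1, \<dots>, x\<^sub>N\<close> (\<open>crit_value_regular\<close>). So the generic fibre has \<open>n\<^sup>N\<close> points by Bezout's theorem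
  (\<open>card_fibre\<close>).

  This count is proved here by analysis and dimension counts. Near a regular value the points of a
  fibre move holomorphically (\<open>regular_local_section\<close>, a Newton iteration), so the sum of a polynomial
  of degree at most \<open>n T\<close> over the fibres along a line extends to a polynomial of degree at most \<open>T\<close>
  (\<open>trace_polynomial\<close>). If a fibre had \<open>D < n\<^sup>N\<close> points, then for large \<open>T\<close> some nonzero polynomial of
  degree \<open>n T\<close> would vanish there to order greater than \<open>T + D\<close>; the traces of its products with
  polynomials of degree at most \<open>D\<close> would then vanish, and so would the polynomial itself. If a fibre had more than \<open>n\<^sup>N\<close> points, the products
  of interpolation polynomials for these points with the monomials in the components of the map would
  be too many linearly independent polynomials of bounded degree.

  Degenerate fibres are compared with generic ones: each point of a fibre is a limit of points of
  nearby generic fibres (\<open>fibre_approximation\<close>), since otherwise a polynomial that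
  separates this point from the limits of the generic fibres would have a discontinuous trace. A family
  of points that are pairwise inequivalent under the \<open>n\<close>-th roots of unity can therefore be moved into
  a generic fibre, where it has \<open>n\<close> times as many distinct rotations. This bounds the number of orbits by
  \<open>n\<^sup>N / n\<close> (\<open>inequivalent_points_bound\<close>, \<open>orbit_count_upper\<close>). Over a generic value there are
  \<open>n\<^sup>N\<close> points and an orbit has at most \<open>n\<close> of them, which gives equality (\<open>orbit_count_lower\<close>).

  Orbits correspond to analytic types (\<open>analytic_type_eq_iff_orbit_eq\<close>). A rotation of \<open>\<Lambda>\<close> by \<open>\<zeta>\<close> is
  realized by \<open>x \<mapsto> a x\<close> with \<open>a\<^sup>q = \<zeta>\<close>. Conversely, a biholomorphism \<open>\<Phi>\<close> that carries one function to
  another has, along the curves \<open>(s\<^sup>p, \<alpha> s\<^sup>q)\<close>, first coordinate of the form \<open>a s\<^sup>p\<close> and second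
  coordinate of the form \<open>e \<alpha> s\<^sup>q\<close> to leading order; a lower term \<open>s\<^sup>k\<close> in the second coordinate would
  have \<open>k\<close> divisible by \<open>p\<close>, and it cannot occur because \<open>\<Phi>\<close> maps zeros to zeros and \<open>p\<close> does not
  divide \<open>q\<close>. So \<open>\<Phi>\<close> multiplies the set of roots by a constant, and the normalization of the product
  makes this constant an \<open>n\<close>-th root of unity.

  Finally, that \<open>Q\<close> has \<open>N\<close> distinct nonzero critical points, and that its values at them and at \<open>0\<close>
  are pairwise distinct and nonzero, is shown to be equivalent to the nonvanishing of one determinant
  in the coefficients of \<open>Q\<close> (\<open>det_value_matrix_nonzero_iff\<close>). This provides the nonempty Zariski open
  set on which equality holds.
\<close>

section \<open>Underdetermined linear systems and bounded sequences\<close>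

text \<open>
  Gaussian elimination: an equation with a nonzero coefficient at \<open>i0\<close> is solved for the unknown
  \<open>u i0\<close>, which leaves one equation and one unknown less.
\<close>

lemma underdetermined_system_kernel:
  fixes m :: "'j \<Rightarrow> 'i \<Rightarrow> 'a::field"
  assumes "finite J" "finite I" "card J < card I"
  shows "\<exists>u. (\<exists>i\<in>I. u i \<noteq> 0) \<and> (\<forall>j\<in>J. (\<Sum>i\<in>I. m j i * u i) = 0)"
  using assms
proof (induction J arbitrary: I m rule: finite_induct)
  case empty
  then have "I \<noteq> {}" by auto
  then show ?case by (intro exI[of _ "\<lambda>_. 1"]) auto
next
  case (insert j J)
  show ?case
  proof (cases "\<forall>i\<in>I. m j i = 0")
    case True
    have "card J < card I" using insert by simp
    from insert.IH[OF insert.prems(1) this, of m] True show ?thesis by auto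
  next
    case False
    then obtain i0 where i0: "i0 \<in> I" "m j i0 \<noteq> 0" by blast
    define I' where "I' = I - {i0}"
    have I: "I = insert i0 I'" "i0 \<notin> I'" "finite I'" using i0 insert.prems by (auto simp: I'_def)
    have "card J < card I'" using insert I by simp
    from insert.IH[OF I(3) this, of "\<lambda>j' i. m j' i - m j' i0 * m j i / m j i0"]
    obtain u where u: "\<exists>i\<in>I'. u i \<noteq> 0"
      "\<forall>j'\<in>J. (\<Sum>i\<in>I'. (m j' i - m j' i0 * m j i / m j i0) * u i) = 0" by blast
    define s where "s = (\<Sum>i\<in>I'. m j i * u i)"
    define w where "w = u(i0 := - s / m j i0)"
    have sw: "(\<Sum>i\<in>I. m j' i * w i) = - m j' i0 * s / m j i0 + (\<Sum>i\<in>I'. m j' i * u i)" for j'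
    proof -
      have "(\<Sum>i\<in>I'. m j' i * w i) = (\<Sum>i\<in>I'. m j' i * u i)"
        using I(2) by (intro sum.cong) (auto simp: w_def)
      then show ?thesis using I by (simp add: w_def)
    qed
    have "(\<Sum>i\<in>I. m j' i * w i) = 0" if "j' \<in> J" for j'
    proof -
      have "0 = (\<Sum>i\<in>I'. (m j' i - m j' i0 * m j i / m j i0) * u i)" using u that by simp
      also have "\<dots> = (\<Sum>i\<in>I'. m j' i * u i) - (\<Sum>i\<in>I'. (m j' i0 / m j i0) * (m j i * u i))"
        by (simp add: left_diff_distrib sum_subtractf mult.assoc)
      also have "\<dots> = (\<Sum>i\<in>I'. m j' i * u i) - (m j' i0 / m j i0) * s"
        by (simp add: s_def sum_distrib_left mult_ac)
      finally show ?thesis unfolding sw by simp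
    qed
    moreover have "(\<Sum>i\<in>I. m j i * w i) = 0" unfolding sw using i0 by (simp add: s_def)
    moreover have "\<exists>i\<in>I. w i \<noteq> 0"
      using u(1) I by (auto simp: w_def)
    ultimately show ?thesis by blast
  qed
qed

lemma bounded_families_simultaneous_subsequence:
  fixes f :: "'i \<Rightarrow> nat \<Rightarrow> complex"
  assumes "finite I" "\<And>i. i \<in> I \<Longrightarrow> bounded (range (f i))"
  shows "\<exists>r::nat\<Rightarrow>nat. strict_mono r \<and> (\<forall>i\<in>I. \<exists>l. (\<lambda>k. f i (r k)) \<longlonglongrightarrow> l)"
  using assms
proof (induction I rule: finite_induct)
  case empty
  then show ?case by (auto intro: exI[of _ id] simp: strict_mono_id)
next
  case (insert i I)
  then obtain r where r: "strict_mono r" "\<forall>i\<in>I. \<exists>l. (\<lambda>k. f i (r k)) \<longlonglongrightarrow> l" by auto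
  have "bounded (range (\<lambda>k. f i (r k)))"
    using insert.prems[of i] by (auto intro: bounded_subset)
  then obtain l r' where r': "strict_mono r'" "((\<lambda>k. f i (r k)) \<circ> r') \<longlonglongrightarrow> l"
    using bounded_imp_convergent_subsequence by blast
  have "\<exists>l. (\<lambda>k. f j (r (r' k))) \<longlonglongrightarrow> l" if j: "j \<in> I" for j
  proof -
    from r(2) j obtain l where "(\<lambda>k. f j (r k)) \<longlonglongrightarrow> l" by blast
    from LIMSEQ_subseq_LIMSEQ[OF this r'(1)] show ?thesis by (auto simp: o_def)
  qed
  with r r' show ?case
    by (intro exI[of _ "r \<circ> r'"]) (auto simp: o_def strict_mono_def)
qed

section \<open>Polynomial functions on complex affine space\<close>

text \<open>
  Points of \<open>\<complex>\<^sup>N\<close> are sequences supported on the first \<open>N\<close> indices, so that the dimension remains an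
  ordinary variable.
\<close>

definition cn :: "nat \<Rightarrow> (nat \<Rightarrow> complex) set"
  where "cn N = {x. \<forall>i\<ge>N. x i = 0}"

definition nrm :: "nat \<Rightarrow> (nat \<Rightarrow> complex) \<Rightarrow> real"
  where "nrm N x = (\<Sum>i<N. cmod (x i))"

definition ray :: "(nat \<Rightarrow> complex) \<Rightarrow> (nat \<Rightarrow> complex) \<Rightarrow> complex \<Rightarrow> nat \<Rightarrow> complex"
  where "ray a v t = (\<lambda>i. a i + t * v i)"

abbreviation vdiff :: "(nat \<Rightarrow> complex) \<Rightarrow> (nat \<Rightarrow> complex) \<Rightarrow> nat \<Rightarrow> complex"
  where "vdiff x y \<equiv> (\<lambda>i. x i - y i)"

lemma cn_eqI: "x \<in> cn N \<Longrightarrow> y \<in> cn N \<Longrightarrow> (\<And>i. i < N \<Longrightarrow> x i = y i) \<Longrightarrow> x = y"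
  by (rule ext) (metis (mono_tags, lifting) cn_def mem_Collect_eq not_less)

lemma ray_in_cn [intro]: "a \<in> cn N \<Longrightarrow> v \<in> cn N \<Longrightarrow> ray a v t \<in> cn N"
  by (auto simp: cn_def ray_def)

lemma vdiff_in_cn [intro]: "a \<in> cn N \<Longrightarrow> v \<in> cn N \<Longrightarrow> vdiff a v \<in> cn N"
  by (auto simp: cn_def)

lemma ray_0 [simp]: "ray a v 0 = a"
  by (simp add: ray_def)

lemma ray_vdiff_1 [simp]: "ray a (vdiff b a) 1 = b"
  by (simp add: ray_def)

lemma ray_ray: "ray (ray a v s) v t = ray a v (s + t)"
  by (simp add: ray_def algebra_simps)

lemma nrm_nonneg [simp]: "0 \<le> nrm N x"
  by (simp add: nrm_def sum_nonneg)

lemma cmod_le_nrm: "i < N \<Longrightarrow> cmod (x i) \<le> nrm N x"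
  unfolding nrm_def by (rule member_le_sum) auto

lemma nrm_zero_iff: "x \<in> cn N \<Longrightarrow> nrm N x = 0 \<longleftrightarrow> x = (\<lambda>_. 0)"
  by (auto simp: nrm_def sum_nonneg_eq_0_iff cn_def intro!: ext) (metis lessThan_iff not_less)

lemma nrm_triangle: "nrm N (\<lambda>i. x i + y i) \<le> nrm N x + nrm N y"
  unfolding nrm_def sum.distrib[symmetric] by (intro sum_mono norm_triangle_ineq)

lemma nrm_triangle_diff: "nrm N (vdiff x z) \<le> nrm N (vdiff x y) + nrm N (vdiff y z)"
  using nrm_triangle[of N "vdiff x y" "vdiff y z"] by simp

lemma nrm_commute: "nrm N (vdiff x y) = nrm N (vdiff y x)"
  by (simp add: nrm_def norm_minus_commute)

lemma nrm_scale: "nrm N (\<lambda>i. c * x i) = cmod c * nrm N x"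
  by (simp add: nrm_def norm_mult sum_distrib_left)

lemma nrm_ray: "nrm N (ray a v t) \<le> nrm N a + cmod t * nrm N v"
  using nrm_triangle[of N a "\<lambda>i. t * v i"] by (simp add: ray_def nrm_scale)

lemma tendsto_nrm_iff:
  "((\<lambda>k. nrm N (vdiff (s k) l)) \<longlongrightarrow> 0) F \<longleftrightarrow> (\<forall>i<N. ((\<lambda>k. s k i) \<longlongrightarrow> l i) F)"
proof
  assume L: "((\<lambda>k. nrm N (vdiff (s k) l)) \<longlongrightarrow> 0) F"
  show "\<forall>i<N. ((\<lambda>k. s k i) \<longlongrightarrow> l i) F"
  proof safe
    fix i assume "i < N"
    then have "cmod (s k i - l i) \<le> nrm N (vdiff (s k) l)" for k
      using cmod_le_nrm[of i N "vdiff (s k) l"] by simp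
    then have "((\<lambda>k. s k i - l i) \<longlongrightarrow> 0) F"
      by (intro Lim_null_comparison[OF _ L]) auto
    then show "((\<lambda>k. s k i) \<longlongrightarrow> l i) F" using Lim_null by blast
  qed
next
  assume R: "\<forall>i<N. ((\<lambda>k. s k i) \<longlongrightarrow> l i) F"
  have "((\<lambda>k. \<Sum>i<N. cmod (s k i - l i)) \<longlongrightarrow> (\<Sum>i<N. cmod (l i - l i))) F"
    by (intro tendsto_sum tendsto_norm tendsto_diff tendsto_const) (use R in auto)
  then show "((\<lambda>k. nrm N (vdiff (s k) l)) \<longlongrightarrow> 0) F" by (simp add: nrm_def)
qed

lemma bounded_sequence_subsequence:
  assumes "\<And>k. s k \<in> cn N" "\<And>k. nrm N (s k) \<le> B"
  shows "\<exists>r l. strict_mono (r::nat\<Rightarrow>nat) \<and> l \<in> cn N \<and> (\<forall>i<N. (\<lambda>k. s (r k) i) \<longlonglongrightarrow> l i)"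
proof -
  have "bounded (range (\<lambda>k. s k i))" if "i < N" for i
    unfolding bounded_iff using order_trans[OF cmod_le_nrm[OF that] assms(2)] by auto
  then obtain r :: "nat \<Rightarrow> nat" where r: "strict_mono r" "\<forall>i\<in>{..<N}. \<exists>l. (\<lambda>k. s (r k) i) \<longlonglongrightarrow> l"
    using bounded_families_simultaneous_subsequence[of "{..<N}" "\<lambda>i k. s k i"] by auto
  then obtain l where l: "\<forall>i<N. (\<lambda>k. s (r k) i) \<longlonglongrightarrow> l i" by (metis lessThan_iff)
  show ?thesis
    by (rule exI[of _ r], rule exI[of _ "\<lambda>i. if i < N then l i else 0"]) (use r l in \<open>auto simp: cn_def\<close>)
qed

text \<open>
  The number \<open>m\<close> is a bound for the degree, not the degree itself.
\<close>

inductive polyfun :: "nat \<Rightarrow> nat \<Rightarrow> ((nat \<Rightarrow> complex) \<Rightarrow> complex) \<Rightarrow> bool" for N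
  where
    const: "polyfun N m (\<lambda>_. a)"
  | coord: "i < N \<Longrightarrow> 1 \<le> m \<Longrightarrow> polyfun N m (\<lambda>x. x i)"
  | add: "polyfun N m f \<Longrightarrow> polyfun N m g \<Longrightarrow> polyfun N m (\<lambda>x. f x + g x)"
  | mult: "polyfun N m f \<Longrightarrow> polyfun N k g \<Longrightarrow> polyfun N (m + k) (\<lambda>x. f x * g x)"
  | weaken: "polyfun N m f \<Longrightarrow> m \<le> m' \<Longrightarrow> polyfun N m' f"

lemma polyfun_cmult: "polyfun N m f \<Longrightarrow> polyfun N m (\<lambda>x. c * f x)"
  using polyfun.mult[OF polyfun.const[of N 0 c]] by simp

lemma polyfun_diff: "polyfun N m f \<Longrightarrow> polyfun N m g \<Longrightarrow> polyfun N m (\<lambda>x. f x - g x)"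
  using polyfun.add[OF _ polyfun_cmult[of N m g "-1"], of f] by simp

lemma polyfun_sum: "(\<And>i. i \<in> I \<Longrightarrow> polyfun N m (f i)) \<Longrightarrow> polyfun N m (\<lambda>x. \<Sum>i\<in>I. f i x)"
  by (induction I rule: infinite_finite_induct) (auto intro: polyfun.intros)

lemma polyfun_prod:
  "(\<And>i. i \<in> I \<Longrightarrow> polyfun N (d i) (f i)) \<Longrightarrow> polyfun N (\<Sum>i\<in>I. d i) (\<lambda>x. \<Prod>i\<in>I. f i x)"
  by (induction I rule: infinite_finite_induct) (auto intro: polyfun.const polyfun.mult)

lemma polyfun_power: "polyfun N m f \<Longrightarrow> polyfun N (k * m) (\<lambda>x. f x ^ k)"
  by (induction k) (auto intro: polyfun.const polyfun.mult)

lemma polyfun_compose: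
  assumes "polyfun N m F" "\<And>j. j < N \<Longrightarrow> polyfun M k (\<lambda>x. G x j)"
  shows "polyfun M (m * k) (\<lambda>x. F (G x))"
  using assms
proof (induction rule: polyfun.induct)
  case (coord i m)
  then show ?case using polyfun.weaken[of M k "\<lambda>x. G x i" "m * k"] by simp
next
  case (mult m f k' g)
  then show ?case by (simp add: add_mult_distrib polyfun.mult)
next
  case (weaken m f m')
  then show ?case by (meson mult_le_mono1 polyfun.weaken)
qed (auto intro: polyfun.intros)

lemma polyfun_growth:
  assumes "polyfun N m F"
  shows "\<exists>C\<ge>0. \<forall>x. cmod (F x) \<le> C * (1 + nrm N x) ^ m"
  using assms
proof (induction rule: polyfun.induct)
  case (const m a)
  have "cmod a \<le> cmod a * (1 + nrm N x) ^ m" for x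
    using mult_left_mono[of 1 "(1 + nrm N x) ^ m" "cmod a"] by (simp add: one_le_power)
  then show ?case by (intro exI[of _ "cmod a"]) auto
next
  case (coord i m)
  have "cmod (x i) \<le> (1 + nrm N x) ^ m" for x
  proof -
    have "cmod (x i) \<le> (1 + nrm N x) ^ 1" using cmod_le_nrm[OF coord(1), of x] by simp
    also have "\<dots> \<le> (1 + nrm N x) ^ m" by (rule power_increasing) (use coord in auto)
    finally show ?thesis .
  qed
  then show ?case by (intro exI[of _ 1]) auto
next
  case (add m f g)
  then obtain C D where "C \<ge> 0" "D \<ge> 0" "\<forall>x. cmod (f x) \<le> C * (1 + nrm N x) ^ m"
    "\<forall>x. cmod (g x) \<le> D * (1 + nrm N x) ^ m" by blast
  then show ?case
    by (intro exI[of _ "C + D"]) (auto simp: distrib_right intro: norm_triangle_le add_mono)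
next
  case (mult m f k g)
  then obtain C D where CD: "C \<ge> 0" "D \<ge> 0" "\<forall>x. cmod (f x) \<le> C * (1 + nrm N x) ^ m"
    "\<forall>x. cmod (g x) \<le> D * (1 + nrm N x) ^ k" by blast
  have "cmod (f x * g x) \<le> (C * D) * (1 + nrm N x) ^ (m + k)" for x
  proof -
    have "cmod (f x * g x) \<le> (C * (1 + nrm N x) ^ m) * (D * (1 + nrm N x) ^ k)"
      unfolding norm_mult by (intro mult_mono) (use CD in auto)
    then show ?thesis by (simp add: power_add mult_ac)
  qed
  then show ?case using CD by (intro exI[of _ "C * D"]) auto
next
  case (weaken m f m')
  then obtain C where C: "C \<ge> 0" "\<forall>x. cmod (f x) \<le> C * (1 + nrm N x) ^ m" by blast
  have "C * (1 + nrm N x) ^ m \<le> C * (1 + nrm N x) ^ m'" for x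
    by (intro mult_left_mono power_increasing) (use weaken C in auto)
  then show ?case using C order_trans by blast
qed

lemma polyfun_tendsto:
  assumes "polyfun N m F" "\<And>i. i < N \<Longrightarrow> ((\<lambda>k. s k i) \<longlongrightarrow> l i) Fl"
  shows "((\<lambda>k. F (s k)) \<longlongrightarrow> F l) Fl"
  using assms by (induction rule: polyfun.induct) (auto intro!: tendsto_intros)

lemma polyfun_holomorphic:
  assumes "polyfun N m F" "\<And>i. i < N \<Longrightarrow> (\<lambda>t. s t i) holomorphic_on S"
  shows "(\<lambda>t. F (s t)) holomorphic_on S"
  using assms by (induction rule: polyfun.induct) (auto intro!: holomorphic_intros)

lemma polyfun_ray:
  assumes "polyfun N m F"
  shows "\<exists>p. degree p \<le> m \<and> (\<forall>t. F (ray a v t) = poly p t)"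
  using assms
proof (induction rule: polyfun.induct)
  case (const m c)
  show ?case by (intro exI[of _ "[:c:]"]) auto
next
  case (coord i m)
  then show ?case by (intro exI[of _ "[:a i, v i:]"]) (auto simp: ray_def)
next
  case (add m f g)
  then show ?case by (metis degree_add_le poly_add)
next
  case (mult m f k g)
  then obtain p q where "degree p \<le> m" "\<forall>t. f (ray a v t) = poly p t"
    "degree q \<le> k" "\<forall>t. g (ray a v t) = poly q t" by blast
  then show ?case by (intro exI[of _ "p * q"]) (auto intro: order_trans[OF degree_mult_le])
next
  case (weaken m f m')
  then show ?case using le_trans by blast
qed

text \<open>
  The linear approximation is uniform in two points \<open>x\<close>, \<open>y\<close> near \<open>a\<close>. Differentiability at \<open>a\<close> alone
  would not suffice for the contraction estimate of the Newton iteration below.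
\<close>

lemma polyfun_strict_derivative:
  assumes "polyfun N m F"
  shows "\<exists>g. \<forall>e>0. \<exists>d>0. \<forall>x y. nrm N (vdiff x a) < d \<longrightarrow> nrm N (vdiff y a) < d \<longrightarrow>
           cmod (F x - F y - (\<Sum>i<N. g i * (x i - y i))) \<le> e * nrm N (vdiff x y)"
  using assms
proof (induction rule: polyfun.induct)
  case (const m c)
  show ?case by (intro exI[of _ "\<lambda>_. 0"]) (auto intro: exI[of _ 1])
next
  case (coord i m)
  have "(\<Sum>j<N. (if j = i then 1 else 0) * (x j - y j)) = x i - y i" for x y :: "nat \<Rightarrow> complex"
    using coord by (simp add: if_distrib[of "\<lambda>c. c * _"] sum.delta cong: if_cong)
  then show ?case
    by (intro exI[of _ "\<lambda>j. if j = i then 1 else 0"]) (auto intro: exI[of _ 1])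
next
  case (add m f g)
  then obtain f' g' where
    f': "\<And>e. e > 0 \<Longrightarrow> \<exists>d>0. \<forall>x y. nrm N (vdiff x a) < d \<longrightarrow> nrm N (vdiff y a) < d \<longrightarrow>
           cmod (f x - f y - (\<Sum>i<N. f' i * (x i - y i))) \<le> e * nrm N (vdiff x y)" and
    g': "\<And>e. e > 0 \<Longrightarrow> \<exists>d>0. \<forall>x y. nrm N (vdiff x a) < d \<longrightarrow> nrm N (vdiff y a) < d \<longrightarrow>
           cmod (g x - g y - (\<Sum>i<N. g' i * (x i - y i))) \<le> e * nrm N (vdiff x y)" by blast
  show ?case
  proof (intro exI[of _ "\<lambda>i. f' i + g' i"] allI impI)
    fix e :: real assume "e > 0"
    then obtain d1 d2 where d: "d1 > 0" "d2 > 0"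
      "\<forall>x y. nrm N (vdiff x a) < d1 \<longrightarrow> nrm N (vdiff y a) < d1 \<longrightarrow>
           cmod (f x - f y - (\<Sum>i<N. f' i * (x i - y i))) \<le> e / 2 * nrm N (vdiff x y)"
      "\<forall>x y. nrm N (vdiff x a) < d2 \<longrightarrow> nrm N (vdiff y a) < d2 \<longrightarrow>
           cmod (g x - g y - (\<Sum>i<N. g' i * (x i - y i))) \<le> e / 2 * nrm N (vdiff x y)"
      using f'[of "e/2"] g'[of "e/2"] by auto
    show "\<exists>d>0. \<forall>x y. nrm N (vdiff x a) < d \<longrightarrow> nrm N (vdiff y a) < d \<longrightarrow>
        cmod (f x + g x - (f y + g y) - (\<Sum>i<N. (f' i + g' i) * (x i - y i))) \<le> e * nrm N (vdiff x y)"
    proof (intro exI[of _ "min d1 d2"] conjI allI impI)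
      fix x y assume xy: "nrm N (vdiff x a) < min d1 d2" "nrm N (vdiff y a) < min d1 d2"
      have "f x + g x - (f y + g y) - (\<Sum>i<N. (f' i + g' i) * (x i - y i))
        = (f x - f y - (\<Sum>i<N. f' i * (x i - y i))) + (g x - g y - (\<Sum>i<N. g' i * (x i - y i)))"
        by (simp add: distrib_right sum.distrib)
      then have "cmod (f x + g x - (f y + g y) - (\<Sum>i<N. (f' i + g' i) * (x i - y i)))
        \<le> e / 2 * nrm N (vdiff x y) + e / 2 * nrm N (vdiff x y)"
        using d xy by (metis (no_types, lifting) min_less_iff_conj norm_triangle_mono)
      then show "cmod (f x + g x - (f y + g y) - (\<Sum>i<N. (f' i + g' i) * (x i - y i))) \<le> e * nrm N (vdiff x y)"
        by simp
    qed (use d in auto)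
  qed
next
  case (mult m f k g)
  then obtain f' g' where
    f': "\<And>e. e > 0 \<Longrightarrow> \<exists>d>0. \<forall>x y. nrm N (vdiff x a) < d \<longrightarrow> nrm N (vdiff y a) < d \<longrightarrow>
           cmod (f x - f y - (\<Sum>i<N. f' i * (x i - y i))) \<le> e * nrm N (vdiff x y)" and
    g': "\<And>e. e > 0 \<Longrightarrow> \<exists>d>0. \<forall>x y. nrm N (vdiff x a) < d \<longrightarrow> nrm N (vdiff y a) < d \<longrightarrow>
           cmod (g x - g y - (\<Sum>i<N. g' i * (x i - y i))) \<le> e * nrm N (vdiff x y)" by blast
  define Mg where "Mg = 1 + cmod (g a)"
  define Mf where "Mf = 1 + cmod (f a)"
  define G where "G = (\<Sum>i<N. cmod (g' i)) + (\<Sum>i<N. cmod (f' i)) + 1"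
  have "(\<Sum>i<N. cmod (g' i)) \<ge> 0" "(\<Sum>i<N. cmod (f' i)) \<ge> 0" by (auto intro: sum_nonneg)
  then have pos: "Mg > 0" "Mf > 0" "G > 0"
    unfolding Mg_def Mf_def G_def using norm_ge_zero[of "f a"] norm_ge_zero[of "g a"] by linarith+
  have lin: "cmod (\<Sum>i<N. c i * (x i - y i)) \<le> (\<Sum>i<N. cmod (c i)) * nrm N (vdiff x y)"
    for c x y :: "nat \<Rightarrow> complex"
  proof -
    have "cmod (\<Sum>i<N. c i * (x i - y i)) \<le> (\<Sum>i<N. cmod (c i) * nrm N (vdiff x y))"
      by (intro sum_norm_le) (auto simp: norm_mult intro!: mult_left_mono cmod_le_nrm[of _ N "vdiff x y"])
    then show ?thesis by (simp add: sum_distrib_right)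
  qed
  have gG: "(\<Sum>i<N. cmod (g' i)) \<le> G" "(\<Sum>i<N. cmod (f' i)) \<le> G"
    unfolding G_def by (auto intro!: add_nonneg_nonneg sum_nonneg)
  show ?case
  proof (intro exI[of _ "\<lambda>i. g a * f' i + f a * g' i"] allI impI)
    fix e :: real assume e: "e > 0"
    define e1 where "e1 = e / (4 * (Mg + Mf))"
    define e2 where "e2 = min 1 (e / (4 * G))"
    have e12: "e1 > 0" "e2 > 0" using e pos by (auto simp: e1_def e2_def)
    have cont: "\<exists>d>0. \<forall>x. nrm N (vdiff x a) < d \<longrightarrow> cmod (f x - f a) < e2 \<and> cmod (g x - g a) < e2"
    proof -
      obtain d1 where d1: "d1 > 0" "\<forall>x y. nrm N (vdiff x a) < d1 \<longrightarrow> nrm N (vdiff y a) < d1 \<longrightarrow>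
           cmod (f x - f y - (\<Sum>i<N. f' i * (x i - y i))) \<le> 1 * nrm N (vdiff x y)" using f'[of 1] by auto
      obtain d2 where d2: "d2 > 0" "\<forall>x y. nrm N (vdiff x a) < d2 \<longrightarrow> nrm N (vdiff y a) < d2 \<longrightarrow>
           cmod (g x - g y - (\<Sum>i<N. g' i * (x i - y i))) \<le> 1 * nrm N (vdiff x y)" using g'[of 1] by auto
      define d where "d = min (min d1 d2) (e2 / (1 + G))"
      have "d > 0" using d1 d2 e12 pos by (auto simp: d_def)
      moreover have "cmod (f x - f a) < e2 \<and> cmod (g x - g a) < e2" if x: "nrm N (vdiff x a) < d" for x
      proof -
        have a0: "nrm N (vdiff a a) = 0" by (simp add: nrm_def)
        have "cmod (f x - f a - (\<Sum>i<N. f' i * (x i - a i))) \<le> 1 * nrm N (vdiff x a)"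
          using d1 x a0 by (auto simp: d_def)
        then have "cmod (f x - f a) \<le> nrm N (vdiff x a) + cmod (\<Sum>i<N. f' i * (x i - a i))"
          using norm_triangle_sub[of "f x - f a" "\<Sum>i<N. f' i * (x i - a i)"] by linarith
        also have "\<dots> \<le> nrm N (vdiff x a) + G * nrm N (vdiff x a)"
          using order_trans[OF lin mult_right_mono[OF gG(2)]] by simp
        also have "\<dots> = (1 + G) * nrm N (vdiff x a)" by (simp add: algebra_simps)
        also have "\<dots> < e2" using x pos by (simp add: d_def pos_less_divide_eq mult.commute)
        finally have 1: "cmod (f x - f a) < e2" .
        have "cmod (g x - g a - (\<Sum>i<N. g' i * (x i - a i))) \<le> 1 * nrm N (vdiff x a)"
          using d2 x a0 by (auto simp: d_def)
        then have "cmod (g x - g a) \<le> nrm N (vdiff x a) + cmod (\<Sum>i<N. g' i * (x i - a i))"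
          using norm_triangle_sub[of "g x - g a" "\<Sum>i<N. g' i * (x i - a i)"] by linarith
        also have "\<dots> \<le> nrm N (vdiff x a) + G * nrm N (vdiff x a)"
          using order_trans[OF lin mult_right_mono[OF gG(1)]] by simp
        also have "\<dots> = (1 + G) * nrm N (vdiff x a)" by (simp add: algebra_simps)
        also have "\<dots> < e2" using x pos by (simp add: d_def pos_less_divide_eq mult.commute)
        finally show ?thesis using 1 by simp
      qed
      ultimately show ?thesis by blast
    qed
    obtain d0 where d0: "d0 > 0" "\<And>x. nrm N (vdiff x a) < d0 \<Longrightarrow> cmod (f x - f a) < e2 \<and> cmod (g x - g a) < e2"
      using cont by blast
    obtain d1 where d1: "d1 > 0" "\<forall>x y. nrm N (vdiff x a) < d1 \<longrightarrow> nrm N (vdiff y a) < d1 \<longrightarrow>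
           cmod (f x - f y - (\<Sum>i<N. f' i * (x i - y i))) \<le> e1 * nrm N (vdiff x y)" using f' e12 by blast
    obtain d2 where d2: "d2 > 0" "\<forall>x y. nrm N (vdiff x a) < d2 \<longrightarrow> nrm N (vdiff y a) < d2 \<longrightarrow>
           cmod (g x - g y - (\<Sum>i<N. g' i * (x i - y i))) \<le> e1 * nrm N (vdiff x y)" using g' e12 by blast
    show "\<exists>d>0. \<forall>x y. nrm N (vdiff x a) < d \<longrightarrow> nrm N (vdiff y a) < d \<longrightarrow>
        cmod (f x * g x - f y * g y - (\<Sum>i<N. (g a * f' i + f a * g' i) * (x i - y i))) \<le> e * nrm N (vdiff x y)"
    proof (intro exI[of _ "min d0 (min d1 d2)"] conjI allI impI)
      fix x y assume xy: "nrm N (vdiff x a) < min d0 (min d1 d2)" "nrm N (vdiff y a) < min d0 (min d1 d2)"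
      define r where "r = nrm N (vdiff x y)"
      define u where "u = (\<Sum>i<N. f' i * (x i - y i))"
      define w where "w = (\<Sum>i<N. g' i * (x i - y i))"
      have r0: "r \<ge> 0" by (simp add: r_def)
      have fx: "cmod (f x - f y - u) \<le> e1 * r" using d1 xy by (auto simp: r_def u_def)
      have gx: "cmod (g x - g y - w) \<le> e1 * r" using d2 xy by (auto simp: r_def w_def)
      have ub: "cmod u \<le> G * r" unfolding u_def r_def
        using order_trans[OF lin mult_right_mono[OF gG(2)]] by simp
      have wb: "cmod w \<le> G * r" unfolding w_def r_def
        using order_trans[OF lin mult_right_mono[OF gG(1)]] by simp
      have gxa: "cmod (g x - g a) \<le> e2" using d0(2)[of x] xy by simp
      have fya: "cmod (f y - f a) \<le> e2" using d0(2)[of y] xy by simp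
      have gxM: "cmod (g x) \<le> Mg"
        using norm_triangle_sub[of "g x" "g a"] gxa by (auto simp: Mg_def e2_def)
      have fyM: "cmod (f y) \<le> Mf"
        using norm_triangle_sub[of "f y" "f a"] fya by (auto simp: Mf_def e2_def)
      have S: "(\<Sum>i<N. (g a * f' i + f a * g' i) * (x i - y i)) = g a * u + f a * w"

        unfolding u_def w_def sum_distrib_left sum.distrib[symmetric] by (intro sum.cong) (auto simp: algebra_simps)
      have "f x * g x - f y * g y - (g a * u + f a * w) =
        (f x - f y - u) * g x + f y * (g x - g y - w) + (g x - g a) * u + (f y - f a) * w"
        by (simp add: algebra_simps)
      also have "cmod \<dots> \<le> (e1 * r) * Mg + Mf * (e1 * r) + e2 * (G * r) + e2 * (G * r)"
        by (intro norm_triangle_mono) (auto simp: norm_mult intro!: mult_mono fx gx ub wb gxa fya gxM fyM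
              simp: pos[THEN less_imp_le] e12[THEN less_imp_le] r0 intro: order_trans[OF _ fyM])
      also have "\<dots> = (e1 * (Mg + Mf)) * r + 2 * (e2 * G) * r" by (simp add: algebra_simps)
      also have "\<dots> \<le> (e / 4) * r + 2 * (e / 4) * r"
      proof (intro add_mono mult_right_mono mult_left_mono)
        have "e / (4 * s) * s = e / 4" if "s \<noteq> 0" for s :: real using that by simp
        from this[of "Mg + Mf"] show "e1 * (Mg + Mf) \<le> e / 4" using pos unfolding e1_def by linarith
        have "e2 * G \<le> e / (4 * G) * G" using pos by (intro mult_right_mono) (auto simp: e2_def)
        then show "e2 * G \<le> e / 4" using pos by simp
      qed (use r0 in auto)
      also have "\<dots> \<le> e * r" using e r0 by simp
      finally show "cmod (f x * g x - f y * g y - (\<Sum>i<N. (g a * f' i + f a * g' i) * (x i - y i))) \<le> e * nrm N (vdiff x y)"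
        unfolding S r_def .
    qed (use d0 d1 d2 in auto)
  qed
qed


section \<open>Monomials and dimension counts\<close>

definition mons :: "nat \<Rightarrow> nat \<Rightarrow> (nat \<Rightarrow> nat) set"
  where "mons N m = {b. (\<forall>i\<ge>N. b i = 0) \<and> (\<Sum>i<N. b i) \<le> m}"

definition monom_fun :: "nat \<Rightarrow> (nat \<Rightarrow> nat) \<Rightarrow> (nat \<Rightarrow> complex) \<Rightarrow> complex"
  where "monom_fun N b x = (\<Prod>i<N. x i ^ b i)"

lemma mons_Suc_bij:
  "bij_betw (\<lambda>(k, g). g(N := k)) (SIGMA k:{..m}. mons N (m - k)) (mons (Suc N) m)"
proof (rule bij_betwI[of _ _ _ "\<lambda>b. (b N, b(N := 0))"])
  show "(\<lambda>(k, g). g(N := k)) \<in> (SIGMA k:{..m}. mons N (m - k)) \<rightarrow> mons (Suc N) m"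
  proof safe
    fix k g assume k: "k \<le> m" "g \<in> mons N (m - k)"
    have "(\<Sum>i<N. (g(N := k)) i) = (\<Sum>i<N. g i)" by (intro sum.cong) auto
    then show "g(N := k) \<in> mons (Suc N) m" using k by (auto simp: mons_def)
  qed
  show "(\<lambda>b. (b N, b(N := 0))) \<in> mons (Suc N) m \<rightarrow> (SIGMA k:{..m}. mons N (m - k))"
  proof safe
    fix b assume b: "b \<in> mons (Suc N) m"
    have "(\<Sum>i<N. (b(N := 0)) i) = (\<Sum>i<N. b i)" by (intro sum.cong) auto
    then show "b(N := 0) \<in> mons N (m - b N)" using b by (auto simp: mons_def)
    show "b N \<le> m" using b by (auto simp: mons_def)
  qed
qed (auto simp: mons_def)

lemma finite_card_mons: "finite (mons N m) \<and> card (mons N m) = (N + m) choose N"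
proof (induction N arbitrary: m)
  case 0
  have "mons 0 m = {\<lambda>_. 0}" by (auto simp: mons_def)
  then show ?case by simp
next
  case (Suc N)
  have fin: "finite (SIGMA k:{..m}. mons N (m - k))" using Suc by auto
  have "card (mons (Suc N) m) = card (SIGMA k:{..m}. mons N (m - k))"
    using bij_betw_same_card[OF mons_Suc_bij] by simp
  also have "\<dots> = (\<Sum>k\<le>m. (N + (m - k)) choose N)"
    using Suc by (subst card_SigmaI) auto
  also have "\<dots> = (\<Sum>k\<le>m. (N + k) choose N)"
    by (rule sum.reindex_bij_witness[of _ "\<lambda>k. m - k" "\<lambda>k. m - k"]) auto
  also have "\<dots> = (N + m + 1) choose (N + 1)" by (rule choose_rising_sum(1))
  finally show ?case using fin bij_betw_finite[OF mons_Suc_bij] by simp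
qed

lemmas finite_mons [simp, intro] = finite_card_mons[THEN conjunct1]

text \<open>
  Only the leading terms in \<open>m\<close> of the dimension \<open>(N + m) choose N\<close> matter for the counts below. They are
  exposed by the two estimates of the dimension times \<open>N!\<close>.
\<close>

lemma card_mons_upper: "fact N * card (mons N m) \<le> (N + m) ^ N"
  using binomial_fact_pow[of "N + m" N] by (simp add: finite_card_mons mult.commute)

lemma card_mons_lower: "m ^ N \<le> fact N * card (mons N m)"
proof -
  have "m ^ N \<le> fact N * ((N + m) choose N)"
  proof (induction N)
    case (Suc N)
    have "Suc (N + m) * ((N + m) choose N) = (Suc (N + m) choose Suc N) * Suc N"
      by (rule Suc_times_binomial_eq)
    then have "fact (Suc N) * ((Suc N + m) choose Suc N) = Suc (N + m) * (fact N * ((N + m) choose N))"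
      by (simp add: algebra_simps)
    also have "\<dots> \<ge> m * m ^ N" by (intro mult_mono Suc) auto
    finally show ?case by simp
  qed simp
  then show ?thesis by (simp add: finite_card_mons)
qed

text \<open>
  Dividing by \<open>M\<^sup>N\<close> and letting \<open>M\<close> tend to infinity compares the leading coefficients.
\<close>

lemma polynomial_growth_comparison:
  fixes A B k N :: nat
  assumes "\<And>M. A * M ^ N \<le> B * (M + k) ^ N"
  shows "A \<le> B"
proof -
  have ev: "real A \<le> real B * (1 + real k / real M) ^ N" if "M > 0" for M
  proof -
    have "real A * real M ^ N \<le> real B * (real M + real k) ^ N"
      using assms[of M] by (metis of_nat_add of_nat_le_iff of_nat_mult of_nat_power)
    also have "real M + real k = real M * (1 + real k / real M)" using that by (simp add: field_simps)
    finally have "real A * real M ^ N \<le> (real B * (1 + real k / real M) ^ N) * real M ^ N"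
      by (simp only: power_mult_distrib mult_ac)
    then show ?thesis by (rule mult_right_le_imp_le) (use that in auto)
  qed
  have "(\<lambda>M. real B * (1 + real k / real M) ^ N) \<longlonglongrightarrow> real B * (1 + 0) ^ N"
    by (intro tendsto_intros lim_const_over_n)
  moreover have "\<forall>\<^sub>F M in sequentially. real A \<le> real B * (1 + real k / real M) ^ N"
    using ev by (auto intro: eventually_mono[OF eventually_gt_at_top[of 0]])
  ultimately have "real A \<le> real B * (1 + 0) ^ N"
    by (intro tendsto_lowerbound) auto
  then show ?thesis by simp
qed

lemma monom_fun_add: "monom_fun N (\<lambda>i. a i + b i) x = monom_fun N a x * monom_fun N b x"
  by (simp add: monom_fun_def power_add prod.distrib)

lemma polyfun_monom_fun: "b \<in> mons N m \<Longrightarrow> polyfun N m (monom_fun N b)"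
proof -
  assume b: "b \<in> mons N m"
  have "polyfun N (\<Sum>i<N. b i * 1) (\<lambda>x. \<Prod>i<N. x i ^ b i)"
    by (intro polyfun_prod polyfun_power polyfun.coord) auto
  then have "polyfun N (\<Sum>i<N. b i) (monom_fun N b)"
    by (simp add: monom_fun_def[abs_def])
  then show ?thesis using b by (auto simp: mons_def intro: polyfun.weaken)
qed

lemma collect_monomials:
  assumes "finite I" "\<And>i. i \<in> I \<Longrightarrow> b i \<in> mons N m"
  shows "(\<Sum>i\<in>I. c i * monom_fun N (b i) x) =
    (\<Sum>g\<in>mons N m. (\<Sum>i\<in>{i\<in>I. b i = g}. c i) * monom_fun N g x)"
proof -
  have "(\<Sum>i\<in>I. c i * monom_fun N (b i) x) =
      (\<Sum>g\<in>mons N m. \<Sum>i\<in>{i\<in>I. b i = g}. c i * monom_fun N (b i) x)"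
    by (rule sum.group[symmetric]) (use assms in auto)
  also have "\<dots> = (\<Sum>g\<in>mons N m. (\<Sum>i\<in>{i\<in>I. b i = g}. c i) * monom_fun N g x)"
    unfolding sum_distrib_right by (intro sum.cong) auto
  finally show ?thesis .
qed

text \<open>
  Together with \<open>monomials_independent\<close> this says that the polynomial functions with degree bound \<open>m\<close>
  form a space of dimension \<open>card (mons N m)\<close>.
\<close>

lemma polyfun_expansion:
  assumes "polyfun N m F"
  shows "\<exists>u. \<forall>x. F x = (\<Sum>b\<in>mons N m. u b * monom_fun N b x)"
  using assms
proof (induction rule: polyfun.induct)
  case (const m a)
  have "(\<lambda>_. 0) \<in> mons N m" by (auto simp: mons_def)
  then have "a = (\<Sum>b\<in>mons N m. (if b = (\<lambda>_. 0) then a else 0) * monom_fun N b x)" for x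
    by (simp add: if_distrib[of "\<lambda>c. c * _"] monom_fun_def cong: if_cong)
  then show ?case by (intro exI[of _ "\<lambda>b. if b = (\<lambda>_. 0) then a else 0"] allI)
next
  case (coord i m)
  define e where "e = (\<lambda>j. if j = i then 1 else 0 :: nat)"
  have "(\<Sum>j<N. e j) = 1" using coord by (simp add: e_def)
  then have e: "e \<in> mons N m" using coord by (auto simp: mons_def e_def)
  have "x i = monom_fun N e x" for x :: "nat \<Rightarrow> complex"
    using coord by (simp add: monom_fun_def e_def if_distrib[of "\<lambda>k. _ ^ k"] prod.delta cong: if_cong)
  then have "x i = (\<Sum>b\<in>mons N m. (if b = e then 1 else 0) * monom_fun N b x)" for x
    using e by (simp add: if_distrib[of "\<lambda>c. c * _"] cong: if_cong)
  then show ?case by (intro exI[of _ "\<lambda>b. if b = e then 1 else 0"] allI)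
next
  case (add m f g)
  then obtain u w where "\<forall>x. f x = (\<Sum>b\<in>mons N m. u b * monom_fun N b x)"
    "\<forall>x. g x = (\<Sum>b\<in>mons N m. w b * monom_fun N b x)" by blast
  then show ?case
    by (intro exI[of _ "\<lambda>b. u b + w b"]) (auto simp: distrib_right sum.distrib)
next
  case (mult m f k g)
  then obtain u w where uw: "\<forall>x. f x = (\<Sum>b\<in>mons N m. u b * monom_fun N b x)"
    "\<forall>x. g x = (\<Sum>b\<in>mons N k. w b * monom_fun N b x)" by blast
  have "f x * g x = (\<Sum>(a, b)\<in>mons N m \<times> mons N k. (u a * w b) * monom_fun N (\<lambda>i. a i + b i) x)" for x
    using uw by (simp add: sum_product sum.cartesian_product monom_fun_add mult_ac)
  also have "\<dots> x = (\<Sum>g\<in>mons N (m + k). (\<Sum>i\<in>{i\<in>mons N m \<times> mons N k. (\<lambda>(a, b) i. a i + b i) i = g}.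
      (\<lambda>(a, b). u a * w b) i) * monom_fun N g x)" for x
    unfolding case_prod_unfold
    by (rule collect_monomials, simp) (auto simp: mons_def sum.distrib)
  finally show ?case
    by (intro exI[of _ "\<lambda>g. \<Sum>i\<in>{i\<in>mons N m \<times> mons N k. (\<lambda>(a, b) i. a i + b i) i = g}.
      (\<lambda>(a, b). u a * w b) i"] allI)
next
  case (weaken m f m')
  then obtain u where u: "\<forall>x. f x = (\<Sum>b\<in>mons N m. u b * monom_fun N b x)" by blast
  have sub: "mons N m \<subseteq> mons N m'" using weaken by (auto simp: mons_def)
  have "f x = (\<Sum>b\<in>mons N m'. (if b \<in> mons N m then u b else 0) * monom_fun N b x)" for x
    using u by (subst sum.mono_neutral_right[OF _ sub]) (auto intro!: sum.cong)
  then show ?case by (intro exI[of _ "\<lambda>b. if b \<in> mons N m then u b else 0"] allI)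
qed

lemma base_expansion_inj:
  fixes a b :: "nat \<Rightarrow> nat"
  assumes "\<And>i. i < N \<Longrightarrow> a i < K" "\<And>i. i < N \<Longrightarrow> b i < K"
    and "(\<Sum>i<N. a i * K ^ i) = (\<Sum>i<N. b i * K ^ i)" and "i < N"
  shows "a i = b i"
  using assms
proof (induction N arbitrary: a b i)
  case (Suc N)
  have S: "(\<Sum>i<Suc N. c i * K ^ i) = c 0 + K * (\<Sum>i<N. c (Suc i) * K ^ i)" for c :: "nat \<Rightarrow> nat"
    unfolding sum.lessThan_Suc_shift by (simp add: sum_distrib_left mult_ac)
  have K: "a 0 < K" "b 0 < K" using Suc.prems by auto
  have eq: "a 0 + K * (\<Sum>i<N. a (Suc i) * K ^ i) = b 0 + K * (\<Sum>i<N. b (Suc i) * K ^ i)"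
    using Suc.prems(3) unfolding S .
  then have a0: "a 0 = b 0" using K
    by (metis mod_less mod_mult_self2)
  then have eq': "(\<Sum>i<N. a (Suc i) * K ^ i) = (\<Sum>i<N. b (Suc i) * K ^ i)" using eq K by simp
  show ?case
  proof (cases i)
    case (Suc j)
    show ?thesis unfolding Suc
      by (rule Suc.IH[of "\<lambda>i. a (Suc i)" "\<lambda>i. b (Suc i)"]) (use Suc.prems eq' Suc in auto)
  qed (use a0 in auto)
qed simp

text \<open>
  Substitute \<open>x\<^sub>i = z\<^bsup>K^i\<^esup>\<close> with \<open>K\<close> larger than all exponents. A monomial then becomes the power of
  \<open>z\<close> whose exponent has the exponents of the monomial as its digits in base \<open>K\<close>. Distinct monomials become
  distinct powers of \<open>z\<close>, and the claim reduces to polynomials in one variable.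
\<close>

lemma monomials_independent:
  assumes zero: "\<And>x. x \<in> cn N \<Longrightarrow> (\<Sum>b\<in>mons N m. u b * monom_fun N b x) = 0" and b: "b \<in> mons N m"
  shows "u b = 0"
proof -
  define K where "K = Suc m"
  define E where "E = (\<lambda>b::nat\<Rightarrow>nat. \<Sum>i<N. b i * K ^ i)"
  have lt: "b i < K" if "b \<in> mons N m" "i < N" for b i
    using that member_le_sum[of i "{..<N}" b] by (auto simp: mons_def K_def)
  have inj: "inj_on E (mons N m)"
  proof (rule inj_onI)
    fix a b assume ab: "a \<in> mons N m" "b \<in> mons N m" "E a = E b"
    show "a = b"
    proof
      fix i show "a i = b i"
      proof (cases "i < N")
        case True
        show ?thesis by (rule base_expansion_inj[of N a K b]) (use ab lt True in \<open>auto simp: E_def\<close>)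
      qed (use ab in \<open>auto simp: mons_def\<close>)
    qed
  qed
  define P where "P = (\<Sum>b\<in>mons N m. Polynomial.monom (u b) (E b))"
  have "poly P z = 0" for z
  proof -
    define x where "x = (\<lambda>i. if i < N then z ^ K ^ i else 0)"
    have "monom_fun N b x = z ^ E b" for b
      by (simp add: monom_fun_def x_def E_def power_sum power_mult[symmetric] mult.commute)
    moreover have "x \<in> cn N" by (auto simp: cn_def x_def)
    ultimately show ?thesis using zero[of x] by (simp add: P_def poly_sum poly_monom)
  qed
  then have "P = 0" by (simp add: poly_all_0_iff_0[symmetric])
  moreover have "coeff P (E b) = (\<Sum>c\<in>mons N m. if c = b then u c else 0)"
    unfolding P_def coeff_sum coeff_monom by (intro sum.cong) (use inj b in \<open>auto dest: inj_onD\<close>)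
  ultimately show ?thesis using b by simp
qed

section \<open>Local sections at regular points\<close>

text \<open>
  Injectivity of the derivative, stated with directional derivatives: the Jacobian matrix of \<open>h\<close> never
  has to be computed.
\<close>

definition regular_at :: "nat \<Rightarrow> (nat \<Rightarrow> (nat \<Rightarrow> complex) \<Rightarrow> complex) \<Rightarrow> (nat \<Rightarrow> complex) \<Rightarrow> bool"
  where "regular_at N h a \<longleftrightarrow> (\<forall>w\<in>cn N.
    (\<forall>j<N. ((\<lambda>t. h j (ray a w t)) has_field_derivative 0) (at 0)) \<longrightarrow> w = (\<lambda>_. 0))"

definition close_to_linear ::
    "nat \<Rightarrow> ((nat \<Rightarrow> complex) \<Rightarrow> complex) \<Rightarrow> (nat \<Rightarrow> complex) \<Rightarrow> (nat \<Rightarrow> complex) \<Rightarrow> real \<Rightarrow> real \<Rightarrow> bool"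
  where "close_to_linear N F a g e d \<longleftrightarrow> (\<forall>x y. nrm N (vdiff x a) < d \<longrightarrow> nrm N (vdiff y a) < d \<longrightarrow>
           cmod (F x - F y - (\<Sum>i<N. g i * (x i - y i))) \<le> e * nrm N (vdiff x y))"

definition strict_gradient ::
    "nat \<Rightarrow> ((nat \<Rightarrow> complex) \<Rightarrow> complex) \<Rightarrow> (nat \<Rightarrow> complex) \<Rightarrow> (nat \<Rightarrow> complex) \<Rightarrow> bool"
  where "strict_gradient N F a g \<longleftrightarrow> (\<forall>e>0. \<exists>d>0. close_to_linear N F a g e d)"

lemma strict_derivative_along_ray:
  assumes g0: "strict_gradient N F a g"
  shows "((\<lambda>t. F (ray a w t)) has_field_derivative (\<Sum>i<N. g i * w i)) (at 0)"
proof -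
  note g = g0[unfolded strict_gradient_def close_to_linear_def]
  define D where "D = (\<Sum>i<N. g i * w i)"
  have "((\<lambda>t. (F (ray a w t) - F (ray a w 0)) / (t - 0)) \<longlongrightarrow> D) (at 0)"
  proof (rule LIM_I)
    fix e :: real assume e: "e > 0"
    define e' where "e' = e / (2 * (1 + nrm N w))"
    have n1: "1 + nrm N w > 0" using nrm_nonneg[of N w] by linarith
    have e': "e' > 0" using e n1 by (simp add: e'_def)
    obtain d where d: "d > 0" "\<forall>x y. nrm N (vdiff x a) < d \<longrightarrow> nrm N (vdiff y a) < d \<longrightarrow>
           cmod (F x - F y - (\<Sum>i<N. g i * (x i - y i))) \<le> e' * nrm N (vdiff x y)" using g e' by blast
    have "norm ((F (ray a w t) - F (ray a w 0)) / (t - 0) - D) < e"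
      if t: "t \<noteq> 0" "cmod t < d / (1 + nrm N w)" for t
    proof -
      have r: "nrm N (vdiff (ray a w t) a) = cmod t * nrm N w"
        by (simp add: ray_def nrm_scale)
      have "cmod t * nrm N w \<le> cmod t * (1 + nrm N w)" by (intro mult_left_mono) auto
      also have "\<dots> < d" using t n1 by (simp add: field_simps)
      finally have lt: "nrm N (vdiff (ray a w t) a) < d" unfolding r .
      have "nrm N (vdiff a a) < d" using d by (simp add: nrm_def)
      then have "cmod (F (ray a w t) - F a - (\<Sum>i<N. g i * (ray a w t i - a i))) \<le> e' * (cmod t * nrm N w)"
        using d(2) lt r by metis
      moreover have "(\<Sum>i<N. g i * (ray a w t i - a i)) = t * D"
        by (simp add: ray_def D_def sum_distrib_left mult_ac)
      ultimately have le: "cmod (F (ray a w t) - F a - t * D) \<le> e' * (cmod t * nrm N w)" by simp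
      have "(F (ray a w t) - F (ray a w 0)) / (t - 0) - D = (F (ray a w t) - F a - t * D) / t"
        using t by (simp add: field_simps)
      then have "norm ((F (ray a w t) - F (ray a w 0)) / (t - 0) - D) = cmod (F (ray a w t) - F a - t * D) / cmod t"
        by (simp add: norm_divide)
      also have "\<dots> \<le> e' * (cmod t * nrm N w) / cmod t" by (intro divide_right_mono le) auto
      also have "\<dots> = e' * nrm N w" using t by simp
      also have "\<dots> \<le> e' * (1 + nrm N w)" using e' by (intro mult_left_mono) auto
      also have "\<dots> = e / 2"
      proof -
        have "e / (2 * s) * s = e / 2" if "s \<noteq> 0" for s :: real using that by simp
        then show ?thesis using n1 unfolding e'_def by (metis less_irrefl)
      qed
      also have "\<dots> < e" using e by simp
      finally show ?thesis .
    qed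
    then show "\<exists>s>0. \<forall>x. x \<noteq> 0 \<and> norm (x - 0) < s \<longrightarrow>
        norm ((F (ray a w x) - F (ray a w 0)) / (x - 0) - D) < e"
      using d n1 by (intro exI[of _ "d / (1 + nrm N w)"]) auto
  qed
  then show ?thesis unfolding D_def has_field_derivative_iff .
qed

text \<open>
  The left inverse gives the contraction property of the Newton iteration; the right inverse shows
  that a fixed point of the iteration solves the equation.
\<close>

lemma kernel_free_matrix_inverse:
  fixes J :: "nat \<Rightarrow> nat \<Rightarrow> complex"
  assumes "\<And>w. w \<in> cn N \<Longrightarrow> (\<And>j. j < N \<Longrightarrow> (\<Sum>i<N. J j i * w i) = 0) \<Longrightarrow> w = (\<lambda>_. 0)"
  obtains K where "\<And>i l. i < N \<Longrightarrow> l < N \<Longrightarrow> (\<Sum>j<N. K i j * J j l) = (if i = l then 1 else 0)"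
    and "\<And>i l. i < N \<Longrightarrow> l < N \<Longrightarrow> (\<Sum>j<N. J i j * K j l) = (if i = l then 1 else 0)"
proof -
  define A where "A = mat N N (\<lambda>(j, i). J j i)"
  have A: "A \<in> carrier_mat N N" by (simp add: A_def)
  have "Determinant.det A \<noteq> 0"
  proof
    assume "Determinant.det A = 0"
    then obtain v where v: "v \<in> carrier_vec N" "v \<noteq> 0\<^sub>v N" "A *\<^sub>v v = 0\<^sub>v N"
      using det_0_iff_vec_prod_zero[OF A] by blast
    define w where "w = (\<lambda>i. if i < N then vec_index v i else 0)"
    have "(\<Sum>i<N. J j i * w i) = 0" if "j < N" for j
    proof -
      have "vec_index (A *\<^sub>v v) j = 0" using v that by simp
      then show ?thesis using that v
        by (simp add: A_def scalar_prod_def w_def lessThan_atLeast0)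
    qed
    moreover have "w \<in> cn N" by (simp add: w_def cn_def)
    ultimately have w0: "w = (\<lambda>_. 0)" using assms by blast
    have "v = 0\<^sub>v N"
      by (rule eq_vecI) (use v w0 in \<open>auto simp: w_def fun_eq_iff split: if_splits\<close>)
    then show False using v by simp
  qed
  from det_non_zero_imp_unit[OF A this, of undefined]
  obtain B where B: "B \<in> carrier_mat N N" "A * B = 1\<^sub>m N" "B * A = 1\<^sub>m N"
    by (auto simp: Units_def ring_mat_def)
  define K where "K = (\<lambda>i j. index_mat B (i, j))"
  have 1: "(\<Sum>j<N. K i j * J j l) = (if i = l then 1 else 0)" if "i < N" "l < N" for i l
  proof -
    have "index_mat (B * A) (i, l) = (if i = l then 1 else 0)" using that by (simp add: B)
    then show ?thesis using that A B
      by (simp add: scalar_prod_def K_def A_def lessThan_atLeast0)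
  qed
  have 2: "(\<Sum>j<N. J i j * K j l) = (if i = l then 1 else 0)" if "i < N" "l < N" for i l
  proof -
    have "index_mat (A * B) (i, l) = (if i = l then 1 else 0)" using that by (simp add: B)
    then show ?thesis using that A B
      by (simp add: scalar_prod_def K_def A_def lessThan_atLeast0)
  qed
  from that[of K, OF 1 2] show ?thesis .
qed

definition injective_matrix :: "nat \<Rightarrow> (nat \<Rightarrow> nat \<Rightarrow> complex) \<Rightarrow> bool"
  where "injective_matrix N K \<longleftrightarrow>
    (\<forall>e. (\<forall>i<N. (\<Sum>j<N. K i j * e j) = 0) \<longrightarrow> (\<forall>j<N. e j = 0))"

text \<open>
  With \<open>K\<close> the inverse of the Jacobian matrix at \<open>a\<close>, the map \<open>x \<mapsto> x - K (h x)\<close> has derivative \<open>0\<close> at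
  \<open>a\<close>, so by strict differentiability it contracts distances near \<open>a\<close> by any prescribed factor.
\<close>

lemma newton_contraction:
  assumes h: "\<And>j. j < N \<Longrightarrow> polyfun N n (h j)" and reg: "regular_at N h a"
  obtains r K where "r > 0"
    and "\<And>x y. nrm N (vdiff x a) < r \<Longrightarrow> nrm N (vdiff y a) < r \<Longrightarrow>
       nrm N (\<lambda>i. x i - y i - (\<Sum>j<N. K i j * (h j x - h j y))) \<le> nrm N (vdiff x y) / 2"
    and "injective_matrix N K"
proof -
  have "\<forall>j\<in>{..<N}. \<exists>g. strict_gradient N (h j) a g"
    unfolding strict_gradient_def close_to_linear_def
    by (intro ballI polyfun_strict_derivative[OF h]) auto
  from bchoice[OF this] obtain J where J: "\<And>j. j < N \<Longrightarrow> strict_gradient N (h j) a (J j)" by auto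
  have kernel: "w = (\<lambda>_. 0)" if w: "w \<in> cn N" "\<And>j. j < N \<Longrightarrow> (\<Sum>i<N. J j i * w i) = 0" for w
  proof -
    have "((\<lambda>t. h j (ray a w t)) has_field_derivative 0) (at 0)" if "j < N" for j
      using strict_derivative_along_ray[OF J[OF that], of w] w(2)[OF that] by simp
    then show ?thesis using reg w(1) by (auto simp: regular_at_def)
  qed
  obtain K where
    KJ: "\<And>i l. i < N \<Longrightarrow> l < N \<Longrightarrow> (\<Sum>j<N. K i j * J j l) = (if i = l then 1 else 0)" and
    JK: "\<And>i l. i < N \<Longrightarrow> l < N \<Longrightarrow> (\<Sum>j<N. J i j * K j l) = (if i = l then 1 else 0)"
    by (rule kernel_free_matrix_inverse[of N J, OF kernel], assumption, assumption) (rule that)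
  define k where "k = (\<Sum>i<N. \<Sum>j<N. cmod (K i j))"
  have k0: "k \<ge> 0" by (auto simp: k_def intro!: sum_nonneg)
  define e where "e = 1 / (2 * (1 + k))"
  have e: "e > 0" "k * e \<le> 1 / 2" using k0 by (auto simp: e_def field_simps)
  have "\<forall>j\<in>{..<N}. \<exists>d>0. close_to_linear N (h j) a (J j) e d"
    using J e(1) unfolding strict_gradient_def by auto
  from bchoice[OF this] obtain d where d: "\<And>j. j < N \<Longrightarrow> d j > 0"
    "\<And>j. j < N \<Longrightarrow> close_to_linear N (h j) a (J j) e (d j)" by auto
  define r where "r = Min (insert 1 (d ` {..<N}))"
  have r: "r > 0" "\<And>j. j < N \<Longrightarrow> r \<le> d j"
    using d(1) by (auto simp: r_def)
  have contr: "nrm N (\<lambda>i. x i - y i - (\<Sum>j<N. K i j * (h j x - h j y))) \<le> nrm N (vdiff x y) / 2"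
    if x: "nrm N (vdiff x a) < r" and y: "nrm N (vdiff y a) < r" for x y
  proof -
    define E where "E = (\<lambda>j. h j x - h j y - (\<Sum>i<N. J j i * (x i - y i)))"
    have E: "cmod (E j) \<le> e * nrm N (vdiff x y)" if "j < N" for j
      unfolding E_def using d(2)[OF that] r(2)[OF that] x y by (force simp: close_to_linear_def)
    have "x i - y i - (\<Sum>j<N. K i j * (h j x - h j y)) = - (\<Sum>j<N. K i j * E j)" if "i < N" for i
    proof -
      have "(\<Sum>j<N. K i j * (\<Sum>l<N. J j l * (x l - y l))) = (\<Sum>j<N. \<Sum>l<N. (K i j * J j l) * (x l - y l))"
        by (simp add: sum_distrib_left mult.assoc)
      also have "\<dots> = (\<Sum>l<N. \<Sum>j<N. (K i j * J j l) * (x l - y l))" by (rule sum.swap)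
      also have "\<dots> = (\<Sum>l<N. (if i = l then 1 else 0) * (x l - y l))"
        unfolding sum_distrib_right[symmetric] by (intro sum.cong) (use KJ that in auto)
      also have "\<dots> = x i - y i"
        using that by (simp add: if_distrib[of "\<lambda>c. c * _"] cong: if_cong)
      finally show ?thesis by (simp add: E_def right_diff_distrib sum_subtractf)
    qed
    then have "nrm N (\<lambda>i. x i - y i - (\<Sum>j<N. K i j * (h j x - h j y))) = (\<Sum>i<N. cmod (\<Sum>j<N. K i j * E j))"
      by (simp add: nrm_def)
    also have "\<dots> \<le> (\<Sum>i<N. \<Sum>j<N. cmod (K i j) * (e * nrm N (vdiff x y)))"
      by (intro sum_mono sum_norm_le) (auto simp: norm_mult intro!: mult_left_mono E)
    also have "\<dots> = (k * e) * nrm N (vdiff x y)"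
      by (simp add: k_def sum_distrib_right mult.assoc)
    also have "\<dots> \<le> 1 / 2 * nrm N (vdiff x y)" by (intro mult_right_mono e) auto
    finally show ?thesis by simp
  qed
  have inj: "e j = 0" if z: "\<And>i. i < N \<Longrightarrow> (\<Sum>j<N. K i j * e j) = 0" and "j < N" for e :: "nat \<Rightarrow> complex" and j
  proof -
    have "0 = (\<Sum>i<N. J j i * (\<Sum>l<N. K i l * e l))" using z by simp
    also have "\<dots> = (\<Sum>i<N. \<Sum>l<N. (J j i * K i l) * e l)" by (simp add: sum_distrib_left mult.assoc)
    also have "\<dots> = (\<Sum>l<N. \<Sum>i<N. (J j i * K i l) * e l)" by (rule sum.swap)
    also have "\<dots> = (\<Sum>l<N. (if j = l then 1 else 0) * e l)"
      unfolding sum_distrib_right[symmetric] by (intro sum.cong) (use JK that in auto)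
    also have "\<dots> = e j"
      using that by (simp add: if_distrib[of "\<lambda>c. c * _"] cong: if_cong)
    finally show ?thesis by simp
  qed
  then have "injective_matrix N K" unfolding injective_matrix_def by blast
  from that[of r K, OF r(1) contr this] show ?thesis .
qed

text \<open>
  If \<open>h x = h y\<close>, the contraction estimate says that the distance of \<open>x\<close> and \<open>y\<close> is at most half of itself.
\<close>

lemma regular_locally_injective:
  assumes h: "\<And>j. j < N \<Longrightarrow> polyfun N n (h j)" and reg: "regular_at N h a"
  shows "\<exists>r>0. \<forall>x\<in>cn N. \<forall>y\<in>cn N. nrm N (vdiff x a) < r \<longrightarrow> nrm N (vdiff y a) < r \<longrightarrow>
    (\<forall>j<N. h j x = h j y) \<longrightarrow> x = y"
proof -
  obtain r K where r: "r > 0" and K: "\<And>x y. nrm N (vdiff x a) < r \<Longrightarrow> nrm N (vdiff y a) < r \<Longrightarrow>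
       nrm N (\<lambda>i. x i - y i - (\<Sum>j<N. K i j * (h j x - h j y))) \<le> nrm N (vdiff x y) / 2"
    by (rule newton_contraction[OF assms], assumption) (rule that)
  have "x = y" if "x \<in> cn N" "y \<in> cn N" "nrm N (vdiff x a) < r" "nrm N (vdiff y a) < r"
    "\<forall>j<N. h j x = h j y" for x y
  proof -
    have "nrm N (vdiff x y) \<le> nrm N (vdiff x y) / 2" using K[of x y] that by simp
    then have "nrm N (vdiff x y) = 0" using nrm_nonneg[of N "vdiff x y"] by linarith
    then have "vdiff x y = (\<lambda>_. 0)" using nrm_zero_iff that by blast
    then show ?thesis by (auto simp: fun_eq_iff)
  qed
  then show ?thesis using r by blast
qed

text \<open>
  The equation \<open>h s = h a + t v\<close> is solved by the simplified Newton iteration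
  \<open>X \<mapsto> X - K (h X - h a - t v)\<close>, started at the constant \<open>a\<close>. All iterates are polynomials in \<open>t\<close>,
  and they converge uniformly for small \<open>t\<close>; so the solution depends holomorphically on \<open>t\<close>.
\<close>

lemma regular_local_section:
  assumes h: "\<And>j. j < N \<Longrightarrow> polyfun N n (h j)" and reg: "regular_at N h a"
    and a: "a \<in> cn N" and v: "v \<in> cn N" and rho: "\<rho> > 0"
  shows "\<exists>d>0. \<exists>s. s 0 = a \<and> (\<forall>i<N. (\<lambda>t. s t i) holomorphic_on ball 0 d) \<and>
    (\<forall>t\<in>ball 0 d. s t \<in> cn N \<and> nrm N (vdiff (s t) a) < \<rho> \<and> (\<forall>j<N. h j (s t) = h j a + t * v j))"
proof -
  obtain r0 K where r0: "r0 > 0" and K0: "\<And>x y. nrm N (vdiff x a) < r0 \<Longrightarrow> nrm N (vdiff y a) < r0 \<Longrightarrow>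
       nrm N (\<lambda>i. x i - y i - (\<Sum>j<N. K i j * (h j x - h j y))) \<le> nrm N (vdiff x y) / 2"
    and inj: "injective_matrix N K"
    by (rule newton_contraction[OF h reg], assumption) (rule that)
  define r where "r = min r0 \<rho>"
  have r: "r > 0" using r0 rho by (simp add: r_def)
  have K: "nrm N (\<lambda>i. x i - y i - (\<Sum>j<N. K i j * (h j x - h j y))) \<le> nrm N (vdiff x y) / 2"
    if "nrm N (vdiff x a) < r" "nrm N (vdiff y a) < r" for x y
    using K0 that by (simp add: r_def)
  define k where "k = nrm N (\<lambda>i. \<Sum>j<N. K i j * v j)"
  have k0: "k \<ge> 0" by (simp add: k_def)
  \<comment> \<open>with this bound for \<open>t\<close> the first step has length at most \<open>r / 4\<close>, so all iterates stay within \<open>r / 2\<close> of \<open>a\<close>\<close>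
  define d where "d = r / (4 * (1 + k))"
  have d: "d > 0" using r k0 by (simp add: d_def)
  have dk: "cmod t * k \<le> r / 4" if "cmod t < d" for t
  proof -
    have "cmod t * k \<le> d * (1 + k)" using that k0 d by (intro mult_mono) auto
    also have "\<dots> = r / 4"
    proof -
      have "r / (4 * s) * s = r / 4" if "s \<noteq> 0" for s :: real using that by simp
      then show ?thesis using k0 unfolding d_def by (metis add_nonneg_eq_0_iff zero_le_one zero_neq_one)
    qed
    finally show ?thesis .
  qed
  define G where "G = (\<lambda>Y t i. if i < N then Y t i - (\<Sum>j<N. K i j * (h j (Y t) - h j a - t * v j)) else 0)"
  define X where "X = rec_nat (\<lambda>_::complex. a) (\<lambda>_. G)"
  have "X (Suc m) = G (X m)" for m by (simp add: X_def)
  note XG = this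
  have X0: "X 0 t = a" for t by (simp add: X_def)
  have XS: "X (Suc m) t = (\<lambda>i. if i < N then X m t i - (\<Sum>j<N. K i j * (h j (X m t) - h j a - t * v j)) else 0)"
    for m t by (simp add: XG G_def)
  have Xcn: "X m t \<in> cn N" for m t using a by (cases m) (auto simp: X0 XS cn_def)
  have step: "nrm N (vdiff (X (Suc m) t) (X m t)) \<le> (r / 4) * (1 / 2) ^ m \<and>
      nrm N (vdiff (X m t) a) \<le> (r / 2) * (1 - (1 / 2) ^ m)" if t: "cmod t < d" for m t
  proof (induction m)
    case 0
    have "nrm N (vdiff (X (Suc 0) t) (X 0 t)) = nrm N (\<lambda>i. t * (\<Sum>j<N. K i j * v j))"
      unfolding nrm_def by (intro sum.cong) (auto simp: XS X0 sum_distrib_left sum_negf mult_ac)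
    also have "\<dots> = cmod t * k" by (simp only: nrm_scale k_def)
    finally have "nrm N (vdiff (X (Suc 0) t) (X 0 t)) \<le> r / 4" using dk[OF t] by linarith
    moreover have "nrm N (vdiff (X 0 t) a) = 0" by (simp add: X0 nrm_def)
    ultimately show ?case by simp
  next
    case (Suc m)
    have p: "(1 / 2 :: real) ^ m > 0" by simp
    have "nrm N (vdiff (X (Suc m) t) a) \<le> nrm N (vdiff (X (Suc m) t) (X m t)) + nrm N (vdiff (X m t) a)"
      by (rule nrm_triangle_diff)
    also have "\<dots> \<le> (r / 4) * (1 / 2) ^ m + (r / 2) * (1 - (1 / 2) ^ m)" using Suc by linarith
    also have "\<dots> = (r / 2) * (1 - (1 / 2) ^ Suc m)" by (simp add: algebra_simps)
    finally have 1: "nrm N (vdiff (X (Suc m) t) a) \<le> (r / 2) * (1 - (1 / 2) ^ Suc m)" .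
    have lt: "(r / 2) * (1 - (1 / 2) ^ l) < r" for l
    proof -
      have "(r / 2) * (1 - (1 / 2) ^ l) \<le> (r / 2) * 1" using r by (intro mult_left_mono) auto
      then show ?thesis using r by linarith
    qed
    have eq: "nrm N (vdiff (X (Suc (Suc m)) t) (X (Suc m) t)) =
        nrm N (\<lambda>i. X (Suc m) t i - X m t i - (\<Sum>j<N. K i j * (h j (X (Suc m) t) - h j (X m t))))"
      unfolding nrm_def
    proof (intro sum.cong refl)
      fix i assume i: "i \<in> {..<N}"
      have "X (Suc (Suc m)) t i - X (Suc m) t i = - (\<Sum>j<N. K i j * (h j (X (Suc m) t) - h j a - t * v j))"
        using i by (subst XS) simp
      moreover have "X (Suc m) t i - X m t i = - (\<Sum>j<N. K i j * (h j (X m t) - h j a - t * v j))"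
        using i by (subst XS) simp
      moreover have "(\<Sum>j<N. K i j * (h j (X (Suc m) t) - h j a - t * v j))
         = (\<Sum>j<N. K i j * (h j (X (Suc m) t) - h j (X m t))) + (\<Sum>j<N. K i j * (h j (X m t) - h j a - t * v j))"
        unfolding sum.distrib[symmetric] by (intro sum.cong) (auto simp: algebra_simps)
      moreover have "p - q = q - r - A" if "p - q = - S" "q - r = - B" "S = A + B" for p q r A B S :: complex
        unfolding that(1) that(2) that(3) by simp
      ultimately have "X (Suc (Suc m)) t i - X (Suc m) t i =
          X (Suc m) t i - X m t i - (\<Sum>j<N. K i j * (h j (X (Suc m) t) - h j (X m t)))"
        by blast
      then show "cmod (X (Suc (Suc m)) t i - X (Suc m) t i) =
          cmod (X (Suc m) t i - X m t i - (\<Sum>j<N. K i j * (h j (X (Suc m) t) - h j (X m t))))" by (rule arg_cong)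
    qed
    have "nrm N (vdiff (X (Suc (Suc m)) t) (X (Suc m) t)) \<le> nrm N (vdiff (X (Suc m) t) (X m t)) / 2"
      unfolding eq by (rule K) (use Suc 1 lt[of m] lt[of "Suc m"] in linarith)+
    also have "\<dots> \<le> (r / 4) * (1 / 2) ^ Suc m" using Suc by simp
    finally show ?case using 1 by blast
  qed
  have le: "nrm N (vdiff (X m t) a) \<le> r / 2" if "cmod t < d" for m t
  proof -
    have "(r / 2) * (1 - (1 / 2) ^ m) \<le> (r / 2) * 1" using r by (intro mult_left_mono) auto
    then show ?thesis using step[OF that, of m] by linarith
  qed
  have tele: "(\<Sum>m<l. X (Suc m) t i - X m t i) = X l t i - a i" for l t i
    by (subst sum_lessThan_telescope) (simp add: X0)
  define s where "s = (\<lambda>t i. a i + (\<Sum>m. X (Suc m) t i - X m t i))"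
  have ulim: "uniform_limit (ball 0 d) (\<lambda>l t. X l t i) (\<lambda>t. s t i) sequentially" if i: "i < N" for i
  proof -
    have "uniform_limit (ball 0 d) (\<lambda>l t. \<Sum>m<l. X (Suc m) t i - X m t i)
        (\<lambda>t. \<Sum>m. X (Suc m) t i - X m t i) sequentially"
    proof (rule Weierstrass_m_test)
      fix m t assume "t \<in> ball (0::complex) d"
      then show "norm (X (Suc m) t i - X m t i) \<le> (r / 4) * (1 / 2) ^ m"
        using step[of t m] cmod_le_nrm[OF i, of "vdiff (X (Suc m) t) (X m t)"] by auto
    qed (auto intro!: summable_mult summable_geometric)
    then have "uniform_limit (ball 0 d) (\<lambda>l t. X l t i - a i) (\<lambda>t. s t i - a i) sequentially"
      by (simp add: tele s_def)
    then show ?thesis by (simp add: uniform_limit_iff dist_norm)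
  qed
  have lim: "(\<lambda>l. X l t i) \<longlonglongrightarrow> s t i" if "i < N" "cmod t < d" for i t
    using tendsto_uniform_limitI[OF ulim[OF that(1)], of t] that by simp
  have Xhol: "(\<lambda>t. X m t i) holomorphic_on UNIV" for m i
  proof (induction m arbitrary: i)
    case 0
    then show ?case by (simp add: X0)
  next
    case (Suc m)
    show ?case
    proof (cases "i < N")
      case True
      then show ?thesis
        by (simp add: XS) (intro holomorphic_intros Suc polyfun_holomorphic[OF h], auto intro: Suc)
    qed (simp add: XS)
  qed
  have shol: "(\<lambda>t. s t i) holomorphic_on ball 0 d" if "i < N" for i
  proof (rule holomorphic_uniform_sequence[of _ "\<lambda>l t. X l t i"])
    fix t :: complex assume "t \<in> ball 0 d"
    then obtain e where "e > 0" "cball t e \<subseteq> ball 0 d" using open_contains_cball by blast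
    then show "\<exists>e>0. cball t e \<subseteq> ball 0 d \<and> uniform_limit (cball t e) (\<lambda>l t. X l t i) (\<lambda>t. s t i) sequentially"
      using uniform_limit_on_subset[OF ulim[OF that]] by blast
  qed (auto intro: holomorphic_on_subset[OF Xhol])
  have scn: "s t \<in> cn N" for t
    using a Xcn by (auto simp: s_def cn_def)
  have s0: "s 0 = a"
  proof -
    have "X m 0 = a" for m
    proof (induction m)
      case (Suc m)
      show ?case by (rule ext) (use a in \<open>auto simp: XS Suc cn_def\<close>)
    qed (simp add: X0)
    then show ?thesis by (simp add: s_def)
  qed
  have main: "nrm N (vdiff (s t) a) < \<rho> \<and> (\<forall>j<N. h j (s t) = h j a + t * v j)" if t: "cmod t < d" for t
  proof
    have "((\<lambda>l. nrm N (vdiff (X l t) a)) \<longlongrightarrow> nrm N (vdiff (s t) a)) sequentially"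
      unfolding nrm_def by (intro tendsto_intros lim t) auto
    then have "nrm N (vdiff (s t) a) \<le> r / 2"
      by (rule tendsto_upperbound) (use le[OF t] in auto)
    then show "nrm N (vdiff (s t) a) < \<rho>" using r by (auto simp: r_def)
    have hl: "(\<lambda>l. h j (X l t)) \<longlonglongrightarrow> h j (s t)" if "j < N" for j
      by (rule polyfun_tendsto[OF h[OF that]]) (use lim t in auto)
    \<comment> \<open>the limit is a fixed point of the iteration\<close>
    have Kz: "(\<Sum>j<N. K i j * (h j (s t) - h j a - t * v j)) = 0" if i: "i < N" for i
    proof -
      have "(\<lambda>l. \<Sum>j<N. K i j * (h j (X l t) - h j a - t * v j)) \<longlonglongrightarrow>
          (\<Sum>j<N. K i j * (h j (s t) - h j a - t * v j))"
        by (intro tendsto_intros hl) auto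
      moreover have "(\<lambda>l. X l t i - X (Suc l) t i) \<longlonglongrightarrow> s t i - s t i"
        by (intro tendsto_diff lim i t LIMSEQ_Suc)
      moreover have "(\<lambda>l. X l t i - X (Suc l) t i) = (\<lambda>l. \<Sum>j<N. K i j * (h j (X l t) - h j a - t * v j))"
        using i by (simp add: XS)
      ultimately show "(\<Sum>j<N. K i j * (h j (s t) - h j a - t * v j)) = 0"
        using LIMSEQ_unique by fastforce
    qed
    from inj[unfolded injective_matrix_def, THEN spec, of "\<lambda>j. h j (s t) - h j a - t * v j"] Kz
    have "h j (s t) - h j a - t * v j = 0" if "j < N" for j using that by simp
    then show "\<forall>j<N. h j (s t) = h j a + t * v j" by (simp add: algebra_simps)
  qed
  show ?thesis
    by (rule exI[of _ d], intro conjI d exI[of _ s]) (use s0 shol scn main in auto)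
qed

section \<open>Fibres and traces of proper polynomial maps\<close>

text \<open>
  Padding by \<open>0\<close> makes the value again a point of \<open>cn N\<close>.
\<close>

definition himg :: "nat \<Rightarrow> (nat \<Rightarrow> (nat \<Rightarrow> complex) \<Rightarrow> complex) \<Rightarrow> (nat \<Rightarrow> complex) \<Rightarrow> nat \<Rightarrow> complex"
  where "himg N h x = (\<lambda>j. if j < N then h j x else 0)"

lemma himg_in_cn [simp, intro]: "himg N h x \<in> cn N"
  by (simp add: himg_def cn_def)

lemma prod_linear_factors_dvd:
  fixes G :: "complex poly"
  assumes "finite E" "\<And>e. e \<in> E \<Longrightarrow> poly G e = 0"
  shows "(\<Prod>e\<in>E. [:-e, 1:]) dvd G"
  using assms
proof (induction E arbitrary: G rule: finite_induct)
  case (insert e E)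
  obtain G1 where G1: "G = [:-e, 1:] * G1" using insert.prems[of e] by (auto simp: poly_eq_0_iff_dvd)
  have "poly G1 e' = 0" if "e' \<in> E" for e'
    using insert.prems[of e'] insert.hyps that by (auto simp: G1)
  then have "(\<Prod>e\<in>E. [:-e, 1:]) dvd G1" by (rule insert.IH)
  then show ?case using insert.hyps by (simp add: G1 mult_dvd_mono del: mult_pCons_left)
qed simp

text \<open>
  The growth condition \<open>proper\<close> says more than that preimages of bounded sets are bounded: it bounds
  the norm of the points over a value by the power \<open>1 / n\<close> of the norm of the value, and the degree bound
  for traces rests on this exponent. For \<open>disc\<close> any polynomial is admitted whose nonvanishing at a value
  guarantees that all points over this value are regular.
\<close>

locale proper_polynomial_map =
  fixes N n e :: nat and h :: "nat \<Rightarrow> (nat \<Rightarrow> complex) \<Rightarrow> complex"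
    and disc :: "(nat \<Rightarrow> complex) \<Rightarrow> complex" and C :: real
  assumes n_pos: "0 < n" and C_pos: "0 < C"
    and poly_h: "\<And>j. j < N \<Longrightarrow> polyfun N n (h j)"
    and poly_disc: "polyfun N e disc"
    and proper: "\<And>x. x \<in> cn N \<Longrightarrow> nrm N x ^ n \<le> C * (1 + nrm N (himg N h x))"
    and regular: "\<And>x. x \<in> cn N \<Longrightarrow> disc (himg N h x) \<noteq> 0 \<Longrightarrow> regular_at N h x"
    and disc_nonzero: "\<exists>x\<in>cn N. disc (himg N h x) \<noteq> 0"
begin

definition fibre :: "(nat \<Rightarrow> complex) \<Rightarrow> (nat \<Rightarrow> complex) set"
  where "fibre c = {x \<in> cn N. himg N h x = c}"

lemma fibreD: "x \<in> fibre c \<Longrightarrow> x \<in> cn N" "x \<in> fibre c \<Longrightarrow> himg N h x = c"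
  "x \<in> fibre c \<Longrightarrow> j < N \<Longrightarrow> h j x = c j"
  by (auto simp: fibre_def himg_def)

lemma fibreI: "x \<in> cn N \<Longrightarrow> c \<in> cn N \<Longrightarrow> (\<And>j. j < N \<Longrightarrow> h j x = c j) \<Longrightarrow> x \<in> fibre c"
  by (auto simp: fibre_def himg_def cn_def)

lemma fibre_bounded: "x \<in> fibre c \<Longrightarrow> nrm N x \<le> 1 + C * (1 + nrm N c)"
proof -
  assume x: "x \<in> fibre c"
  have le: "nrm N x ^ n \<le> C * (1 + nrm N c)" using proper fibreD[OF x] by force
  have pos: "0 \<le> C * (1 + nrm N c)" using C_pos by auto
  show ?thesis
  proof (cases "nrm N x \<le> 1")
    case False
    then have "nrm N x ^ 1 \<le> nrm N x ^ n" using n_pos by (intro power_increasing) auto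
    then show ?thesis using le by simp
  qed (use pos in auto)
qed

lemma fibre_limit:
  assumes x: "\<And>k. x k \<in> fibre (c k)" and c: "c0 \<in> cn N" "\<And>j. j < N \<Longrightarrow> (\<lambda>k. c k j) \<longlonglongrightarrow> c0 j"
  shows "\<exists>r l. strict_mono (r::nat\<Rightarrow>nat) \<and> l \<in> fibre c0 \<and> (\<forall>i<N. (\<lambda>k. x (r k) i) \<longlonglongrightarrow> l i)"
proof -
  have "(\<lambda>k. nrm N (vdiff (c k) c0)) \<longlonglongrightarrow> 0" using c(2) by (simp add: tendsto_nrm_iff)
  then have "Bseq (\<lambda>k. nrm N (vdiff (c k) c0))" by (rule convergent_imp_Bseq[OF convergentI])
  then obtain B where B: "\<And>k. norm (nrm N (vdiff (c k) c0)) \<le> B" by (auto simp: Bseq_def)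
  have cb: "nrm N (c k) \<le> nrm N c0 + B" for k
    using nrm_triangle[of N "vdiff (c k) c0" c0] B[of k] by simp
  have "nrm N (x k) \<le> 1 + C * (1 + (nrm N c0 + B))" for k
  proof -
    have "nrm N (x k) \<le> 1 + C * (1 + nrm N (c k))" using fibre_bounded[OF x] .
    also have "\<dots> \<le> 1 + C * (1 + (nrm N c0 + B))" using cb C_pos by auto
    finally show ?thesis .
  qed
  from bounded_sequence_subsequence[of x N, OF fibreD(1)[OF x] this]
  obtain r l where rl: "strict_mono (r::nat\<Rightarrow>nat)" "l \<in> cn N" "\<And>i. i < N \<Longrightarrow> (\<lambda>k. x (r k) i) \<longlonglongrightarrow> l i" by blast
  have "h j l = c0 j" if j: "j < N" for j
  proof -
    have "(\<lambda>k. h j (x (r k))) \<longlonglongrightarrow> h j l" by (rule polyfun_tendsto[OF poly_h[OF j]]) (rule rl)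
    moreover have "(\<lambda>k. h j (x (r k))) = (\<lambda>k. c (r k) j)" using fibreD(3)[OF x j] by simp
    moreover have "(\<lambda>k. c (r k) j) \<longlonglongrightarrow> c0 j"
      using LIMSEQ_subseq_LIMSEQ[OF c(2)[OF j] rl(1)] by (simp add: o_def)
    ultimately show ?thesis using LIMSEQ_unique by auto
  qed
  then have "l \<in> fibre c0" using rl c by (intro fibreI) auto
  with rl show ?thesis by blast
qed

lemma regular_on_fibre: "x \<in> fibre c \<Longrightarrow> disc c \<noteq> 0 \<Longrightarrow> regular_at N h x"
  using regular fibreD by auto

text \<open>
  An infinite fibre would accumulate, by properness at a point of the same fibre, where \<open>h\<close> is locally
  injective.
\<close>

lemma finite_fibre:
  assumes c: "c \<in> cn N" "disc c \<noteq> 0"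
  shows "finite (fibre c)"
proof (rule ccontr)
  assume "infinite (fibre c)"
  then obtain f :: "nat \<Rightarrow> _" where f: "inj f" "range f \<subseteq> fibre c"
    using infinite_countable_subset by blast
  have fm: "f m \<in> fibre c" for m using f by auto
  obtain r l where rl: "strict_mono (r::nat\<Rightarrow>nat)" "l \<in> fibre c" "\<forall>i<N. (\<lambda>k. f (r k) i) \<longlonglongrightarrow> l i"
    using fibre_limit[of f "\<lambda>_. c" c, OF fm c(1) tendsto_const] by blast
  obtain s where s: "s > 0" "\<And>x y. x\<in>cn N \<Longrightarrow> y\<in>cn N \<Longrightarrow> nrm N (vdiff x l) < s \<Longrightarrow> nrm N (vdiff y l) < s \<Longrightarrow>
    (\<forall>j<N. h j x = h j y) \<Longrightarrow> x = y"
    using regular_locally_injective[OF poly_h regular_on_fibre[OF rl(2) c(2)]] by blast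
  have "(\<lambda>k. nrm N (vdiff (f (r k)) l)) \<longlonglongrightarrow> 0" using rl(3) by (simp add: tendsto_nrm_iff)
  then have "\<forall>\<^sub>F k in sequentially. nrm N (vdiff (f (r k)) l) < s"
    using s(1) by (rule order_tendstoD)
  then obtain k0 where k0: "\<And>k. k \<ge> k0 \<Longrightarrow> nrm N (vdiff (f (r k)) l) < s"
    by (auto simp: eventually_sequentially)
  have "f (r k0) = f (r (Suc k0))"
  proof (rule s(2))
    show "\<forall>j<N. h j (f (r k0)) = h j (f (r (Suc k0)))" using fibreD(3)[OF fm] by simp
  qed (use k0 fibreD(1)[OF fm] in auto)
  then have "r k0 = r (Suc k0)" using f by (auto dest: injD)
  then show False using rl(1) by (metis lessI less_irrefl strict_monoD)
qed

text \<open>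
  Through each point of the fibre runs a local section. The sections stay in disjoint balls, and for small
  \<open>t\<close> they exhaust the fibre: further points would accumulate, as \<open>t\<close> tends to \<open>0\<close>, at a point of the
  fibre over \<open>c\<close>, and near this point \<open>h\<close> is injective.
\<close>

lemma fibre_sections:
  assumes c: "c \<in> cn N" "disc c \<noteq> 0" and v: "v \<in> cn N"
  obtains d S where "d > 0"
    and "\<And>x. x \<in> fibre c \<Longrightarrow> S x 0 = x"
    and "\<And>x i. x \<in> fibre c \<Longrightarrow> i < N \<Longrightarrow> (\<lambda>t. S x t i) holomorphic_on ball 0 d"
    and "\<And>t. cmod t < d \<Longrightarrow> bij_betw (\<lambda>x. S x t) (fibre c) (fibre (ray c v t))"
proof -
  note fin = finite_fibre[OF c]
  have "\<forall>x\<in>fibre c. \<exists>s>0. \<forall>y\<in>cn N. \<forall>z\<in>cn N. nrm N (vdiff y x) < s \<longrightarrow> nrm N (vdiff z x) < s \<longrightarrow>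
    (\<forall>j<N. h j y = h j z) \<longrightarrow> y = z"
    using regular_locally_injective[OF poly_h regular_on_fibre[OF _ c(2)]] by blast
  from bchoice[OF this] obtain s where s: "\<And>x. x \<in> fibre c \<Longrightarrow> s x > 0"
    "\<And>x y z. x \<in> fibre c \<Longrightarrow> y \<in> cn N \<Longrightarrow> z \<in> cn N \<Longrightarrow> nrm N (vdiff y x) < s x \<Longrightarrow> nrm N (vdiff z x) < s x \<Longrightarrow>
    (\<forall>j<N. h j y = h j z) \<Longrightarrow> y = z" by blast
  define P where "P = {(x, y) \<in> fibre c \<times> fibre c. x \<noteq> y}"
  have finP: "finite P" unfolding P_def by (rule finite_subset[of _ "fibre c \<times> fibre c"]) (use fin in auto)
  \<comment> \<open>the balls of radius \<open>\<rho>\<close> around the points of the fibre are disjoint, and \<open>h\<close> is injective on each of them\<close>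
  define \<rho> where "\<rho> = Min (insert 1 (s ` fibre c \<union> (\<lambda>(x, y). nrm N (vdiff x y) / 2) ` P))"
  have npos: "nrm N (vdiff x y) > 0" if "(x, y) \<in> P" for x y
  proof -
    have "vdiff x y \<in> cn N" using that fibreD(1) by (auto simp: P_def)
    moreover have "vdiff x y \<noteq> (\<lambda>_. 0)" using that by (auto simp: P_def fun_eq_iff)
    ultimately show ?thesis using nrm_zero_iff nrm_nonneg[of N "vdiff x y"] by (metis less_eq_real_def)
  qed
  have \<rho>: "\<rho> > 0" unfolding \<rho>_def
    by (subst Min_gr_iff) (use fin finP s(1) npos in auto)
  have \<rho>s: "\<rho> \<le> s x" if "x \<in> fibre c" for x
    unfolding \<rho>_def by (rule Min_le) (use fin finP that in auto)
  have \<rho>d: "2 * \<rho> \<le> nrm N (vdiff x y)" if "x \<in> fibre c" "y \<in> fibre c" "x \<noteq> y" for x y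
  proof -
    have "\<rho> \<le> nrm N (vdiff x y) / 2"
      unfolding \<rho>_def by (rule Min_le) (use fin finP that in \<open>auto simp: P_def image_iff\<close>)
    then show ?thesis by simp
  qed
  have "\<forall>x\<in>fibre c. \<exists>dS. fst dS > 0 \<and> snd dS 0 = x \<and> (\<forall>i<N. (\<lambda>t. snd dS t i) holomorphic_on ball 0 (fst dS)) \<and>
    (\<forall>t\<in>ball 0 (fst dS). snd dS t \<in> cn N \<and> nrm N (vdiff (snd dS t) x) < \<rho> \<and>
      (\<forall>j<N. h j (snd dS t) = h j x + t * v j))"
  proof
    fix x assume x: "x \<in> fibre c"
    from regular_local_section[OF poly_h regular_on_fibre[OF x c(2)] fibreD(1)[OF x] v \<rho>]
    obtain d S where "d > 0" "S 0 = x" "\<forall>i<N. (\<lambda>t. S t i) holomorphic_on ball 0 d"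
      "\<forall>t\<in>ball 0 d. S t \<in> cn N \<and> nrm N (vdiff (S t) x) < \<rho> \<and> (\<forall>j<N. h j (S t) = h j x + t * v j)" by blast
    then show "\<exists>dS. fst dS > 0 \<and> snd dS 0 = x \<and> (\<forall>i<N. (\<lambda>t. snd dS t i) holomorphic_on ball 0 (fst dS)) \<and>
    (\<forall>t\<in>ball 0 (fst dS). snd dS t \<in> cn N \<and> nrm N (vdiff (snd dS t) x) < \<rho> \<and>
      (\<forall>j<N. h j (snd dS t) = h j x + t * v j))" by (intro exI[of _ "(d, S)"]) auto
  qed
  from bchoice[OF this] obtain dS where dS: "\<And>x. x \<in> fibre c \<Longrightarrow> fst (dS x) > 0 \<and> snd (dS x) 0 = x \<and>
     (\<forall>i<N. (\<lambda>t. snd (dS x) t i) holomorphic_on ball 0 (fst (dS x))) \<and>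
    (\<forall>t\<in>ball 0 (fst (dS x)). snd (dS x) t \<in> cn N \<and> nrm N (vdiff (snd (dS x) t) x) < \<rho> \<and>
      (\<forall>j<N. h j (snd (dS x) t) = h j x + t * v j))" by blast
  define S where "S = (\<lambda>x. snd (dS x))"
  define d0 where "d0 = Min (insert 1 ((\<lambda>x. fst (dS x)) ` fibre c))"
  have d0: "d0 > 0" unfolding d0_def by (subst Min_gr_iff) (use fin dS in auto)
  have d0le: "d0 \<le> fst (dS x)" if "x \<in> fibre c" for x
    unfolding d0_def by (rule Min_le) (use fin that in auto)
  have Sf: "S x t \<in> fibre (ray c v t)" and Sn: "nrm N (vdiff (S x t) x) < \<rho>"
    if x: "x \<in> fibre c" and t: "cmod t < d0" for x t
  proof -
    have "t \<in> ball 0 (fst (dS x))" using d0le[OF x] t by simp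
    then have "S x t \<in> cn N \<and> nrm N (vdiff (S x t) x) < \<rho> \<and> (\<forall>j<N. h j (S x t) = h j x + t * v j)"
      using dS[OF x] unfolding S_def by blast
    then show "S x t \<in> fibre (ray c v t)" "nrm N (vdiff (S x t) x) < \<rho>"
      using fibreD(3)[OF x] c v by (auto intro!: fibreI simp: ray_def[of c])
         (auto simp: cn_def)
  qed
  \<comment> \<open>for small \<open>t\<close> every point over \<open>c + t v\<close> lies in one of these balls, by properness\<close>
  have "\<exists>d1>0. \<forall>t y. cmod t < d1 \<longrightarrow> y \<in> fibre (ray c v t) \<longrightarrow> (\<exists>x\<in>fibre c. nrm N (vdiff y x) < \<rho>)"
  proof (rule ccontr)
    define far where "far = (\<lambda>ty. snd ty \<in> fibre (ray c v (fst ty)) \<and>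
      \<not> (\<exists>x\<in>fibre c. nrm N (vdiff (snd ty) x) < \<rho>))"
    assume neg: "\<not> ?thesis"
    have ex: "\<exists>ty. cmod (fst ty) < d1 \<and> far ty" if "d1 > 0" for d1
      using neg that unfolding far_def by (metis fst_conv snd_conv)
    have "\<forall>k. \<exists>ty. cmod (fst ty) < 1 / Suc k \<and> far ty" by (intro allI ex) simp
    from choice[OF this] obtain ty where ty0: "\<And>k. cmod (fst (ty k)) < 1 / Suc k \<and> far (ty k)" by blast
    define t where "t = (\<lambda>k. fst (ty k))"
    define y where "y = (\<lambda>k. snd (ty k))"
    have ty: "cmod (t k) < 1 / Suc k" "y k \<in> fibre (ray c v (t k))"
      "x \<in> fibre c \<Longrightarrow> \<not> nrm N (vdiff (y k) x) < \<rho>" for k x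
      using ty0[of k] by (auto simp: far_def t_def y_def)
    have t0: "t \<longlonglongrightarrow> 0"
      by (rule Lim_null_comparison[OF _ LIMSEQ_inverse_real_of_nat])
         (use ty(1) in \<open>auto intro!: always_eventually less_imp_le simp: inverse_eq_divide\<close>)
    have "(\<lambda>k. ray c v (t k) j) \<longlonglongrightarrow> c j" for j
    proof -
      have "(\<lambda>k. c j + t k * v j) \<longlonglongrightarrow> c j + 0 * v j" by (intro tendsto_intros t0)
      then show ?thesis by (simp add: ray_def)
    qed
    from fibre_limit[OF ty(2) c(1) this]
    obtain r l where rl: "l \<in> fibre c" "\<forall>i<N. (\<lambda>k. y (r k) i) \<longlonglongrightarrow> l i" by blast
    then have "(\<lambda>k. nrm N (vdiff (y (r k)) l)) \<longlonglongrightarrow> 0" by (simp add: tendsto_nrm_iff)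
    then have "\<forall>\<^sub>F k in sequentially. nrm N (vdiff (y (r k)) l) < \<rho>" using \<rho> by (rule order_tendstoD)
    then show False using ty(3)[OF rl(1)] by (auto simp: eventually_sequentially)
  qed
  then obtain d1 where d1: "d1 > 0"
    "\<And>t y. cmod t < d1 \<Longrightarrow> y \<in> fibre (ray c v t) \<Longrightarrow> \<exists>x\<in>fibre c. nrm N (vdiff y x) < \<rho>" by blast
  show ?thesis
  proof (rule that[of "min d0 d1" S])
    show "min d0 d1 > 0" using d0 d1 by simp
    fix x assume x: "x \<in> fibre c"
    show "S x 0 = x" using dS[OF x] by (simp add: S_def)
    fix i assume i: "i < N"
    then have "(\<lambda>t. S x t i) holomorphic_on ball 0 (fst (dS x))" using dS[OF x] by (simp add: S_def)
    then show "(\<lambda>t. S x t i) holomorphic_on ball 0 (min d0 d1)"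
      by (rule holomorphic_on_subset) (use d0le[OF x] in auto)
  next
    fix t assume t: "cmod t < min d0 d1"
    show "bij_betw (\<lambda>x. S x t) (fibre c) (fibre (ray c v t))"
    proof (rule bij_betw_imageI)
      show "inj_on (\<lambda>x. S x t) (fibre c)"
      proof (rule inj_onI, rule ccontr)
        fix x y assume xy: "x \<in> fibre c" "y \<in> fibre c" "S x t = S y t" "x \<noteq> y"
        have "nrm N (vdiff x y) \<le> nrm N (vdiff x (S x t)) + nrm N (vdiff (S x t) y)"
          by (rule nrm_triangle_diff)
        also have "\<dots> < \<rho> + \<rho>"
          using Sn[OF xy(1), of t] Sn[OF xy(2), of t] t xy(3)
          by (simp add: nrm_commute[of N x] del: One_nat_def)
        finally show False using \<rho>d[OF xy(1,2,4)] by simp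
      qed
      show "(\<lambda>x. S x t) ` fibre c = fibre (ray c v t)"
      proof (intro equalityI subsetI)
        fix y assume y: "y \<in> fibre (ray c v t)"
        then obtain x where x: "x \<in> fibre c" "nrm N (vdiff y x) < \<rho>" using d1(2) t by auto
        have "S x t \<in> fibre (ray c v t)" using Sf x t by auto
        then have "S x t = y"
          using fibreD(3)[of _ "ray c v t"] y x Sn[OF x(1), of t] t \<rho>s[OF x(1)]
          by (intro s(2)[OF x(1)]) (auto dest: fibreD(1))
        then show "y \<in> (\<lambda>x. S x t) ` fibre c" using x by blast
      qed (use Sf t in auto)
    qed
  qed
qed

lemma line_meets_discriminant_finitely:
  assumes "disc c \<noteq> 0"
  shows "finite {t. disc (ray c v t) = 0}"
proof -
  obtain p where p: "\<And>t. disc (ray c v t) = poly p t" using polyfun_ray[OF poly_disc] by blast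
  have "poly p 0 \<noteq> 0" using p[of 0] assms by simp
  then have "p \<noteq> 0" by auto
  then show ?thesis using poly_roots_finite[of p] by (simp add: p)
qed

text \<open>
  The complex line through \<open>c\<close> and \<open>c'\<close> meets the zero set of \<open>disc\<close> in finitely many points. Their
  complement in the line is connected, and on it the number of points is locally constant.
\<close>

lemma card_fibre_constant:
  assumes c: "c \<in> cn N" "disc c \<noteq> 0" and c': "c' \<in> cn N" "disc c' \<noteq> 0"
  shows "card (fibre c) = card (fibre c')"
proof -
  define v where "v = vdiff c' c"
  have v: "v \<in> cn N" using c c' by (auto simp: v_def)
  define E where "E = {t. disc (ray c v t) = 0}"
  have E: "finite E" unfolding E_def by (rule line_meets_discriminant_finitely[OF c(2)])
  have conn: "connected (UNIV - E)"
    by (rule connected_open_diff_countable) (use E in \<open>auto intro: countable_finite\<close>)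
  have "card (fibre (ray c v 0)) = card (fibre (ray c v 1))"
  proof (rule connected_local_const[OF conn])
    show "0 \<in> UNIV - E" using c by (simp add: E_def)
    show "1 \<in> UNIV - E" using c' by (simp add: E_def v_def)
    show "\<forall>a\<in>UNIV - E. \<forall>\<^sub>F b in at a within UNIV - E. card (fibre (ray c v a)) = card (fibre (ray c v b))"
    proof
      fix a assume a: "a \<in> UNIV - E"
      have ca: "ray c v a \<in> cn N" "disc (ray c v a) \<noteq> 0" using a c v by (auto simp: E_def)
      obtain d S where d: "d > 0" "\<And>t. cmod t < d \<Longrightarrow>
          bij_betw (\<lambda>x. S x t) (fibre (ray c v a)) (fibre (ray (ray c v a) v t))"
        by (rule fibre_sections[OF ca v]) blast
      have "card (fibre (ray c v a)) = card (fibre (ray c v b))" if "dist b a < d" for b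
      proof -
        have "cmod (b - a) < d" using that by (simp add: dist_norm)
        from bij_betw_same_card[OF d(2)[OF this]] show ?thesis by (simp add: ray_ray)
      qed
      then show "\<forall>\<^sub>F b in at a within UNIV - E. card (fibre (ray c v a)) = card (fibre (ray c v b))"
        using d(1) by (auto simp: eventually_at)
    qed
  qed
  then show ?thesis by (simp add: v_def)
qed

text \<open>
  Away from the finite set of parameters with vanishing discriminant the trace is holomorphic, by the
  local sections. By properness the points of the fibre over \<open>c + t v\<close> have norm
  \<open>O(\<bar>t\<bar>\<^bsup>1/n\<^esup>)\<close>, so the trace is bounded near the exceptional parameters and is \<open>O(\<bar>t\<bar>\<^sup>T)\<close> at infinity.
  Riemann's theorem on removable singularities and Liouville's theorem make it a polynomial of degree at
  most \<open>T\<close>.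
\<close>

lemma trace_polynomial:
  assumes th: "polyfun N (n * T) \<theta>" and c: "c \<in> cn N" "disc c \<noteq> 0" and v: "v \<in> cn N"
  shows "\<exists>p. degree p \<le> T \<and>
    (\<forall>t. disc (ray c v t) \<noteq> 0 \<longrightarrow> poly p t = (\<Sum>x\<in>fibre (ray c v t). \<theta> x))"
proof -
  define f where "f = (\<lambda>t. \<Sum>x\<in>fibre (ray c v t). \<theta> x)"
  define E where "E = {t. disc (ray c v t) = 0}"
  have E: "finite E" unfolding E_def by (rule line_meets_discriminant_finitely[OF c(2)])
  have raycn: "ray c v t \<in> cn N" for t using c v by auto
  obtain C1 where C1: "C1 \<ge> 0" "\<And>x. cmod (\<theta> x) \<le> C1 * (1 + nrm N x) ^ (n * T)"
    using polyfun_growth[OF th] by blast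
  define A where "A = 2 ^ n * (1 + C * (1 + nrm N c + nrm N v))"
  have A0: "A \<ge> 0" using C_pos by (auto simp: A_def intro!: mult_nonneg_nonneg add_nonneg_nonneg)
  \<comment> \<open>properness, in the form needed for the growth of the trace\<close>
  have pw: "(1 + nrm N x) ^ n \<le> A * (1 + cmod t)" if x: "x \<in> fibre (ray c v t)" for x t
  proof -
    have "(1 + nrm N x) ^ n \<le> (2 * max 1 (nrm N x)) ^ n" by (intro power_mono) auto
    also have "\<dots> = 2 ^ n * max 1 (nrm N x) ^ n" by (rule power_mult_distrib)
    also have "\<dots> \<le> 2 ^ n * (1 + nrm N x ^ n)" by (intro mult_left_mono) (auto simp: max_def)
    also have "\<dots> \<le> 2 ^ n * (1 + C * (1 + (nrm N c + cmod t * nrm N v)))"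
    proof (intro mult_left_mono add_left_mono)
      have "nrm N x ^ n \<le> C * (1 + nrm N (ray c v t))" using proper fibreD[OF x] by force
      also have "\<dots> \<le> C * (1 + (nrm N c + cmod t * nrm N v))"
        using nrm_ray[of N c v t] C_pos by (intro mult_left_mono) auto
      finally show "nrm N x ^ n \<le> C * (1 + (nrm N c + cmod t * nrm N v))" .
    qed auto
    also have "\<dots> \<le> 2 ^ n * ((1 + C * (1 + nrm N c + nrm N v)) * (1 + cmod t))"
    proof (intro mult_left_mono)
      have "0 \<le> cmod t + C * nrm N v + C * (cmod t * (1 + nrm N c))"
        using C_pos by (auto intro!: add_nonneg_nonneg mult_nonneg_nonneg)
      then show "1 + C * (1 + (nrm N c + cmod t * nrm N v)) \<le> (1 + C * (1 + nrm N c + nrm N v)) * (1 + cmod t)"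
        by (simp add: algebra_simps)
    qed auto
    finally show ?thesis by (simp add: A_def mult.assoc)
  qed
  define K where "K = real (card (fibre c)) * (C1 * A ^ T)"
  have K0: "K \<ge> 0" using C1 A0 by (simp add: K_def)
  have fb: "cmod (f t) \<le> K * (1 + cmod t) ^ T" if t: "t \<notin> E" for t
  proof -
    have "cmod (\<theta> x) \<le> C1 * (A * (1 + cmod t)) ^ T" if "x \<in> fibre (ray c v t)" for x
    proof -
      have "cmod (\<theta> x) \<le> C1 * ((1 + nrm N x) ^ n) ^ T" using C1(2)[of x] by (simp add: power_mult)
      also have "\<dots> \<le> C1 * (A * (1 + cmod t)) ^ T"
        by (intro mult_left_mono power_mono pw that C1) auto
      finally show ?thesis .
    qed
    then have "cmod (f t) \<le> real (card (fibre (ray c v t))) * (C1 * (A * (1 + cmod t)) ^ T)"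
      unfolding f_def by (rule sum_norm_bound)
    also have "card (fibre (ray c v t)) = card (fibre c)"
      by (rule card_fibre_constant) (use raycn c t in \<open>auto simp: E_def\<close>)
    finally show ?thesis by (simp add: K_def power_mult_distrib mult_ac)
  qed
  have fdiff: "f field_differentiable (at a)" if a: "a \<notin> E" for a
  proof -
    have ca: "ray c v a \<in> cn N" "disc (ray c v a) \<noteq> 0" using a c v by (auto simp: E_def)
    obtain d S where d: "d > 0"
      and hol: "\<And>x i. x \<in> fibre (ray c v a) \<Longrightarrow> i < N \<Longrightarrow> (\<lambda>t. S x t i) holomorphic_on ball 0 d"
      and bij: "\<And>t. cmod t < d \<Longrightarrow> bij_betw (\<lambda>x. S x t) (fibre (ray c v a)) (fibre (ray (ray c v a) v t))"
      by (rule fibre_sections[OF ca v]) blast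
    have "(\<lambda>t. \<Sum>x\<in>fibre (ray c v a). \<theta> (S x t)) holomorphic_on ball 0 d"
      by (intro holomorphic_on_sum polyfun_holomorphic[OF th] hol)
    then have "((\<lambda>t. \<Sum>x\<in>fibre (ray c v a). \<theta> (S x t)) \<circ> (\<lambda>t. t - a)) holomorphic_on ball a d"
      by (rule holomorphic_on_compose_gen[rotated])
         (auto intro!: holomorphic_intros simp: dist_norm norm_minus_commute)
    moreover have "((\<lambda>t. \<Sum>x\<in>fibre (ray c v a). \<theta> (S x t)) \<circ> (\<lambda>t. t - a)) t = f t" if "t \<in> ball a d" for t
    proof -
      have "cmod (t - a) < d" using that by (simp add: dist_norm norm_minus_commute)
      from sum.reindex_bij_betw[OF bij[OF this], of \<theta>] show ?thesis by (simp add: f_def ray_ray)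
    qed
    ultimately have "f holomorphic_on ball a d" by (rule holomorphic_transform)
    then show ?thesis by (rule holomorphic_on_imp_differentiable_at) (use d in auto)
  qed
  \<comment> \<open>multiplied by \<open>Q\<close>, the locally bounded trace tends to \<open>0\<close> at the exceptional parameters, which are thus removable\<close>
  define Q where "Q = (\<Prod>e\<in>E. [:-e, 1:])"
  have Q0: "Q \<noteq> 0" using E by (simp add: Q_def)
  have degQ: "degree Q = card E" unfolding Q_def by (subst degree_prod_eq_sum_degree) auto
  have QE: "poly Q t = 0 \<longleftrightarrow> t \<in> E" for t using E by (auto simp: Q_def poly_prod)
  define M where "M = (\<Prod>e\<in>E. 1 + cmod e)"
  have Qb: "cmod (poly Q t) \<le> M * (1 + cmod t) ^ card E" for t
  proof -
    have "cmod (poly Q t) = (\<Prod>e\<in>E. cmod (t - e))" by (simp add: Q_def poly_prod prod_norm[symmetric])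
    also have "\<dots> \<le> (\<Prod>e\<in>E. (1 + cmod e) * (1 + cmod t))"
    proof (intro prod_mono conjI norm_ge_zero)
      fix e
      have "cmod (t - e) \<le> cmod t + cmod e" by (rule norm_triangle_ineq4)
      also have "\<dots> \<le> (1 + cmod e) * (1 + cmod t)" by (simp add: algebra_simps)
      finally show "cmod (t - e) \<le> (1 + cmod e) * (1 + cmod t)" .
    qed
    also have "\<dots> = M * (1 + cmod t) ^ card E" by (simp add: M_def prod.distrib)
    finally show ?thesis .
  qed
  have M0: "M \<ge> 0" by (auto simp: M_def intro!: prod_nonneg)
  define g where "g = (\<lambda>t. f t * poly Q t)"
  have gb: "cmod (g t) \<le> K * (1 + cmod t) ^ T * cmod (poly Q t)" for t
  proof (cases "t \<in> E")
    case True
    then have "poly Q t = 0" using QE by blast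
    then show ?thesis by (simp add: g_def)
  next
    case False
    then show ?thesis using fb by (simp add: g_def norm_mult mult_right_mono)
  qed
  have ghol: "g holomorphic_on UNIV"
  proof (rule no_isolated_singularity'[of E])
    show "g holomorphic_on UNIV - E"
      unfolding g_def by (intro holomorphic_intros)
        (use fdiff in \<open>auto simp: holomorphic_on_def intro: field_differentiable_at_within\<close>)
    fix z assume "z \<in> E"
    then have z: "poly Q z = 0" using QE by blast
    have "((\<lambda>t. K * (1 + cmod t) ^ T * cmod (poly Q t)) \<longlongrightarrow> K * (1 + cmod z) ^ T * cmod (poly Q z)) (at z)"
      by (intro tendsto_intros)
    then have "((\<lambda>t. K * (1 + cmod t) ^ T * cmod (poly Q t)) \<longlongrightarrow> 0) (at z)" using z by simp
    then have "(g \<longlongrightarrow> 0) (at z)" by (rule Lim_null_comparison[rotated]) (use gb in auto)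
    then show "(g \<longlongrightarrow> g z) (at z within UNIV)" using z by (simp add: g_def)
  qed (use E in auto)
  define m where "m = T + card E"
  have gl: "cmod (g t) \<le> (K * M * 2 ^ m) * cmod t ^ m" if t: "1 \<le> cmod t" for t
  proof -
    have "cmod (g t) \<le> K * (1 + cmod t) ^ T * cmod (poly Q t)" by (rule gb)
    also have "\<dots> \<le> K * (1 + cmod t) ^ T * (M * (1 + cmod t) ^ card E)"
      by (intro mult_left_mono Qb) (use K0 in auto)
    also have "\<dots> = K * M * (1 + cmod t) ^ m" by (simp add: m_def power_add mult_ac)
    also have "\<dots> \<le> K * M * (2 * cmod t) ^ m"
      by (intro mult_left_mono power_mono) (use K0 M0 t in auto)
    finally show ?thesis by (simp add: power_mult_distrib mult_ac)
  qed
  define G where "G = (\<Sum>k\<le>m. Polynomial.monom ((deriv ^^ k) g 0 / fact k) k)"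
  have G: "g t = poly G t" for t
    using Liouville_polynomial[OF ghol gl, where \<xi> = t] by (simp add: G_def poly_sum poly_monom)
  have degG: "degree G \<le> m" unfolding G_def
    by (intro degree_sum_le) (auto intro: order_trans[OF degree_monom_le])
  have "poly G e = 0" if "e \<in> E" for e using G[of e] QE[of e, THEN iffD2, OF that] by (simp add: g_def)
  then have "Q dvd G" unfolding Q_def by (intro prod_linear_factors_dvd E)
  then obtain p where p: "G = Q * p" by (rule dvdE)
  have "degree p \<le> T"
  proof (cases "p = 0")
    case False
    then have "degree G = card E + degree p" using Q0 degQ by (simp add: p degree_mult_eq)
    then show ?thesis using degG by (simp add: m_def)
  qed simp
  moreover have "poly p t = f t" if "disc (ray c v t) \<noteq> 0" for t
  proof -
    have "t \<notin> E" using that by (simp add: E_def)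
    then have "poly Q t \<noteq> 0" using QE by blast
    then show ?thesis using G[of t] by (simp add: g_def p)
  qed
  ultimately show ?thesis unfolding f_def by blast
qed

end

section \<open>The number of points in a regular fibre\<close>

text \<open>
  If \<open>p\<close> had a finite order \<open>k\<close> at \<open>0\<close>, then \<open>k \<le> M\<close>, and \<open>p\<close> divided by \<open>t\<^sup>k\<close> would have a nonzero
  limit.
\<close>

lemma poly_eq_0_if_small_near_0:
  fixes p :: "complex poly"
  assumes deg: "degree p \<le> M" and lim: "((\<lambda>t. poly p t / t ^ M) \<longlongrightarrow> 0) (at 0)"
  shows "p = 0"
proof (rule ccontr)
  assume p: "p \<noteq> 0"
  define k where "k = order 0 p"
  obtain r where r: "p = [:- 0, 1:] ^ k * r" "\<not> [:- 0, 1:] dvd r"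
    using order_decomp[OF p, of 0] by (auto simp: k_def)
  have r0: "poly r 0 \<noteq> 0" using r(2) by (simp add: poly_eq_0_iff_dvd)
  have kM: "k \<le> M" using order_degree[OF p, of 0] deg by (simp add: k_def)
  have "((\<lambda>t. (poly p t / t ^ M) * t ^ (M - k)) \<longlongrightarrow> 0 * 0 ^ (M - k)) (at 0)"
    by (intro tendsto_intros lim)
  moreover have "\<forall>\<^sub>F t in at 0. (poly p t / t ^ M) * t ^ (M - k) = poly r t"
  proof (rule eventually_mono[OF eventually_neq_at_within[of 0]])
    fix t :: complex assume t: "t \<noteq> 0"
    have "t ^ M = t ^ k * t ^ (M - k)" using kM by (simp add: power_add[symmetric])
    then show "(poly p t / t ^ M) * t ^ (M - k) = poly r t"
      using t by (simp add: r(1) poly_power)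
  qed
  ultimately have "((\<lambda>t. poly r t) \<longlongrightarrow> 0) (at 0)"
    using tendsto_cong by force
  moreover have "((\<lambda>t. poly r t) \<longlongrightarrow> poly r 0) (at 0)" by (intro tendsto_intros)
  ultimately show False using r0 tendsto_unique[OF trivial_limit_at] by blast
qed

lemma eventually_avoids_finite:
  assumes "finite (E :: complex set)"
  shows "\<forall>\<^sub>F t in at t0. t \<notin> E"
proof -
  have "open (- (E - {t0}))" using assms by (intro open_Compl finite_imp_closed) auto
  then have "\<forall>\<^sub>F t in at t0. t \<in> - (E - {t0})" by (rule eventually_at_in_open') auto
  moreover have "\<forall>\<^sub>F t in at t0. t \<noteq> t0" by (rule eventually_neq_at_within)
  ultimately show ?thesis by eventually_elim auto
qed

text \<open>
  One linear factor for each point of \<open>A\<close>, in a coordinate in which it differs from \<open>a\<close>.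
\<close>

lemma interpolating_polyfun:
  assumes A: "finite A" "A \<subseteq> cn N" and a: "a \<in> cn N" "a \<notin> A"
  shows "\<exists>G. polyfun N (card A) G \<and> G a = 1 \<and> (\<forall>b\<in>A. G b = 0)"
proof -
  have "\<exists>i<N. a i \<noteq> b i" if "b \<in> A" for b
    using cn_eqI[of a N b] a A that by blast
  then obtain i where i: "\<And>b. b \<in> A \<Longrightarrow> i b < N \<and> a (i b) \<noteq> b (i b)" by metis
  define G where "G = (\<lambda>x. \<Prod>b\<in>A. (1 / (a (i b) - b (i b))) * (x (i b) - b (i b)))"
  have "polyfun N (\<Sum>b\<in>A. 1) G" unfolding G_def
    by (intro polyfun_prod polyfun_cmult polyfun_diff polyfun.coord polyfun.const) (use i in auto)
  moreover have "G a = 1" using i by (simp add: G_def)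
  moreover have "G b = 0" if "b \<in> A" for b
    unfolding G_def by (rule prod_zero) (use A that in auto)
  ultimately show ?thesis by auto
qed

lemma bounded_tuples_subsequence:
  fixes s :: "nat \<Rightarrow> nat \<Rightarrow> nat \<Rightarrow> complex"
  assumes "\<And>k l. l < m \<Longrightarrow> s k l \<in> cn N \<and> nrm N (s k l) \<le> B"
  shows "\<exists>r L. strict_mono (r::nat\<Rightarrow>nat) \<and> (\<forall>l<m. L l \<in> cn N \<and> (\<forall>i<N. (\<lambda>k. s (r k) l i) \<longlonglongrightarrow> L l i))"
proof -
  have bd: "bounded (range (\<lambda>k. s k (fst li) (snd li)))" if "li \<in> {..<m} \<times> {..<N}" for li
    unfolding bounded_iff
    using that assms[of "fst li"] order_trans[OF cmod_le_nrm[of "snd li" N]] by (auto intro!: exI[of _ B])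
  have fin: "finite ({..<m} \<times> {..<N})" by simp
  obtain r :: "nat \<Rightarrow> nat" where r: "strict_mono r"
      "\<forall>li\<in>{..<m} \<times> {..<N}. \<exists>l. (\<lambda>k. s (r k) (fst li) (snd li)) \<longlonglongrightarrow> l"
    using bounded_families_simultaneous_subsequence[of "{..<m} \<times> {..<N}" "\<lambda>li k. s k (fst li) (snd li)",
      OF fin bd] by blast
  from bchoice[OF r(2)] obtain L where
    L: "\<And>l i. l < m \<Longrightarrow> i < N \<Longrightarrow> (\<lambda>k. s (r k) l i) \<longlonglongrightarrow> L (l, i)" by auto
  show ?thesis
    by (rule exI[of _ r], rule exI[of _ "\<lambda>l i. if i < N then L (l, i) else 0"])
       (use r L in \<open>auto simp: cn_def\<close>)
qed

context proper_polynomial_map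
begin

lemma poly_disc_h: "polyfun N (e * n) (\<lambda>x. disc (himg N h x))"
proof (rule polyfun_compose[OF poly_disc])
  fix j assume "j < N"
  then show "polyfun N n (\<lambda>x. himg N h x j)" using poly_h by (simp add: himg_def)
qed

text \<open>
  On the line from \<open>x\<close> to a point with regular value, the product of \<open>F\<close> with the discriminant vanishes
  identically, and the second factor is not the zero polynomial.
\<close>

lemma vanishes_if_vanishes_off_discriminant:
  assumes F: "polyfun N m F" and z: "\<And>x. x \<in> cn N \<Longrightarrow> disc (himg N h x) \<noteq> 0 \<Longrightarrow> F x = 0" and x: "x \<in> cn N"
  shows "F x = 0"
proof -
  obtain b where b: "b \<in> cn N" "disc (himg N h b) \<noteq> 0" using disc_nonzero by blast
  obtain p where p: "\<And>t. F (ray x (vdiff b x) t) = poly p t" using polyfun_ray[OF F] by blast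
  obtain q where q: "\<And>t. disc (himg N h (ray x (vdiff b x) t)) = poly q t" using polyfun_ray[OF poly_disc_h] by blast
  have "poly (p * q) t = 0" for t
  proof (cases "poly q t = 0")
    case False
    then have "F (ray x (vdiff b x) t) = 0" by (intro z) (use q b x in auto)
    then show ?thesis by (simp add: p)
  qed simp
  then have "p * q = 0" by (simp add: poly_all_0_iff_0[symmetric])
  moreover have "q \<noteq> 0" using q[of 1] b by auto
  ultimately have "p = 0" by simp
  then show ?thesis using p[of 0] by simp
qed

lemma regular_values_near:
  assumes a: "a \<in> cn N" and ep: "\<epsilon> > 0"
  shows "\<exists>x\<in>cn N. disc (himg N h x) \<noteq> 0 \<and> nrm N (vdiff x a) < \<epsilon>"
proof -
  obtain b where b: "b \<in> cn N" "disc (himg N h b) \<noteq> 0" using disc_nonzero by blast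
  define v where "v = vdiff b a"
  have v: "v \<in> cn N" using a b by (auto simp: v_def)
  obtain q where q: "\<And>t. disc (himg N h (ray a v t)) = poly q t" using polyfun_ray[OF poly_disc_h] by blast
  have "q \<noteq> 0" using q[of 1] b by (auto simp: v_def)
  then have "\<forall>\<^sub>F t in at 0. t \<notin> {t. poly q t = 0}" by (intro eventually_avoids_finite poly_roots_finite)
  moreover have "\<forall>\<^sub>F t in at 0. nrm N (vdiff (ray a v t) a) < \<epsilon>"
  proof (rule order_tendstoD[OF _ ep])
    have "((\<lambda>t. a i + t * v i) \<longlongrightarrow> a i + 0 * v i) (at 0)" for i by (intro tendsto_intros)
    then show "((\<lambda>t. nrm N (vdiff (ray a v t) a)) \<longlongrightarrow> 0) (at 0)"
      unfolding tendsto_nrm_iff by (simp add: ray_def)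
  qed
  ultimately have "\<forall>\<^sub>F t in at (0::complex). disc (himg N h (ray a v t)) \<noteq> 0 \<and> nrm N (vdiff (ray a v t) a) < \<epsilon>"
    by eventually_elim (auto simp: q)
  then obtain t where "disc (himg N h (ray a v t)) \<noteq> 0 \<and> nrm N (vdiff (ray a v t) a) < \<epsilon>"
    using eventually_happens'[OF at_neq_bot] by blast
  then show ?thesis using a v by blast
qed

lemma section_difference_quotient:
  assumes "(\<lambda>t. s t i) holomorphic_on ball (0::complex) d" "d > 0" "s 0 = x"
  shows "\<exists>D. ((\<lambda>t. (s t i - x i) / t) \<longlongrightarrow> D) (at 0)"
proof -
  have "(\<lambda>t. s t i) field_differentiable (at 0)"
    using assms by (intro holomorphic_on_imp_differentiable_at[of _ "ball 0 d"]) auto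
  then show ?thesis using assms(3) by (auto simp: field_differentiable_def has_field_derivative_iff)
qed

text \<open>
  Suppose the fibre has \<open>D < n\<^sup>N\<close> points. Vanishing to order greater than \<open>T + D\<close> at these points imposes
  about \<open>D T\<^sup>N / N!\<close> linear conditions on the coefficients of a polynomial of degree \<open>n T\<close>, which are
  about \<open>n\<^sup>N T\<^sup>N / N!\<close> in number; so for large \<open>T\<close> there is a nonzero such polynomial \<open>F\<close>. For any \<open>G\<close> of
  degree at most \<open>D\<close> the trace of \<open>F G\<close> along a line through \<open>c\<close> is a polynomial of degree at most
  \<open>T + D\<close> that vanishes to higher order at \<open>t = 0\<close>, hence it is \<open>0\<close>. Choosing for \<open>G\<close> a polynomial that
  separates one point \<open>x0\<close> of a regular fibre from the others gives \<open>F x0 = 0\<close>. So \<open>F\<close> vanishes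
  identically, a contradiction.
\<close>

lemma card_fibre_lower:
  assumes c: "c \<in> cn N" "disc c \<noteq> 0"
  shows "n ^ N \<le> card (fibre c)"
proof (rule ccontr)
  assume lt: "\<not> ?thesis"
  define D where "D = card (fibre c)"
  \<comment> \<open>for large \<open>T\<close> there are more coefficients than conditions\<close>
  have "\<exists>T. D * card (mons N (T + D)) < card (mons N (n * T))"
  proof (rule ccontr)
    assume "\<nexists>T. D * card (mons N (T + D)) < card (mons N (n * T))"
    then have neg: "card (mons N (n * T)) \<le> D * card (mons N (T + D))" for T
      using not_less by blast
    have "n ^ N * T ^ N \<le> D * (T + (N + D)) ^ N" for T
    proof -
      have "n ^ N * T ^ N \<le> fact N * card (mons N (n * T))"
        using card_mons_lower[of "n * T" N] by (simp add: power_mult_distrib)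
      also have "\<dots> \<le> fact N * (D * card (mons N (T + D)))" by (intro mult_left_mono neg) auto
      also have "\<dots> = D * (fact N * card (mons N (T + D)))" by simp
      also have "\<dots> \<le> D * (N + (T + D)) ^ N" by (intro mult_left_mono card_mons_upper) auto
      finally show ?thesis by (simp add: add_ac)
    qed
    then have "n ^ N \<le> D" by (rule polynomial_growth_comparison)
    then show False using lt by (simp add: D_def)
  qed
  then obtain T where T: "D * card (mons N (T + D)) < card (mons N (n * T))" by blast
  define M where "M = T + D"
  define I where "I = mons N (n * T)"
  define J where "J = fibre c \<times> mons N M"
  have finfib: "finite (fibre c)" by (rule finite_fibre[OF c])
  have "\<forall>xg\<in>fibre c \<times> I. \<exists>u. \<forall>y. monom_fun N (snd xg) (\<lambda>i. fst xg i + y i) = (\<Sum>b\<in>I. u b * monom_fun N b y)"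
  proof
    fix xg assume "xg \<in> fibre c \<times> I"
    then have "snd xg \<in> mons N (n * T)" by (auto simp: I_def)
    then have "polyfun N (n * T * 1) (\<lambda>y. monom_fun N (snd xg) (\<lambda>i. fst xg i + y i))"
      by (intro polyfun_compose[OF polyfun_monom_fun] polyfun.add polyfun.const polyfun.coord) auto
    then show "\<exists>u. \<forall>y. monom_fun N (snd xg) (\<lambda>i. fst xg i + y i) = (\<Sum>b\<in>I. u b * monom_fun N b y)"
      using polyfun_expansion by (simp add: I_def)
  qed
  \<comment> \<open>\<open>\<tau> (x, g) b\<close> is the Taylor coefficient with index \<open>b\<close> at \<open>x\<close> of the monomial with index \<open>g\<close>\<close>
  from bchoice[OF this] obtain \<tau> where \<tau>: "\<And>x g y. x \<in> fibre c \<Longrightarrow> g \<in> I \<Longrightarrow>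
     monom_fun N g (\<lambda>i. x i + y i) = (\<Sum>b\<in>I. \<tau> (x, g) b * monom_fun N b y)" by auto
  have "card J < card I" using T by (simp add: J_def I_def M_def D_def card_cartesian_product)
  then obtain u where u: "\<exists>g\<in>I. u g \<noteq> 0"
    "\<forall>j\<in>J. (\<Sum>g\<in>I. \<tau> (fst j, g) (snd j) * u g) = 0"
    using underdetermined_system_kernel[of J I "\<lambda>j g. \<tau> (fst j, g) (snd j)"] finfib
    by (auto simp: J_def I_def)
  define F where "F = (\<lambda>x. \<Sum>g\<in>I. u g * monom_fun N g x)"
  have F: "polyfun N (n * T) F" unfolding F_def
    by (intro polyfun_sum polyfun_cmult polyfun_monom_fun) (auto simp: I_def)
  \<comment> \<open>\<open>F\<close> vanishes to order greater than \<open>M\<close> at every point of the fibre.\<close>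
  have Fexp: "F (\<lambda>i. x i + y i) = (\<Sum>b\<in>I - mons N M. (\<Sum>g\<in>I. \<tau> (x, g) b * u g) * monom_fun N b y)"
    if x: "x \<in> fibre c" for x y
  proof -
    have "F (\<lambda>i. x i + y i) = (\<Sum>g\<in>I. \<Sum>b\<in>I. (\<tau> (x, g) b * u g) * monom_fun N b y)"
      unfolding F_def by (intro sum.cong) (auto simp: \<tau>[OF x] sum_distrib_left mult_ac)
    also have "\<dots> = (\<Sum>b\<in>I. \<Sum>g\<in>I. (\<tau> (x, g) b * u g) * monom_fun N b y)" by (rule sum.swap)
    also have "\<dots> = (\<Sum>b\<in>I. (\<Sum>g\<in>I. \<tau> (x, g) b * u g) * monom_fun N b y)"
      by (simp add: sum_distrib_right)
    also have "\<dots> = (\<Sum>b\<in>I - mons N M. (\<Sum>g\<in>I. \<tau> (x, g) b * u g) * monom_fun N b y)"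
    proof (rule sum.mono_neutral_right)
      show "\<forall>b\<in>I - (I - mons N M). (\<Sum>g\<in>I. \<tau> (x, g) b * u g) * monom_fun N b y = 0"
        using u(2) x by (auto simp: J_def)
    qed (auto simp: I_def)
    finally show ?thesis .
  qed
  have Flim: "((\<lambda>t. F (s t) / t ^ M) \<longlongrightarrow> 0) (at 0)"
    if x: "x \<in> fibre c" and s: "s 0 = x" "d > 0" "\<And>i. i < N \<Longrightarrow> (\<lambda>t. s t i) holomorphic_on ball 0 d" for s x d
  proof -
    have "\<forall>i\<in>{..<N}. \<exists>D. ((\<lambda>t. (s t i - x i) / t) \<longlongrightarrow> D) (at 0)"
      using section_difference_quotient[OF s(3) s(2) s(1)] by auto
    from bchoice[OF this] obtain Dq where Dq: "\<And>i. i < N \<Longrightarrow> ((\<lambda>t. (s t i - x i) / t) \<longlongrightarrow> Dq i) (at 0)" by auto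
    have mon: "((\<lambda>t. monom_fun N b (vdiff (s t) x) / t ^ M) \<longlongrightarrow> 0) (at 0)" if b: "b \<in> I - mons N M" for b
    proof -
      define m where "m = (\<Sum>i<N. b i)"
      have m: "M < m" using b by (auto simp: mons_def I_def m_def)
      have "((\<lambda>t. (\<Prod>i<N. ((s t i - x i) / t) ^ b i) * t ^ (m - M)) \<longlongrightarrow> (\<Prod>i<N. Dq i ^ b i) * 0 ^ (m - M)) (at 0)"
        by (intro tendsto_intros Dq) auto
      then have "((\<lambda>t. (\<Prod>i<N. ((s t i - x i) / t) ^ b i) * t ^ (m - M)) \<longlongrightarrow> 0) (at 0)"
        using m by (simp add: power_0_left)
      moreover have "\<forall>\<^sub>F t in at 0. (\<Prod>i<N. ((s t i - x i) / t) ^ b i) * t ^ (m - M) = monom_fun N b (vdiff (s t) x) / t ^ M"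
      proof (rule eventually_mono[OF eventually_neq_at_within[of 0]])
        fix t :: complex assume t: "t \<noteq> 0"
        have "(\<Prod>i<N. ((s t i - x i) / t) ^ b i) = monom_fun N b (vdiff (s t) x) / t ^ m"
          by (simp add: monom_fun_def power_divide prod_dividef m_def power_sum)
        moreover have "t ^ m = t ^ M * t ^ (m - M)" using m by (simp add: power_add[symmetric])
        ultimately show "(\<Prod>i<N. ((s t i - x i) / t) ^ b i) * t ^ (m - M) = monom_fun N b (vdiff (s t) x) / t ^ M"
          using t by simp
      qed
      ultimately show ?thesis using tendsto_cong by force
    qed
    have "((\<lambda>t. \<Sum>b\<in>I - mons N M. (\<Sum>g\<in>I. \<tau> (x, g) b * u g) * (monom_fun N b (vdiff (s t) x) / t ^ M)) \<longlongrightarrow>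
      (\<Sum>b\<in>I - mons N M. (\<Sum>g\<in>I. \<tau> (x, g) b * u g) * 0)) (at 0)"
      by (intro tendsto_intros mon) auto
    moreover have "F (s t) / t ^ M = (\<Sum>b\<in>I - mons N M. (\<Sum>g\<in>I. \<tau> (x, g) b * u g) * (monom_fun N b (vdiff (s t) x) / t ^ M))" for t
      using Fexp[OF x, of "vdiff (s t) x"] by (simp add: sum_divide_distrib)
    ultimately show ?thesis by simp
  qed
  \<comment> \<open>the trace of \<open>F G\<close> along the line from \<open>c\<close> to the value of \<open>x0\<close> vanishes\<close>
  have F0: "F x0 = 0" if x0: "x0 \<in> cn N" "disc (himg N h x0) \<noteq> 0" for x0
  proof -
    define c' where "c' = himg N h x0"
    have c': "c' \<in> cn N" "disc c' \<noteq> 0" using x0 by (auto simp: c'_def)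
    have x0f: "x0 \<in> fibre c'" using x0 by (simp add: fibre_def c'_def)
    have fin': "finite (fibre c')" by (rule finite_fibre[OF c'])
    have card': "card (fibre c') = D" unfolding D_def by (rule card_fibre_constant[OF c' c])
    obtain G where G: "polyfun N (card (fibre c' - {x0})) G" "G x0 = 1" "\<forall>b\<in>fibre c' - {x0}. G b = 0"
      using interpolating_polyfun[of "fibre c' - {x0}" N x0] fin' x0 by (auto dest: fibreD(1))
    have "card (fibre c' - {x0}) \<le> card (fibre c')" by (rule card_mono[OF fin']) auto
    also have "\<dots> \<le> n * D" using card' n_pos by simp
    finally have "polyfun N (n * D) G" using G(1) polyfun.weaken by blast
    from polyfun.mult[OF F this] have FG: "polyfun N (n * M) (\<lambda>x. F x * G x)"
      by (simp add: M_def distrib_left)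
    define v where "v = vdiff c' c"
    have v: "v \<in> cn N" using c c' by (auto simp: v_def)
    obtain p where p: "degree p \<le> M" "\<And>t. disc (ray c v t) \<noteq> 0 \<Longrightarrow> poly p t = (\<Sum>x\<in>fibre (ray c v t). F x * G x)"
      using trace_polynomial[OF FG c v] by blast
    obtain d S where S: "d > 0" "\<And>x. x \<in> fibre c \<Longrightarrow> S x 0 = x"
      "\<And>x i. x \<in> fibre c \<Longrightarrow> i < N \<Longrightarrow> (\<lambda>t. S x t i) holomorphic_on ball 0 d"
      "\<And>t. cmod t < d \<Longrightarrow> bij_betw (\<lambda>x. S x t) (fibre c) (fibre (ray c v t))"
      by (rule fibre_sections[OF c v]) blast
    have Glim: "((\<lambda>t. G (S x t)) \<longlongrightarrow> G x) (at 0)" if x: "x \<in> fibre c" for x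
    proof -
      have "(\<lambda>t. G (S x t)) holomorphic_on ball 0 d" by (intro polyfun_holomorphic[OF G(1)] S(3) x)
      then have "continuous (at 0) (\<lambda>t. G (S x t))"
        using S(1) by (intro continuous_on_interior[of "ball 0 d"] holomorphic_on_imp_continuous_on) auto
      then show ?thesis using S(2)[OF x] by (simp add: continuous_at)
    qed
    have "((\<lambda>t. \<Sum>x\<in>fibre c. (F (S x t) / t ^ M) * G (S x t)) \<longlongrightarrow> (\<Sum>x\<in>fibre c. 0 * G x)) (at 0)"
      by (intro tendsto_sum tendsto_mult Glim) (use Flim S in auto)
    moreover have "\<forall>\<^sub>F t in at 0. (\<Sum>x\<in>fibre c. (F (S x t) / t ^ M) * G (S x t)) = poly p t / t ^ M"
    proof -
      have e1: "\<forall>\<^sub>F t in at 0. t \<notin> {t. disc (ray c v t) = 0}"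
        by (intro eventually_avoids_finite line_meets_discriminant_finitely c)
      have e2: "\<forall>\<^sub>F t in at 0. t \<in> ball 0 d" by (rule eventually_at_in_open') (use S(1) in auto)
      show ?thesis using e1 e2
      proof eventually_elim
        case (elim t)
        have "poly p t = (\<Sum>x\<in>fibre c. F (S x t) * G (S x t))"
          using p(2)[of t] elim sum.reindex_bij_betw[OF S(4)[of t], of "\<lambda>x. F x * G x"] by simp
        then show ?case by (simp add: sum_divide_distrib)
      qed
    qed
    ultimately have "((\<lambda>t. poly p t / t ^ M) \<longlongrightarrow> 0) (at 0)"
      using tendsto_cong by force
    then have "p = 0" by (rule poly_eq_0_if_small_near_0[OF p(1)])
    then have "0 = (\<Sum>x\<in>fibre c'. F x * G x)" using p(2)[of 1] c' by (simp add: v_def)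
    also have "\<dots> = (\<Sum>x\<in>{x0}. F x * G x)"
      by (rule sum.mono_neutral_right) (use fin' x0f G in auto)
    finally show ?thesis using G(2) by simp
  qed
  have "F x = 0" if "x \<in> cn N" for x
    by (rule vanishes_if_vanishes_off_discriminant[OF F F0 that])
  then have "u g = 0" if "g \<in> I" for g
    using monomials_independent[where N = N and m = "n * T" and u = u and b = g] that by (auto simp: F_def I_def)
  then show False using u(1) by blast
qed

text \<open>
  For the points \<open>y\<close> of the fibre choose polynomials \<open>G y\<close> that are \<open>1\<close> at \<open>y\<close> and \<open>0\<close> at the other
  points. The products of \<open>G y\<close> with monomials in the components of \<open>h\<close> are linearly independent: a
  relation \<open>\<Sum>\<^sub>y G y (x) P y (h x) = 0\<close>, read at the points of the fibre over a value near \<open>c\<close>, is a linear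
  system for the numbers \<open>P y\<close> whose matrix is close to the identity, so each \<open>P y\<close> vanishes near \<open>c\<close>.
  With monomials of degree at most \<open>M\<close> these are about \<open>D M\<^sup>N / N!\<close> functions in a space of dimension
  about \<open>(n M)\<^sup>N / N!\<close>, which forces \<open>D \<le> n\<^sup>N\<close>.
\<close>

lemma card_fibre_upper:
  assumes c: "c \<in> cn N" "disc c \<noteq> 0"
  shows "card (fibre c) \<le> n ^ N"
proof (rule ccontr)
  assume lt: "\<not> ?thesis"
  define D where "D = card (fibre c)"
  have finfib: "finite (fibre c)" by (rule finite_fibre[OF c])
  have "\<exists>M. card (mons N (D + M * n)) < D * card (mons N M)"
  proof (rule ccontr)
    assume "\<nexists>M. card (mons N (D + M * n)) < D * card (mons N M)"
    then have neg: "D * card (mons N M) \<le> card (mons N (D + M * n))" for M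
      using not_less by blast
    have "D * M ^ N \<le> n ^ N * (M + (N + D)) ^ N" for M
    proof -
      have "D * M ^ N \<le> D * (fact N * card (mons N M))" by (intro mult_left_mono card_mons_lower) auto
      also have "\<dots> = fact N * (D * card (mons N M))" by simp
      also have "\<dots> \<le> fact N * card (mons N (D + M * n))" by (intro mult_left_mono neg) auto
      also have "\<dots> \<le> (N + (D + M * n)) ^ N" by (rule card_mons_upper)
      also have "\<dots> \<le> (n * (M + (N + D))) ^ N"
      proof (intro power_mono)
        have "1 * (N + D) \<le> n * (N + D)" using n_pos by (intro mult_right_mono) auto
        then show "N + (D + M * n) \<le> n * (M + (N + D))" by (simp add: algebra_simps)
      qed auto
      finally show ?thesis by (simp add: power_mult_distrib)
    qed
    then have "D \<le> n ^ N" by (rule polynomial_growth_comparison)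
    then show False using lt by (simp add: D_def)
  qed
  then obtain M where M: "card (mons N (D + M * n)) < D * card (mons N M)" by blast
  have "\<forall>y\<in>fibre c. \<exists>G. polyfun N D G \<and> G y = 1 \<and> (\<forall>b\<in>fibre c - {y}. G b = 0)"
  proof
    fix y assume y: "y \<in> fibre c"
    obtain G where G: "polyfun N (card (fibre c - {y})) G" "G y = 1" "\<forall>b\<in>fibre c - {y}. G b = 0"
      using interpolating_polyfun[of "fibre c - {y}" N y] finfib y by (auto dest: fibreD(1))
    have "card (fibre c - {y}) \<le> D" unfolding D_def by (rule card_mono[OF finfib]) auto
    then show "\<exists>G. polyfun N D G \<and> G y = 1 \<and> (\<forall>b\<in>fibre c - {y}. G b = 0)"
      using G polyfun.weaken by blast
  qed
  from bchoice[OF this] obtain G where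
    G0: "\<forall>y\<in>fibre c. polyfun N D (G y) \<and> G y y = 1 \<and> (\<forall>b\<in>fibre c - {y}. G y b = 0)" by blast
  have G: "\<And>y. y \<in> fibre c \<Longrightarrow> polyfun N D (G y)"
    "\<And>y z. y \<in> fibre c \<Longrightarrow> z \<in> fibre c \<Longrightarrow> G y z = (if y = z then 1 else 0)" using G0 by auto
  define I where "I = fibre c \<times> mons N M"
  define J where "J = mons N (D + M * n)"
  have "\<forall>ya\<in>I. \<exists>k. \<forall>x. G (fst ya) x * monom_fun N (snd ya) (himg N h x) = (\<Sum>b\<in>J. k b * monom_fun N b x)"
  proof
    fix ya assume ya: "ya \<in> I"
    have "polyfun N (M * n) (\<lambda>x. monom_fun N (snd ya) (himg N h x))"
    proof (rule polyfun_compose[OF polyfun_monom_fun])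
      fix j assume "j < N"
      then show "polyfun N n (\<lambda>x. himg N h x j)" using poly_h by (simp add: himg_def)
    qed (use ya in \<open>auto simp: I_def\<close>)
    from polyfun.mult[OF G(1) this, of "fst ya"] ya
    have "polyfun N (D + M * n) (\<lambda>x. G (fst ya) x * monom_fun N (snd ya) (himg N h x))"
      by (auto simp: I_def)
    then show "\<exists>k. \<forall>x. G (fst ya) x * monom_fun N (snd ya) (himg N h x) = (\<Sum>b\<in>J. k b * monom_fun N b x)"
      unfolding J_def by (rule polyfun_expansion)
  qed
  from bchoice[OF this] obtain k where k: "\<And>ya x. ya \<in> I \<Longrightarrow>
    G (fst ya) x * monom_fun N (snd ya) (himg N h x) = (\<Sum>b\<in>J. k ya b * monom_fun N b x)" by blast
  have "card J < card I" using M by (simp add: J_def I_def D_def card_cartesian_product)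
  then obtain u where u: "\<exists>i\<in>I. u i \<noteq> 0" "\<forall>b\<in>J. (\<Sum>i\<in>I. k i b * u i) = 0"
    using underdetermined_system_kernel[of J I "\<lambda>b i. k i b"] finfib by (auto simp: J_def I_def)
  define P where "P = (\<lambda>y c'. \<Sum>a\<in>mons N M. u (y, a) * monom_fun N a c')"
  have P: "polyfun N M (P y)" for y
    unfolding P_def by (intro polyfun_sum polyfun_cmult polyfun_monom_fun)
  have rel: "(\<Sum>y\<in>fibre c. G y x * P y (himg N h x)) = 0" for x
  proof -
    have "(\<Sum>y\<in>fibre c. G y x * P y (himg N h x)) =
      (\<Sum>y\<in>fibre c. \<Sum>a\<in>mons N M. u (y, a) * (G (fst (y, a)) x * monom_fun N (snd (y, a)) (himg N h x)))"
      by (simp add: P_def sum_distrib_left mult_ac)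
    also have "\<dots> = (\<Sum>i\<in>I. u i * (G (fst i) x * monom_fun N (snd i) (himg N h x)))"
      unfolding I_def sum.cartesian_product by (intro sum.cong) auto
    also have "\<dots> = (\<Sum>i\<in>I. \<Sum>b\<in>J. (k i b * u i) * monom_fun N b x)"
      by (intro sum.cong) (auto simp: k sum_distrib_left mult_ac)
    also have "\<dots> = (\<Sum>b\<in>J. \<Sum>i\<in>I. (k i b * u i) * monom_fun N b x)" by (rule sum.swap)
    also have "\<dots> = (\<Sum>b\<in>J. (\<Sum>i\<in>I. k i b * u i) * monom_fun N b x)" by (simp add: sum_distrib_right)
    also have "\<dots> = 0" using u(2) by simp
    finally show ?thesis .
  qed
  have Pz: "P y c' = 0" if y: "y \<in> fibre c" and c': "c' \<in> cn N" for y c'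
  proof -
    define v where "v = vdiff c' c"
    have v: "v \<in> cn N" using c c' by (auto simp: v_def)
    obtain d S where S: "d > 0" "\<And>x. x \<in> fibre c \<Longrightarrow> S x 0 = x"
      "\<And>x i. x \<in> fibre c \<Longrightarrow> i < N \<Longrightarrow> (\<lambda>t. S x t i) holomorphic_on ball 0 d"
      "\<And>t. cmod t < d \<Longrightarrow> bij_betw (\<lambda>x. S x t) (fibre c) (fibre (ray c v t))"
      by (rule fibre_sections[OF c v]) blast
    \<comment> \<open>small enough for a matrix of size \<open>D\<close> with entries this close to the identity matrix to be injective\<close>
    define \<epsilon> where "\<epsilon> = 1 / (2 * (real D + 1))"
    have ep: "\<epsilon> > 0" by (simp add: \<epsilon>_def)
    have lim: "((\<lambda>t. G y (S z t)) \<longlongrightarrow> G y z) (at 0)" if "y \<in> fibre c" "z \<in> fibre c" for y z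
    proof -
      have "(\<lambda>t. G y (S z t)) holomorphic_on ball 0 d" by (intro polyfun_holomorphic[OF G(1)] S(3) that)
      then have "continuous (at 0) (\<lambda>t. G y (S z t))"
        using S(1) by (intro continuous_on_interior[of "ball 0 d"] holomorphic_on_imp_continuous_on) auto
      then show ?thesis using S(2)[OF that(2)] by (simp add: continuous_at)
    qed
    have "\<forall>\<^sub>F t in at 0. \<forall>yz\<in>fibre c \<times> fibre c. dist (G (fst yz) (S (snd yz) t)) (G (fst yz) (snd yz)) < \<epsilon>"
      by (intro eventually_ball_finite) (use finfib lim ep in \<open>auto intro!: tendstoD\<close>)
    moreover have "\<forall>\<^sub>F t in at 0. t \<in> ball 0 d" by (rule eventually_at_in_open') (use S(1) in auto)
    ultimately have ev: "\<forall>\<^sub>F t in at 0. P y (ray c v t) = 0"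
    proof eventually_elim
      case (elim t)
      define m where "m = (\<Sum>y\<in>fibre c. cmod (P y (ray c v t)))"
      have "cmod (P z (ray c v t)) \<le> \<epsilon> * m" if z: "z \<in> fibre c" for z
      proof -
        have "S z t \<in> fibre (ray c v t)" using S(4)[of t] elim z by (auto simp: bij_betw_def)
        then have "himg N h (S z t) = ray c v t" by (rule fibreD)
        then have r: "(\<Sum>y\<in>fibre c. G y (S z t) * P y (ray c v t)) = 0" using rel[of "S z t"] by simp
        have "(\<Sum>y\<in>fibre c. G y z * P y (ray c v t)) = (\<Sum>y\<in>fibre c. if y = z then P y (ray c v t) else 0)"
          by (intro sum.cong) (use G(2) z in auto)
        also have "\<dots> = P z (ray c v t)" using z finfib by simp
        finally have "P z (ray c v t) = (\<Sum>y\<in>fibre c. (G y z - G y (S z t)) * P y (ray c v t))"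
          using r by (simp add: left_diff_distrib sum_subtractf)
        also have "cmod \<dots> \<le> (\<Sum>y\<in>fibre c. \<epsilon> * cmod (P y (ray c v t)))"
        proof (intro sum_norm_le)
          fix y assume y: "y \<in> fibre c"
          have "dist (G (fst (y, z)) (S (snd (y, z)) t)) (G (fst (y, z)) (snd (y, z))) < \<epsilon>"
            using elim(1) y z by blast
          then have "cmod (G y z - G y (S z t)) \<le> \<epsilon>" by (simp add: dist_norm norm_minus_commute)
          then show "cmod ((G y z - G y (S z t)) * P y (ray c v t)) \<le> \<epsilon> * cmod (P y (ray c v t))"
            unfolding norm_mult by (intro mult_right_mono) auto
        qed
        finally show ?thesis by (simp add: m_def sum_distrib_left)
      qed
      then have "m \<le> real D * (\<epsilon> * m)" unfolding m_def D_def by (rule sum_bounded_above)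
      moreover have "real D * (\<epsilon> * m) \<le> 1 / 2 * m"
      proof -
        have m0: "m \<ge> 0" by (auto simp: m_def intro: sum_nonneg)
        have "real D * \<epsilon> \<le> 1 / 2" by (simp add: \<epsilon>_def field_simps)
        from mult_right_mono[OF this m0] show ?thesis by simp
      qed
      ultimately have "m \<le> 0" by simp
      then have "\<forall>y\<in>fibre c. cmod (P y (ray c v t)) = 0"
        unfolding m_def using finfib
        by (metis (no_types, lifting) norm_ge_zero sum_nonneg sum_nonneg_eq_0_iff antisym)
      then show ?case using y by simp
    qed
    obtain p where p: "\<And>t. P y (ray c v t) = poly p t" using polyfun_ray[OF P] by blast
    from ev have "\<forall>\<^sub>F t in at 0. poly p t / t ^ degree p = 0" by eventually_elim (simp add: p)
    then have "((\<lambda>t. poly p t / t ^ degree p) \<longlongrightarrow> 0) (at 0)" by (rule tendsto_eventually)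
    then have "p = 0" by (rule poly_eq_0_if_small_near_0[OF order_refl])
    then show ?thesis using p[of 1] by (simp add: v_def)
  qed
  have "u (y, a) = 0" if "y \<in> fibre c" "a \<in> mons N M" for y a
    using monomials_independent[where N = N and m = M and u = "\<lambda>a. u (y, a)" and b = a] Pz[OF that(1)] that(2) by (simp add: P_def)
  then show False using u(1) by (auto simp: I_def)
qed

theorem card_fibre: "c \<in> cn N \<Longrightarrow> disc c \<noteq> 0 \<Longrightarrow> card (fibre c) = n ^ N"
  using card_fibre_lower card_fibre_upper by (simp add: antisym)

end

section \<open>Points of degenerate fibres as limits of regular fibres\<close>

context proper_polynomial_map
begin

text \<open>
  The trace along a line of unit speed is a polynomial in the parameter. On the unit disc it is bounded
  independently of the line, since the points of the fibres over a bounded set of values are bounded and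
  their number is constant. The Schwarz lemma turns this bound into a Lipschitz constant.
\<close>

lemma trace_lipschitz:
  assumes th: "polyfun N (n * T) \<theta>" and R: "R \<ge> 0"
  shows "\<exists>L. \<forall>c c'. c \<in> cn N \<longrightarrow> c' \<in> cn N \<longrightarrow> disc c \<noteq> 0 \<longrightarrow> disc c' \<noteq> 0 \<longrightarrow>
    nrm N c \<le> R \<longrightarrow> nrm N c' \<le> R \<longrightarrow>
    cmod ((\<Sum>x\<in>fibre c'. \<theta> x) - (\<Sum>x\<in>fibre c. \<theta> x)) \<le> L * nrm N (vdiff c' c)"
proof -
  define tr where "tr = (\<lambda>c. \<Sum>x\<in>fibre c. \<theta> x)"
  obtain C1 where C1: "C1 \<ge> 0" "\<And>x. cmod (\<theta> x) \<le> C1 * (1 + nrm N x) ^ (n * T)"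
    using polyfun_growth[OF th] by blast
  \<comment> \<open>a bound for the trace over all regular values of norm at most \<open>R + 1\<close>\<close>
  define K where "K = real (n ^ N) * (C1 * (1 + (1 + C * (1 + (R + 1)))) ^ (n * T))"
  have K0: "K \<ge> 0" using C1 C_pos R by (auto simp: K_def intro!: mult_nonneg_nonneg zero_le_power add_nonneg_nonneg)
  have tb: "cmod (tr c) \<le> K" if c: "c \<in> cn N" "disc c \<noteq> 0" "nrm N c \<le> R + 1" for c
  proof -
    have "cmod (\<theta> x) \<le> C1 * (1 + (1 + C * (1 + (R + 1)))) ^ (n * T)" if x: "x \<in> fibre c" for x
    proof -
      have "nrm N x \<le> 1 + C * (1 + nrm N c)" by (rule fibre_bounded[OF x])
      also have "\<dots> \<le> 1 + C * (1 + (R + 1))" using c(3) C_pos by simp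
      finally have le: "nrm N x \<le> 1 + C * (1 + (R + 1))" .
      have "cmod (\<theta> x) \<le> C1 * (1 + nrm N x) ^ (n * T)" by (rule C1)
      also have "\<dots> \<le> C1 * (1 + (1 + C * (1 + (R + 1)))) ^ (n * T)"
        by (intro mult_left_mono power_mono add_left_mono le C1) auto
      finally show ?thesis .
    qed
    then have "cmod (tr c) \<le> real (card (fibre c)) * (C1 * (1 + (1 + C * (1 + (R + 1)))) ^ (n * T))"
      unfolding tr_def by (rule sum_norm_bound)
    then show ?thesis using card_fibre[OF c(1,2)] by (simp add: K_def)
  qed
  have "cmod (tr c' - tr c) \<le> (2 * K + 1) * nrm N (vdiff c' c)"
    if c: "c \<in> cn N" "c' \<in> cn N" "disc c \<noteq> 0" "disc c' \<noteq> 0" "nrm N c \<le> R" "nrm N c' \<le> R" for c c'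
  proof -
    define s where "s = nrm N (vdiff c' c)"
    have s0: "s \<ge> 0" by (simp add: s_def)
    have far: "cmod (tr c' - tr c) \<le> 2 * K"
      using norm_triangle_ineq4[of "tr c'" "tr c"] tb[of c] tb[of c'] c by simp
    consider "s = 0" | "s \<ge> 1" | "0 < s" "s < 1" using s0 by linarith
    then show ?thesis
    proof cases
      case 1
      have "vdiff c' c \<in> cn N" using c by auto
      then have "vdiff c' c = (\<lambda>_. 0)" using nrm_zero_iff 1 by (simp add: s_def)
      then have "c' = c" by (auto simp: fun_eq_iff)
      then show ?thesis using K0 by simp
    next
      case 2
      have "2 * K \<le> (2 * K + 1) * 1" by simp
      also have "\<dots> \<le> (2 * K + 1) * s" using 2 K0 by (intro mult_left_mono) auto
      finally show ?thesis using far by (simp add: s_def)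
    next
      case 3
      define v where "v = (\<lambda>i. (1 / complex_of_real s) * (c' i - c i))"
      have v: "v \<in> cn N" using c by (auto simp: v_def cn_def)
      have nv: "nrm N v = 1" unfolding v_def nrm_scale using 3 by (simp add: s_def[symmetric] norm_divide)
      have rs: "ray c v (of_real s) = c'" using 3 by (simp add: ray_def v_def)
      obtain p where p: "\<And>t. disc (ray c v t) \<noteq> 0 \<Longrightarrow> poly p t = tr (ray c v t)"
        using trace_polynomial[OF th c(1,3) v] unfolding tr_def by blast
      have pb: "cmod (poly p t) \<le> K" if t: "cmod t < 1" for t
      proof -
        have "((\<lambda>t. cmod (poly p t)) \<longlongrightarrow> cmod (poly p t)) (at t)" by (intro tendsto_intros)
        moreover have "\<forall>\<^sub>F u in at t. cmod (poly p u) \<le> K"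
        proof -
          have e1: "\<forall>\<^sub>F u in at t. u \<notin> {u. disc (ray c v u) = 0}"
            by (intro eventually_avoids_finite line_meets_discriminant_finitely c)
          have e2: "\<forall>\<^sub>F u in at t. u \<in> ball 0 1" by (rule eventually_at_in_open') (use t in auto)
          show ?thesis using e1 e2
          proof eventually_elim
            case (elim u)
            have "nrm N (ray c v u) \<le> R + 1"
              using nrm_ray[of N c v u] c(5) elim nv by simp
            then show ?case using p[of u] tb[of "ray c v u"] elim c v by auto
          qed
        qed
        ultimately show ?thesis by (rule tendsto_upperbound) auto
      qed
      \<comment> \<open>the summand \<open>1\<close> gives the strict bound in the Schwarz lemma, also if \<open>K = 0\<close>\<close>
      define g where "g = (\<lambda>z. (poly p z - poly p 0) / of_real (2 * K + 1))"
      have pos: "2 * K + 1 > 0" using K0 by simp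
      have "cmod (g (of_real s)) \<le> cmod (complex_of_real s)"
      proof (rule Schwarz_Lemma(1))
        show "g holomorphic_on ball 0 1" unfolding g_def using pos
          by (intro holomorphic_intros) (auto simp del: of_real_add of_real_mult)
        show "g 0 = 0" by (simp add: g_def)
        show "cmod (complex_of_real s) < 1" using 3 by simp
        fix z :: complex assume z: "cmod z < 1"
        have "cmod (poly p z - poly p 0) \<le> K + K"
          using norm_triangle_ineq4[of "poly p z" "poly p 0"] pb[OF z] pb[of 0] by simp
        then have "cmod (poly p z - poly p 0) < 2 * K + 1" by simp
        then show "cmod (g z) < 1" using pos
          by (simp add: g_def norm_divide del: of_real_add of_real_mult)
      qed
      then have "cmod (poly p (of_real s) - poly p 0) / (2 * K + 1) \<le> s"
        using pos 3 by (simp add: g_def norm_divide del: of_real_add of_real_mult)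
      then have "cmod (poly p (of_real s) - poly p 0) \<le> (2 * K + 1) * s"
        using pos by (simp add: pos_divide_le_eq mult.commute)
      moreover have "poly p (of_real s) = tr c'" using p[of "of_real s"] rs c by simp
      moreover have "poly p 0 = tr c" using p[of 0] c by simp
      ultimately show ?thesis by (simp add: s_def)
    qed
  qed
  then show ?thesis unfolding tr_def by blast
qed

lemma himg_tendsto:
  assumes "\<And>i. i < N \<Longrightarrow> ((\<lambda>k. x k i) \<longlongrightarrow> a i) Fl" "j < N"
  shows "((\<lambda>k. himg N h (x k) j) \<longlongrightarrow> himg N h a j) Fl"
  using polyfun_tendsto[OF poly_h[OF assms(2)] assms(1)] assms(2) by (simp add: himg_def)

text \<open>
  Otherwise there are regular values \<open>c\<^sub>k\<close> tending to \<open>h a\<close> whose fibres avoid a neighbourhood of \<open>a\<close>,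
  and regular values \<open>e\<^sub>k\<close> tending to \<open>h a\<close> whose fibres contain points \<open>x\<^sub>k\<close> tending to \<open>a\<close>. After
  passing to a subsequence all points of these fibres converge. A polynomial that is \<open>1\<close> at \<open>a\<close> and \<open>0\<close> at
  all other limit points has traces over \<open>c\<^sub>k\<close> that tend to \<open>0\<close>, whereas its traces over \<open>e\<^sub>k\<close> tend to the
  number of sequences with limit \<open>a\<close>, which is positive. This contradicts the Lipschitz continuity of the
  trace.
\<close>

theorem fibre_approximation:
  assumes a: "a \<in> cn N" and ep: "\<epsilon> > 0"
  shows "\<exists>\<delta>>0. \<forall>c\<in>cn N. disc c \<noteq> 0 \<longrightarrow> nrm N (vdiff c (himg N h a)) < \<delta> \<longrightarrow>
    (\<exists>x\<in>fibre c. nrm N (vdiff x a) < \<epsilon>)"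
proof (rule ccontr)
  assume neg: "\<not> ?thesis"
  define c0 where "c0 = himg N h a"
  define D where "D = n ^ N"
  define bad where "bad = (\<lambda>c. c \<in> cn N \<and> disc c \<noteq> 0 \<and> \<not> (\<exists>x\<in>fibre c. nrm N (vdiff x a) < \<epsilon>))"
  have "\<exists>c. bad c \<and> nrm N (vdiff c c0) < \<delta>" if "\<delta> > 0" for \<delta>
    using neg that unfolding bad_def c0_def by blast
  then have "\<forall>k. \<exists>c. bad c \<and> nrm N (vdiff c c0) < 1 / Suc k" by simp
  from choice[OF this] obtain c where c: "\<And>k. bad (c k) \<and> nrm N (vdiff (c k) c0) < 1 / Suc k" by blast
  have "\<forall>k. \<exists>x. x \<in> cn N \<and> disc (himg N h x) \<noteq> 0 \<and> nrm N (vdiff x a) < 1 / Suc k"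
    using regular_values_near[OF a] by (metis of_nat_0_less_iff zero_less_Suc zero_less_divide_1_iff)
  from choice[OF this] obtain x where x: "\<And>k. x k \<in> cn N \<and> disc (himg N h (x k)) \<noteq> 0 \<and> nrm N (vdiff (x k) a) < 1 / Suc k"
    by blast
  have null: "f \<longlonglongrightarrow> 0" if "\<And>k. 0 \<le> f k \<and> f k < 1 / Suc k" for f :: "nat \<Rightarrow> real"
    by (rule tendsto_sandwich[OF _ _ tendsto_const LIMSEQ_inverse_real_of_nat])
       (use that in \<open>auto intro!: always_eventually less_imp_le simp: inverse_eq_divide\<close>)
  have clim: "(\<lambda>k. c k j) \<longlonglongrightarrow> c0 j" if "j < N" for j
    using null[of "\<lambda>k. nrm N (vdiff (c k) c0)"] c that by (auto simp: tendsto_nrm_iff)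
  have xlim: "(\<lambda>k. x k j) \<longlonglongrightarrow> a j" if "j < N" for j
    using null[of "\<lambda>k. nrm N (vdiff (x k) a)"] x that by (auto simp: tendsto_nrm_iff)
  define e where "e = (\<lambda>k. himg N h (x k))"
  have elim: "(\<lambda>k. e k j) \<longlonglongrightarrow> c0 j" if "j < N" for j
    unfolding e_def c0_def by (rule himg_tendsto[OF xlim that])
  have cB: "c k \<in> cn N" "disc (c k) \<noteq> 0" for k using c[of k] by (auto simp: bad_def)
  have eB: "e k \<in> cn N" "disc (e k) \<noteq> 0" for k using x[of k] by (auto simp: e_def)
  have xf: "x k \<in> fibre (e k)" for k using x[of k] by (simp add: fibre_def e_def)
  have bd: "\<exists>R\<ge>0. \<forall>k. nrm N (f k) \<le> R" if "\<And>j. j < N \<Longrightarrow> (\<lambda>k. f k j) \<longlonglongrightarrow> c0 j" for f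
  proof -
    have "(\<lambda>k. nrm N (vdiff (f k) c0)) \<longlonglongrightarrow> 0" using that by (simp add: tendsto_nrm_iff)
    then have "Bseq (\<lambda>k. nrm N (vdiff (f k) c0))" by (rule convergent_imp_Bseq[OF convergentI])
    then obtain B where B: "B > 0" "\<And>k. norm (nrm N (vdiff (f k) c0)) \<le> B" by (auto simp: Bseq_def)
    have "nrm N (f k) \<le> nrm N c0 + B" for k
      using nrm_triangle[of N "vdiff (f k) c0" c0] B(2)[of k] by simp
    then show ?thesis using B(1) by (intro exI[of _ "nrm N c0 + B"]) auto
  qed
  obtain R1 R2 where R12: "\<And>k. nrm N (c k) \<le> R1" "\<And>k. nrm N (e k) \<le> R2" "R1 \<ge> 0" "R2 \<ge> 0"
    using bd[OF clim] bd[OF elim] by blast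
  define R where "R = max R1 R2"
  have R: "nrm N (c k) \<le> R" "nrm N (e k) \<le> R" "R \<ge> 0" for k using R12 by (auto simp: R_def le_max_iff_disj)
  have "\<forall>k. \<exists>Y. bij_betw Y {0..<D} (fibre (c k))"
    using ex_bij_betw_nat_finite[OF finite_fibre[OF cB]] card_fibre[OF cB] by (simp add: D_def)
  \<comment> \<open>\<open>Y k\<close> enumerates the fibre over \<open>c k\<close>, and \<open>Z k\<close> the points other than \<open>x k\<close> in the fibre over \<open>e k\<close>\<close>
  from choice[OF this] obtain Y where Y: "\<And>k. bij_betw (Y k) {0..<D} (fibre (c k))" by blast
  have "card (fibre (e k) - {x k}) = D - 1" for k
    using xf[of k] finite_fibre[OF eB] card_fibre[OF eB] by (simp add: D_def)
  then have "\<forall>k. \<exists>Z. bij_betw Z {0..<D - 1} (fibre (e k) - {x k})"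
    using ex_bij_betw_nat_finite finite_fibre[OF eB] by (metis finite_Diff)
  from choice[OF this] obtain Z where Z: "\<And>k. bij_betw (Z k) {0..<D - 1} (fibre (e k) - {x k})" by blast
  define m where "m = D + (D - 1)"
  define s where "s = (\<lambda>k l. if l < D then Y k l else Z k (l - D))"
  have sf: "s k l \<in> fibre (c k) \<or> s k l \<in> fibre (e k)" if "l < m" for k l
  proof (cases "l < D")
    case True
    then show ?thesis using bij_betwE[OF Y[of k]] by (auto simp: s_def)
  next
    case False
    then have "l - D \<in> {0..<D - 1}" using that by (auto simp: m_def)
    then show ?thesis using bij_betwE[OF Z[of k]] False by (auto simp: s_def)
  qed
  have sb: "s k l \<in> cn N \<and> nrm N (s k l) \<le> 1 + C * (1 + R)" if lm: "l < m" for k l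
  proof -
    obtain c' where c': "s k l \<in> fibre c'" "nrm N c' \<le> R" using sf[OF lm] R by blast
    have "nrm N (s k l) \<le> 1 + C * (1 + nrm N c')" by (rule fibre_bounded[OF c'(1)])
    also have "\<dots> \<le> 1 + C * (1 + R)" using c'(2) C_pos by simp
    finally show ?thesis using fibreD(1)[OF c'(1)] by blast
  qed
  obtain r L where rL: "strict_mono (r::nat\<Rightarrow>nat)" "\<And>l. l < m \<Longrightarrow> L l \<in> cn N"
    "\<And>l i. l < m \<Longrightarrow> i < N \<Longrightarrow> (\<lambda>k. s (r k) l i) \<longlonglongrightarrow> L l i"
    using bounded_tuples_subsequence[of m s N, OF sb] by blast
  have sub: "(\<lambda>k. f (r k)) \<longlonglongrightarrow> l" if "f \<longlonglongrightarrow> l" for f :: "nat \<Rightarrow> complex" and l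
    using LIMSEQ_subseq_LIMSEQ[OF that rL(1)] by (simp add: o_def)
  have Lna: "L l \<noteq> a" if l: "l < D" for l
  proof
    assume La: "L l = a"
    have lm: "l < m" using l by (simp add: m_def)
    have "(\<lambda>k. nrm N (vdiff (s (r k) l) a)) \<longlonglongrightarrow> 0"
      unfolding tendsto_nrm_iff using rL(3)[OF lm] La by simp
    then have "\<forall>\<^sub>F k in sequentially. nrm N (vdiff (s (r k) l) a) < \<epsilon>" by (rule order_tendstoD) (rule ep)
    then obtain k where k: "nrm N (vdiff (s (r k) l) a) < \<epsilon>" by (auto simp: eventually_sequentially)
    have "s (r k) l \<in> fibre (c (r k))" using bij_betwE[OF Y[of "r k"]] l by (auto simp: s_def)
    then show False using c[of "r k"] k by (auto simp: bad_def)
  qed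
  \<comment> \<open>\<open>\<theta>\<close> separates \<open>a\<close> from the other limit points\<close>
  define A where "A = L ` {..<m} - {a}"
  have A: "finite A" "A \<subseteq> cn N" "a \<notin> A" using rL(2) by (auto simp: A_def)
  obtain \<theta> where th0: "polyfun N (card A) \<theta>" "\<theta> a = 1" "\<forall>b\<in>A. \<theta> b = 0"
    using interpolating_polyfun[OF A(1,2) a A(3)] by blast
  have "card A \<le> n * card A" using n_pos by simp
  then have th: "polyfun N (n * card A) \<theta>" using th0(1) polyfun.weaken by blast
  obtain Lip where Lip: "\<And>c c'. c \<in> cn N \<Longrightarrow> c' \<in> cn N \<Longrightarrow> disc c \<noteq> 0 \<Longrightarrow> disc c' \<noteq> 0 \<Longrightarrow>
    nrm N c \<le> R \<Longrightarrow> nrm N c' \<le> R \<Longrightarrow>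
    cmod ((\<Sum>x\<in>fibre c'. \<theta> x) - (\<Sum>x\<in>fibre c. \<theta> x)) \<le> Lip * nrm N (vdiff c' c)"
    using trace_lipschitz[OF th R(3)] by blast
  define trc where "trc = (\<lambda>k. \<Sum>l<D. \<theta> (s (r k) l))"
  define tre where "tre = (\<lambda>k. \<theta> (x (r k)) + (\<Sum>l<D - 1. \<theta> (s (r k) (D + l))))"
  have trc: "trc k = (\<Sum>x\<in>fibre (c (r k)). \<theta> x)" for k
    using sum.reindex_bij_betw[OF Y[of "r k"], of \<theta>] by (simp add: trc_def s_def lessThan_atLeast0)
  have tre: "tre k = (\<Sum>x\<in>fibre (e (r k)). \<theta> x)" for k
    using sum.reindex_bij_betw[OF Z[of "r k"], of \<theta>] sum.remove[OF finite_fibre[OF eB] xf, of \<theta> "r k"]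
    by (simp add: tre_def s_def lessThan_atLeast0)
  have thL: "(\<lambda>k. \<theta> (s (r k) l)) \<longlonglongrightarrow> \<theta> (L l)" if "l < m" for l
    by (rule polyfun_tendsto[OF th rL(3)[OF that]])
  have "trc \<longlonglongrightarrow> (\<Sum>l<D. \<theta> (L l))" unfolding trc_def
    by (intro tendsto_sum thL) (auto simp: m_def)
  moreover have "\<theta> (L l) = 0" if "l < D" for l
    using th0(3) Lna[OF that] that by (auto simp: A_def m_def)
  ultimately have trc0: "trc \<longlonglongrightarrow> 0" by simp
  have "tre \<longlonglongrightarrow> \<theta> a + (\<Sum>l<D - 1. \<theta> (L (D + l)))" unfolding tre_def
    by (intro tendsto_add tendsto_sum thL polyfun_tendsto[OF th] sub xlim) (auto simp: m_def)
  then have "(\<lambda>k. tre k - trc k) \<longlonglongrightarrow> (1 + (\<Sum>l<D - 1. \<theta> (L (D + l)))) - 0"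
    using th0(2) by (intro tendsto_diff trc0) simp
  moreover have "(\<lambda>k. tre k - trc k) \<longlonglongrightarrow> 0"
  proof (rule Lim_null_comparison)
    show "\<forall>\<^sub>F k in sequentially. cmod (tre k - trc k) \<le> Lip * nrm N (vdiff (e (r k)) (c (r k)))"
      unfolding trc tre by (intro always_eventually allI Lip cB eB R)
    have "(\<lambda>k. \<Sum>i<N. cmod (e (r k) i - c (r k) i)) \<longlonglongrightarrow> (\<Sum>i<N. cmod (c0 i - c0 i))"
      by (intro tendsto_sum tendsto_norm tendsto_diff sub elim clim) auto
    then have "(\<lambda>k. nrm N (vdiff (e (r k)) (c (r k)))) \<longlonglongrightarrow> 0" by (simp add: nrm_def)
    from tendsto_mult_left[OF this, of Lip]
    show "(\<lambda>k. Lip * nrm N (vdiff (e (r k)) (c (r k)))) \<longlonglongrightarrow> 0" by simp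
  qed
  ultimately have eq: "1 + (\<Sum>l<D - 1. \<theta> (L (D + l))) = 0" using LIMSEQ_unique by fastforce
  have "\<theta> (L (D + l)) = (if L (D + l) = a then 1 else 0)" if "l < D - 1" for l
    using th0(2,3) that by (auto simp: A_def m_def)
  then have "(\<Sum>l<D - 1. \<theta> (L (D + l))) = of_nat (card {l. l < D - 1 \<and> L (D + l) = a})"
    by (simp add: sum.If_cases Int_def)
  then have "of_nat (Suc (card {l. l < D - 1 \<and> L (D + l) = a})) = (0 :: complex)" using eq by simp
  then show False by (simp only: of_nat_eq_0_iff)
qed

end

section \<open>Critical values as functions of the critical points\<close>

text \<open>
  Vieta's formulas.
\<close>

lemma prod_linear_esym:
  fixes x :: "'i \<Rightarrow> complex"
  assumes "finite A"
  shows "(\<Prod>i\<in>A. [:- x i, 1:]) = (\<Sum>l\<le>card A. Polynomial.monom ((-1) ^ l * esym l x A) (card A - l))"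
proof -
  have lin: "[:- x i, 1:] = [:- x i:] + [:0, 1:]" for i by simp
  have const: "(\<Prod>i\<in>X. [:- x i:]) = [:(-1) ^ card X * (\<Prod>i\<in>X. x i):]" for X
    by (induction X rule: infinite_finite_induct) auto
  have var: "(\<Prod>i\<in>X. [:0, 1:]) = Polynomial.monom (1::complex) (card X)" for X :: "'i set"
    by (simp add: monom_altdef)
  have "(\<Prod>i\<in>A. [:- x i, 1:]) = (\<Sum>X\<in>Pow A. (\<Prod>i\<in>X. [:- x i:]) * (\<Prod>i\<in>A - X. [:0, 1:]))"
    unfolding lin by (rule prod_add[OF assms])
  also have "\<dots> = (\<Sum>X\<in>Pow A. Polynomial.monom ((-1) ^ card X * (\<Prod>i\<in>X. x i)) (card A - card X))"
  proof (intro sum.cong refl)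
    fix X assume "X \<in> Pow A"
    then have "card (A - X) = card A - card X" using assms by (simp add: card_Diff_subset finite_subset)
    then show "(\<Prod>i\<in>X. [:- x i:]) * (\<Prod>i\<in>A - X. [:0, 1:]) =
        Polynomial.monom ((-1) ^ card X * (\<Prod>i\<in>X. x i)) (card A - card X)"
      by (simp only: const var) (simp add: smult_monom)
  qed
  also have "\<dots> = (\<Sum>l\<le>card A. \<Sum>X\<in>{X\<in>Pow A. card X = l}.
      Polynomial.monom ((-1) ^ card X * (\<Prod>i\<in>X. x i)) (card A - card X))"
    by (rule sum.group[symmetric]) (use assms in \<open>auto intro: card_mono\<close>)
  also have "\<dots> = (\<Sum>l\<le>card A. Polynomial.monom ((-1) ^ l * esym l x A) (card A - l))"
  proof (intro sum.cong refl)
    fix l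
    have "{X \<in> Pow A. card X = l} = {I. I \<subseteq> A \<and> card I = l}" by auto
    then have "(\<Sum>X\<in>{X\<in>Pow A. card X = l}. Polynomial.monom ((-1) ^ card X * (\<Prod>i\<in>X. x i)) (card A - card X))
        = (\<Sum>X\<in>{I. I \<subseteq> A \<and> card I = l}. Polynomial.monom ((-1) ^ l * (\<Prod>i\<in>X. x i)) (card A - l))"
      by (intro sum.cong) auto
    also have "\<dots> = Polynomial.monom ((-1) ^ l * esym l x A) (card A - l)"
      by (simp add: poly_eq_iff coeff_sum esym_def sum_distrib_left)
    finally show "(\<Sum>X\<in>{X\<in>Pow A. card X = l}. Polynomial.monom ((-1) ^ card X * (\<Prod>i\<in>X. x i)) (card A - card X))
        = Polynomial.monom ((-1) ^ l * esym l x A) (card A - l)" .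
  qed
  finally show ?thesis .
qed

lemma esym_0: "finite A \<Longrightarrow> esym 0 x A = 1"
proof -
  assume "finite A"
  then have "{I. I \<subseteq> A \<and> card I = 0} = {{}}" by (auto dest: finite_subset)
  then show ?thesis by (simp add: esym_def)
qed

lemma esym_scale: "esym l (\<lambda>i. c * x i) A = c ^ l * esym l x A"
proof -
  have "(\<Prod>i\<in>I. c * x i) = c ^ l * (\<Prod>i\<in>I. x i)" if "card I = l" for I
    using that by (simp add: prod.distrib)
  then show ?thesis unfolding esym_def sum_distrib_left by (intro sum.cong) auto
qed

lemma esym_cong: "(\<And>i. i \<in> A \<Longrightarrow> x i = y i) \<Longrightarrow> esym l x A = esym l y A"
  unfolding esym_def by (intro sum.cong prod.cong) auto

lemma polyfun_esym: "polyfun N l (\<lambda>x. esym l x {..<N})"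
  unfolding esym_def
proof (rule polyfun_sum)
  fix I assume I: "I \<in> {I. I \<subseteq> {..<N} \<and> card I = l}"
  have "polyfun N (\<Sum>i\<in>I. 1) (\<lambda>x. \<Prod>i\<in>I. x i)"
    by (intro polyfun_prod polyfun.coord) (use I in auto)
  then show "polyfun N l (\<lambda>x. \<Prod>i\<in>I. x i)" using I by simp
qed

definition crit_poly :: "nat \<Rightarrow> (nat \<Rightarrow> complex) \<Rightarrow> complex poly"
  where "crit_poly N x = (\<Prod>i<N. [:- x i, 1:])"

text \<open>
  The primitive, vanishing at \<open>0\<close>, of \<open>N + 1\<close> times \<open>crit_poly\<close>: up to its constant term, the monic
  polynomial of degree \<open>N + 1\<close> with critical points \<open>x\<close>.
\<close>

definition crit_primitive :: "nat \<Rightarrow> (nat \<Rightarrow> complex) \<Rightarrow> complex poly"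
  where "crit_primitive N x = (\<Sum>l\<le>N. Polynomial.monom
    ((-1) ^ l * (of_nat (Suc N) / of_nat (Suc N - l)) * esym l x {..<N}) (Suc N - l))"

lemma pderiv_crit_primitive: "pderiv (crit_primitive N x) = Polynomial.smult (of_nat (Suc N)) (crit_poly N x)"
proof -
  have "pderiv (crit_primitive N x) = (\<Sum>l\<le>N. pderiv (Polynomial.monom
    ((-1) ^ l * (of_nat (Suc N) / of_nat (Suc N - l)) * esym l x {..<N}) (Suc N - l)))"
    unfolding crit_primitive_def by (rule higher_pderiv_sum[of 1, simplified])
  also have "\<dots> = (\<Sum>l\<le>N. Polynomial.smult (of_nat (Suc N)) (Polynomial.monom ((-1) ^ l * esym l x {..<N}) (N - l)))"
  proof (intro sum.cong refl)
    fix l assume l: "l \<in> {..N}"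
    then have "of_nat (Suc N - l) \<noteq> (0 :: complex)" unfolding of_nat_eq_0_iff by auto
    moreover have "Suc N - l - 1 = N - l" by simp
    ultimately show "pderiv (Polynomial.monom
        ((-1) ^ l * (of_nat (Suc N) / of_nat (Suc N - l)) * esym l x {..<N}) (Suc N - l)) =
      Polynomial.smult (of_nat (Suc N)) (Polynomial.monom ((-1) ^ l * esym l x {..<N}) (N - l))"
      unfolding pderiv_monom smult_monom by (simp del: of_nat_Suc)
  qed
  also have "\<dots> = Polynomial.smult (of_nat (Suc N)) (crit_poly N x)"
    unfolding crit_poly_def prod_linear_esym[OF finite_lessThan]
    by (simp add: poly_eq_iff coeff_sum sum_distrib_left del: of_nat_Suc)
  finally show ?thesis .
qed

lemma coeff_crit_primitive:
  "coeff (crit_primitive N x) k = (if 1 \<le> k \<and> k \<le> Suc N then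
     (-1) ^ (Suc N - k) * (of_nat (Suc N) / of_nat k) * esym (Suc N - k) x {..<N} else 0)"
proof -
  have "coeff (crit_primitive N x) k = (\<Sum>l\<le>N. if l = Suc N - k \<and> k \<le> Suc N then
      (-1) ^ (Suc N - k) * (of_nat (Suc N) / of_nat k) * esym (Suc N - k) x {..<N} else 0)"
    unfolding crit_primitive_def coeff_sum coeff_monom by (intro sum.cong) auto
  also have "\<dots> = (if 1 \<le> k \<and> k \<le> Suc N then
     (-1) ^ (Suc N - k) * (of_nat (Suc N) / of_nat k) * esym (Suc N - k) x {..<N} else 0)"
    by (cases "k \<le> Suc N") (auto simp: sum.delta)
  finally show ?thesis .
qed

lemma degree_crit_primitive: "degree (crit_primitive N x) = Suc N"
  and lead_crit_primitive: "coeff (crit_primitive N x) (Suc N) = 1"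
  and crit_primitive_0: "poly (crit_primitive N x) 0 = 0"
proof -
  show 1: "coeff (crit_primitive N x) (Suc N) = 1"
    by (simp add: coeff_crit_primitive esym_0 del: of_nat_Suc)
  have "degree (crit_primitive N x) \<le> Suc N"
    by (rule degree_le) (simp add: coeff_crit_primitive)
  moreover have "Suc N \<le> degree (crit_primitive N x)" by (rule le_degree) (simp add: 1)
  ultimately show "degree (crit_primitive N x) = Suc N" by simp
  show "poly (crit_primitive N x) 0 = 0" by (simp add: poly_0_coeff_0 coeff_crit_primitive)
qed

definition crit_value :: "nat \<Rightarrow> nat \<Rightarrow> (nat \<Rightarrow> complex) \<Rightarrow> complex"
  where "crit_value N j x = poly (crit_primitive N x) (x j)"

lemma poly_crit_primitive:
  "poly (crit_primitive N x) t = (\<Sum>l\<le>N. (-1) ^ l * (of_nat (Suc N) / of_nat (Suc N - l)) * esym l x {..<N} * t ^ (Suc N - l))"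
  by (simp add: crit_primitive_def poly_sum poly_monom)

lemma polyfun_crit_value: "j < N \<Longrightarrow> polyfun N (Suc N) (crit_value N j)"
proof -
  assume j: "j < N"
  have "polyfun N (Suc N) (\<lambda>x. (-1) ^ l * (of_nat (Suc N) / of_nat (Suc N - l)) * (esym l x {..<N} * x j ^ (Suc N - l)))"
    if l: "l \<le> N" for l
  proof (rule polyfun_cmult)
    have "polyfun N (l + (Suc N - l) * 1) (\<lambda>x. esym l x {..<N} * x j ^ (Suc N - l))"
      by (intro polyfun.mult polyfun_esym polyfun_power polyfun.coord j) simp
    then show "polyfun N (Suc N) (\<lambda>x. esym l x {..<N} * x j ^ (Suc N - l))" using l by simp
  qed
  then have "polyfun N (Suc N) (\<lambda>x. \<Sum>l\<le>N. (-1) ^ l * (of_nat (Suc N) / of_nat (Suc N - l)) * (esym l x {..<N} * x j ^ (Suc N - l)))"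
    by (intro polyfun_sum) auto
  then show ?thesis by (simp add: crit_value_def[abs_def] poly_crit_primitive mult.assoc)
qed

lemma poly_crit_primitive_scale:
  "poly (crit_primitive N (\<lambda>i. c * x i)) (c * t) = c ^ Suc N * poly (crit_primitive N x) t"
proof -
  have "(-1) ^ l * r * esym l (\<lambda>i. c * x i) {..<N} * (c * t) ^ (Suc N - l) =
      c ^ Suc N * ((-1) ^ l * r * esym l x {..<N} * t ^ (Suc N - l))" if "l \<le> N" for l r
  proof -
    have pw: "c ^ l * c ^ (Suc N - l) = c ^ Suc N" using that by (simp add: power_add[symmetric])
    have "(-1) ^ l * r * (c ^ l * esym l x {..<N}) * (c ^ (Suc N - l) * t ^ (Suc N - l)) =
      (c ^ l * c ^ (Suc N - l)) * ((-1) ^ l * r * esym l x {..<N} * t ^ (Suc N - l))"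
      by (simp only: mult_ac)
    then show ?thesis unfolding esym_scale power_mult_distrib pw .
  qed
  then show ?thesis unfolding poly_crit_primitive sum_distrib_left by (intro sum.cong) auto
qed

lemma crit_value_scale: "crit_value N j (\<lambda>i. c * x i) = c ^ Suc N * crit_value N j x"
  by (simp add: crit_value_def poly_crit_primitive_scale)

lemma poly_crit_poly_eq_0_iff: "poly (crit_poly N x) t = 0 \<longleftrightarrow> (\<exists>i<N. t = x i)"
  by (auto simp: crit_poly_def poly_prod)

lemma crit_poly_nonzero: "crit_poly N x \<noteq> 0"
  by (simp add: crit_poly_def)

lemma sum_order_eq_degree:
  fixes p :: "complex poly"
  assumes "p \<noteq> 0"
  shows "(\<Sum>a\<in>{a. poly p a = 0}. order a p) = degree p"
  using size_proots_complex[of p] assms by (simp add: size_multiset_overloaded_eq)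

text \<open>
  A count of multiplicities: the order of a root of \<open>R\<close> exceeds its order as a root of \<open>R'\<close> by one, and by
  assumption all roots of \<open>R'\<close> are roots of \<open>R\<close>. Comparing degrees, \<open>R\<close> has exactly one root; as
  \<open>R\<close> vanishes at \<open>0\<close>, this root is \<open>0\<close>.
\<close>

lemma crit_values_zero_imp_zero:
  assumes x: "x \<in> cn N" and z: "\<And>j. j < N \<Longrightarrow> crit_value N j x = 0"
  shows "x = (\<lambda>_. 0)"
proof -
  define R where "R = crit_primitive N x"
  have R0: "R \<noteq> 0" using lead_crit_primitive[of N x] by (auto simp: R_def)
  define R' where "R' = pderiv R"
  have R'0: "R' \<noteq> 0" using crit_poly_nonzero by (simp add: R'_def R_def pderiv_crit_primitive del: of_nat_Suc)
  have degR: "degree R = Suc N" by (simp add: R_def degree_crit_primitive)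
  have degR': "degree R' = N" by (simp add: R'_def degree_pderiv degR)
  have rootsR': "poly R' a = 0 \<longleftrightarrow> (\<exists>i<N. a = x i)" for a
    by (simp add: R'_def R_def pderiv_crit_primitive poly_crit_poly_eq_0_iff del: of_nat_Suc)
  have sub: "{a. poly R' a = 0} \<subseteq> {a. poly R a = 0}"
    using z by (auto simp: rootsR' crit_value_def R_def)
  have fin: "finite {a. poly R a = 0}" using R0 by (rule poly_roots_finite)
  have "Suc N = (\<Sum>a\<in>{a. poly R a = 0}. order a R)" using sum_order_eq_degree[OF R0] degR by simp
  also have "\<dots> = (\<Sum>a\<in>{a. poly R a = 0}. 1 + order a R')"
    by (intro sum.cong) (auto simp: R'_def order_pderiv[OF R0])
  also have "\<dots> = card {a. poly R a = 0} + (\<Sum>a\<in>{a. poly R a = 0}. order a R')"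
    by (simp only: sum.distrib) simp
  also have "(\<Sum>a\<in>{a. poly R a = 0}. order a R') = (\<Sum>a\<in>{a. poly R' a = 0}. order a R')"
    by (rule sum.mono_neutral_right) (use fin sub in \<open>auto simp: order_root\<close>)
  also have "\<dots> = N" using sum_order_eq_degree[OF R'0] degR' by simp
  finally have "card {a. poly R a = 0} = 1" by simp
  moreover have "0 \<in> {a. poly R a = 0}" by (simp add: R_def crit_primitive_0)
  ultimately have "{a. poly R a = 0} = {0}" by (metis card_1_singletonE singletonD)
  then have "x i = 0" if "i < N" for i using sub rootsR' that by auto
  then show ?thesis using x by (auto simp: cn_def fun_eq_iff not_less[symmetric])
qed

text \<open>
  On the unit sphere the map is bounded away from \<open>0\<close>, by compactness and \<open>crit_values_zero_imp_zero\<close>. The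
  general case follows by homogeneity.
\<close>

lemma crit_value_proper:
  "\<exists>C>0. \<forall>x\<in>cn N. nrm N x ^ Suc N \<le> C * (1 + nrm N (himg N (crit_value N) x))"
proof -
  have "\<exists>m>0. \<forall>x\<in>cn N. nrm N x = 1 \<longrightarrow> m \<le> nrm N (himg N (crit_value N) x)"
  proof (rule ccontr)
    assume neg: "\<not> ?thesis"
    have "\<forall>k. \<exists>x. x \<in> cn N \<and> nrm N x = 1 \<and> nrm N (himg N (crit_value N) x) < 1 / Suc k"
    proof
      fix k
      have "(1 :: real) / Suc k > 0" by simp
      then show "\<exists>x. x \<in> cn N \<and> nrm N x = 1 \<and> nrm N (himg N (crit_value N) x) < 1 / Suc k"
        using neg not_le by blast
    qed
    from choice[OF this] obtain x where x: "\<And>k. x k \<in> cn N" "\<And>k. nrm N (x k) = 1"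
      "\<And>k. nrm N (himg N (crit_value N) (x k)) < 1 / Suc k" by blast
    obtain r l where rl: "strict_mono (r::nat\<Rightarrow>nat)" "l \<in> cn N" "\<And>i. i < N \<Longrightarrow> (\<lambda>k. x (r k) i) \<longlonglongrightarrow> l i"
      using bounded_sequence_subsequence[of x N 1] x by auto
    have "(\<lambda>k. nrm N (x (r k))) \<longlonglongrightarrow> nrm N l" unfolding nrm_def
      by (intro tendsto_intros rl) auto
    then have l1: "nrm N l = 1" using x(2) by (simp add: LIMSEQ_const_iff)
    have "crit_value N j l = 0" if j: "j < N" for j
    proof -
      have "(\<lambda>k. crit_value N j (x (r k))) \<longlonglongrightarrow> crit_value N j l"
        by (rule polyfun_tendsto[OF polyfun_crit_value[OF j]]) (rule rl)
      moreover have "(\<lambda>k. crit_value N j (x (r k))) \<longlonglongrightarrow> 0"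
      proof (rule Lim_null_comparison[OF _ LIMSEQ_inverse_real_of_nat], rule always_eventually, rule allI)
        fix k
        have "cmod (crit_value N j (x (r k))) \<le> nrm N (himg N (crit_value N) (x (r k)))"
          using cmod_le_nrm[OF j, of "himg N (crit_value N) (x (r k))"] j by (simp add: himg_def)
        also have "\<dots> \<le> 1 / Suc (r k)" using x(3) less_imp_le by blast
        also have "\<dots> \<le> 1 / Suc k" using seq_suble[OF rl(1), of k] by (simp add: frac_le)
        finally show "cmod (crit_value N j (x (r k))) \<le> inverse (real (Suc k))" by (simp add: inverse_eq_divide)
      qed
      ultimately show ?thesis using LIMSEQ_unique by blast
    qed
    then have "l = (\<lambda>_. 0)" by (rule crit_values_zero_imp_zero[OF rl(2)])
    then show False using l1 by (simp add: nrm_def)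
  qed
  then obtain m where m: "m > 0" "\<And>x. x \<in> cn N \<Longrightarrow> nrm N x = 1 \<Longrightarrow> m \<le> nrm N (himg N (crit_value N) x)" by blast
  have "nrm N x ^ Suc N \<le> 1 / m * (1 + nrm N (himg N (crit_value N) x))" if x: "x \<in> cn N" for x
  proof (cases "nrm N x = 0")
    case True
    have "0 \<le> 1 / m * (1 + nrm N (himg N (crit_value N) x))" using m(1) by (intro mult_nonneg_nonneg add_nonneg_nonneg) auto
    then show ?thesis using True by simp
  next
    case False
    define s where "s = nrm N x"
    have s: "s > 0" using False nrm_nonneg[of N x] by (auto simp: s_def less_eq_real_def)
    define y where "y = (\<lambda>i. (1 / complex_of_real s) * x i)"
    have y: "y \<in> cn N" using x by (auto simp: y_def cn_def)
    have ny: "nrm N y = 1" unfolding y_def nrm_scale using s by (simp add: s_def[symmetric] norm_divide)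
    have xy: "x = (\<lambda>i. complex_of_real s * y i)" using s by (simp add: y_def)
    have "himg N (crit_value N) x = (\<lambda>i. complex_of_real s ^ Suc N * himg N (crit_value N) y i)"
      by (subst xy) (auto simp: himg_def crit_value_scale)
    then have "nrm N (himg N (crit_value N) x) = s ^ Suc N * nrm N (himg N (crit_value N) y)"
      using s by (simp only: nrm_scale) (simp add: norm_power norm_mult)
    also have "\<dots> \<ge> s ^ Suc N * m" using m(2)[OF y ny] s by (intro mult_left_mono) auto
    finally have "s ^ Suc N * m \<le> nrm N (himg N (crit_value N) x)" .
    then have "s ^ Suc N \<le> 1 / m * nrm N (himg N (crit_value N) x)" using m(1) by (simp add: field_simps)
    also have "\<dots> \<le> 1 / m * (1 + nrm N (himg N (crit_value N) x))" using m(1) by (intro mult_left_mono) auto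
    finally show ?thesis by (simp add: s_def)
  qed
  then show ?thesis using m(1) by (intro exI[of _ "1 / m"]) auto
qed

text \<open>
  Let \<open>w\<close> be a direction in which all derivatives vanish, and let \<open>V\<close> be the derivative at \<open>t = 0\<close> of the
  polynomial with critical points \<open>x + t w\<close>. As \<open>x j\<close> is a critical point, moving the point of evaluation
  does not contribute to first order, so \<open>V (x j) = 0\<close>. Also \<open>V 0 = 0\<close>, and the degree of \<open>V\<close> is at most
  \<open>N\<close> because the polynomials of the family are monic of degree \<open>N + 1\<close>. Having \<open>N + 1\<close> zeros, \<open>V\<close>
  is \<open>0\<close>. So the polynomial \<open>\<Prod>(z - x\<^sub>l - t w\<^sub>l)\<close> is stationary at \<open>t = 0\<close>, and its derivative at the
  simple root \<open>z = x\<^sub>i\<close> is a nonzero multiple of \<open>w\<^sub>i\<close>.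
\<close>

lemma crit_value_regular:
  assumes x: "x \<in> cn N" and inj: "inj_on x {..<N}" and nz: "\<And>j. j < N \<Longrightarrow> x j \<noteq> 0"
  shows "regular_at N (crit_value N) x"
  unfolding regular_at_def
proof (intro ballI impI)
  fix w assume w: "w \<in> cn N" and der: "\<forall>j<N. ((\<lambda>t. crit_value N j (ray x w t)) has_field_derivative 0) (at 0)"
  \<comment> \<open>the coefficients move with \<open>t\<close>, and \<open>D k\<close> is the velocity of the coefficient with index \<open>k\<close>\<close>
  define cf where "cf = (\<lambda>k y. coeff (crit_primitive N y) k)"
  have "\<exists>p. \<forall>t. cf k (ray x w t) = poly p t" for k
  proof -
    have "polyfun N (Suc N - k) (cf k)"
    proof (cases "1 \<le> k \<and> k \<le> Suc N")
      case True
      then show ?thesis unfolding cf_def coeff_crit_primitive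
        by (simp only: if_True True simp_thms) (intro polyfun_cmult polyfun_esym)
    next
      case False
      then show ?thesis unfolding cf_def coeff_crit_primitive by (simp only: if_False False polyfun.const)
    qed
    from polyfun_ray[OF this, of x w] show ?thesis by auto
  qed
  then have "\<forall>k. \<exists>p. \<forall>t. cf k (ray x w t) = poly p t" by blast
  from choice[OF this] obtain P where P: "\<And>k t. cf k (ray x w t) = poly (P k) t" by blast
  define D where "D = (\<lambda>k. poly (pderiv (P k)) 0)"
  have cfd: "((\<lambda>t. cf k (ray x w t)) has_field_derivative D k) (at 0)" for k
    unfolding P D_def by (rule poly_DERIV)
  define V where "V = (\<Sum>k\<le>N. Polynomial.monom (D k) k)"
  have D0: "D 0 = 0"
  proof (rule DERIV_unique[OF cfd])
    show "((\<lambda>t. cf 0 (ray x w t)) has_field_derivative 0) (at 0)" by (simp add: cf_def coeff_crit_primitive)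
  qed
  have DN: "D (Suc N) = 0"
  proof (rule DERIV_unique[OF cfd])
    show "((\<lambda>t. cf (Suc N) (ray x w t)) has_field_derivative 0) (at 0)" by (simp add: cf_def lead_crit_primitive)
  qed
  have ex: "poly (crit_primitive N y) z = (\<Sum>k\<le>Suc N. cf k y * z ^ k)" for y z
    unfolding cf_def by (subst poly_altdef) (simp only: degree_crit_primitive)
  have Vx: "poly V (x j) = 0" if j: "j < N" for j
  proof -
    have "((\<lambda>t. crit_value N j (ray x w t)) has_field_derivative
        (\<Sum>k\<le>Suc N. cf k x * (of_nat k * x j ^ (k - 1) * w j) + D k * x j ^ k)) (at 0)"
      unfolding crit_value_def ex
    proof (rule DERIV_sum)
      fix k
      have "((\<lambda>t. ray x w t j) has_field_derivative w j) (at 0)"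
        unfolding ray_def by (auto intro!: derivative_eq_intros)
      from DERIV_power[OF this, of k]
      have "((\<lambda>t. ray x w t j ^ k) has_field_derivative (of_nat k * x j ^ (k - 1) * w j)) (at 0)"
        by (simp add: mult_ac)
      from DERIV_mult[OF cfd[of k] this]
      show "((\<lambda>t. cf k (ray x w t) * ray x w t j ^ k) has_field_derivative
          (cf k x * (of_nat k * x j ^ (k - 1) * w j) + D k * x j ^ k)) (at 0)"
        by (simp add: algebra_simps)
    qed
    moreover have "((\<lambda>t. crit_value N j (ray x w t)) has_field_derivative 0) (at 0)" using der j by blast
    ultimately have "0 = (\<Sum>k\<le>Suc N. cf k x * (of_nat k * x j ^ (k - 1) * w j) + D k * x j ^ k)"
      using DERIV_unique by blast
    also have "\<dots> = w j * (\<Sum>k\<le>Suc N. cf k x * (of_nat k * x j ^ (k - 1))) + (\<Sum>k\<le>Suc N. D k * x j ^ k)"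
      by (simp only: sum.distrib sum_distrib_left mult_ac)
    also have "(\<Sum>k\<le>Suc N. cf k x * (of_nat k * x j ^ (k - 1))) = poly (pderiv (crit_primitive N x)) (x j)"
    proof (rule DERIV_unique)
      have "((\<lambda>z. \<Sum>k\<le>Suc N. cf k x * z ^ k) has_field_derivative
          (\<Sum>k\<le>Suc N. cf k x * (of_nat k * x j ^ (k - 1)))) (at (x j))"
        by (intro DERIV_sum DERIV_cmult) (auto intro!: derivative_eq_intros)
      then show "((\<lambda>z. poly (crit_primitive N x) z) has_field_derivative
          (\<Sum>k\<le>Suc N. cf k x * (of_nat k * x j ^ (k - 1)))) (at (x j))" by (simp only: ex)
    qed (rule poly_DERIV)
    also have "\<dots> = 0" using j by (auto simp: pderiv_crit_primitive poly_crit_poly_eq_0_iff)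
    also have "(\<Sum>k\<le>Suc N. D k * x j ^ k) = poly V (x j)"
      by (simp add: V_def poly_sum poly_monom DN)
    finally show ?thesis by simp
  qed
  have V0: "poly V 0 = 0" by (simp add: V_def poly_0_coeff_0 coeff_sum D0)
  have "V = 0"
  proof (rule ccontr)
    assume "V \<noteq> 0"
    have "insert 0 (x ` {..<N}) \<subseteq> {a. poly V a = 0}" using V0 Vx by auto
    then have "card (insert 0 (x ` {..<N})) \<le> card {a. poly V a = 0}"
      by (intro card_mono poly_roots_finite \<open>V \<noteq> 0\<close>)
    also have "\<dots> \<le> degree V" by (rule card_poly_roots_bound[OF \<open>V \<noteq> 0\<close>])
    also have "\<dots> \<le> N" unfolding V_def
      by (intro degree_sum_le) (auto intro: order_trans[OF degree_monom_le])
    also have "card (insert 0 (x ` {..<N})) = Suc N"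
      using nz by (subst card_insert_disjoint) (auto simp: card_image[OF inj] image_iff)
    finally show False by simp
  qed
  then have Dk: "D k = 0" if "k \<le> Suc N" for k
  proof (cases "k = Suc N")
    case False
    have "coeff V k = D k" using that False by (simp add: V_def coeff_sum)
    then show ?thesis using \<open>V = 0\<close> by simp
  qed (use DN in simp)
  show "w = (\<lambda>_. 0)"
  proof (rule cn_eqI[OF w])
    fix i assume i: "i < N"
    have W: "poly (crit_poly N y) s = (\<Sum>k\<le>N. of_nat (Suc k) / of_nat (Suc N) * cf (Suc k) y * s ^ k)" for y s
    proof -
      have "of_nat (Suc N) * coeff (crit_poly N y) k = of_nat (Suc k) * cf (Suc k) y" for k
        using arg_cong[OF pderiv_crit_primitive[of N y], of "\<lambda>p. coeff p k"]
        by (simp only: coeff_pderiv coeff_smult cf_def)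
      note eq = this
      have c: "coeff (crit_poly N y) k = of_nat (Suc k) / of_nat (Suc N) * cf (Suc k) y" for k
      proof -
        have b: "of_nat (Suc N) \<noteq> (0::complex)" by (simp del: of_nat_Suc)
        have "coeff (crit_poly N y) k = of_nat (Suc N) * coeff (crit_poly N y) k / of_nat (Suc N)"
          by (simp only: nonzero_mult_div_cancel_left[OF b])
        then show ?thesis by (simp only: eq times_divide_eq_left)
      qed
      have "degree (crit_poly N y) = N"
        unfolding crit_poly_def by (subst degree_prod_eq_sum_degree) auto
      then show ?thesis by (simp only: poly_altdef c)
    qed
    have "((\<lambda>t. poly (crit_poly N (ray x w t)) (x i)) has_field_derivative
        (\<Sum>k\<le>N. of_nat (Suc k) / of_nat (Suc N) * D (Suc k) * x i ^ k)) (at 0)"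
      unfolding W by (intro DERIV_sum DERIV_cmult DERIV_cmult_right cfd)
    then have d0: "((\<lambda>t. poly (crit_poly N (ray x w t)) (x i)) has_field_derivative 0) (at 0)"
      using Dk by simp
    have "poly (crit_poly N (ray x w t)) (x i) = - t * w i * (\<Prod>l\<in>{..<N} - {i}. x i - x l - t * w l)" for t
    proof -
      have "poly (crit_poly N (ray x w t)) (x i) = (\<Prod>l<N. x i - x l - t * w l)"
        by (simp add: crit_poly_def poly_prod ray_def algebra_simps)
      also have "\<dots> = (x i - x i - t * w i) * (\<Prod>l\<in>{..<N} - {i}. x i - x l - t * w l)"
        by (rule prod.remove) (use i in auto)
      finally show ?thesis by simp
    qed
    note prod_form = this
    have zero: "poly (crit_poly N x) (x i) = 0" using prod_form[of 0] by simp
    have eq: "poly (crit_poly N (ray x w t)) (x i) / t =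
        - w i * (\<Prod>l\<in>{..<N} - {i}. x i - x l - t * w l)" if "t \<noteq> 0" for t
      unfolding prod_form[of t] using that by simp
    have "((\<lambda>t. poly (crit_poly N (ray x w t)) (x i) / t) \<longlongrightarrow> 0) (at 0)"
      using d0 unfolding has_field_derivative_iff by (simp add: zero)
    then have "((\<lambda>t. - w i * (\<Prod>l\<in>{..<N} - {i}. x i - x l - t * w l)) \<longlongrightarrow> 0) (at 0)"
      by (rule Lim_transform_eventually) (rule eventually_mono[OF eventually_neq_at_within[of 0] eq])
    moreover have "((\<lambda>t. - w i * (\<Prod>l\<in>{..<N} - {i}. x i - x l - t * w l)) \<longlongrightarrow>
        - w i * (\<Prod>l\<in>{..<N} - {i}. x i - x l - 0 * w l)) (at 0)"
      by (intro tendsto_intros)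
    ultimately have "- w i * (\<Prod>l\<in>{..<N} - {i}. x i - x l - 0 * w l) = 0"
      using tendsto_unique[OF trivial_limit_at] by blast
    moreover have "(\<Prod>l\<in>{..<N} - {i}. x i - x l - 0 * w l) \<noteq> 0"
      using inj i by (auto dest: inj_onD)
    ultimately show "w i = 0" by simp
  qed (simp add: cn_def)
qed

text \<open>
  If \<open>e j\<close> is a critical value of \<open>crit_primitive\<close>, then \<open>e j + (-1) ^ Suc N\<close> is the corresponding one of
  the polynomial with constant term \<open>(-1) ^ Suc N\<close>, whose roots have product \<open>1\<close>. Where none of these
  values vanishes, the roots of that polynomial are simple.
\<close>

definition crit_disc :: "nat \<Rightarrow> (nat \<Rightarrow> complex) \<Rightarrow> complex"
  where "crit_disc N e = (\<Prod>j<N. e j * (e j + (-1) ^ Suc N)) * (\<Prod>j<N. \<Prod>i<j. e i - e j)"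

lemma crit_disc_nonzero_iff:
  "crit_disc N e \<noteq> 0 \<longleftrightarrow> (\<forall>j<N. e j \<noteq> 0 \<and> e j + (-1) ^ Suc N \<noteq> 0) \<and> inj_on e {..<N}"
proof -
  have "(\<Prod>j<N. \<Prod>i<j. e i - e j) \<noteq> 0 \<longleftrightarrow> inj_on e {..<N}"
  proof -
    have "(\<Prod>j<N. \<Prod>i<j. e i - e j) \<noteq> 0 \<longleftrightarrow> (\<forall>j<N. \<forall>i<j. e i \<noteq> e j)" by auto
    also have "\<dots> \<longleftrightarrow> inj_on e {..<N}"
    proof
      assume "\<forall>j<N. \<forall>i<j. e i \<noteq> e j"
      then show "inj_on e {..<N}" by (intro linorder_inj_onI) auto
    next
      assume inj: "inj_on e {..<N}"
      show "\<forall>j<N. \<forall>i<j. e i \<noteq> e j"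
      proof (intro allI impI)
        fix j i assume "j < N" "i < j"
        then show "e i \<noteq> e j" using inj_onD[OF inj, of i j] by auto
      qed
    qed
    finally show ?thesis .
  qed
  moreover have "(\<Prod>j<N. e j * (e j + (-1) ^ Suc N)) \<noteq> 0 \<longleftrightarrow> (\<forall>j<N. e j \<noteq> 0 \<and> e j + (-1) ^ Suc N \<noteq> 0)"
    by (simp add: Ball_def del: power_Suc)
  ultimately show ?thesis unfolding crit_disc_def mult_eq_0_iff de_Morgan_disj by blast
qed

lemma polyfun_crit_disc: "\<exists>m. polyfun N m (crit_disc N)"
proof -
  have "polyfun N (\<Sum>j<N. 1 + 1) (\<lambda>e. \<Prod>j<N. e j * (e j + (-1) ^ Suc N))"
    by (intro polyfun_prod polyfun.mult polyfun.add polyfun.coord polyfun.const) auto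
  moreover have "polyfun N (\<Sum>j<N. \<Sum>i<j. 1) (\<lambda>e. \<Prod>j<N. \<Prod>i<j. e i - e j)"
    by (intro polyfun_prod polyfun_diff polyfun.coord) auto
  ultimately have "polyfun N ((\<Sum>j<N. 1 + 1) + (\<Sum>j<N. \<Sum>i<j. 1)) (crit_disc N)"
    unfolding crit_disc_def[abs_def] by (rule polyfun.mult)
  then show ?thesis ..
qed

text \<open>
  The point \<open>a = (1, \<dots>, N)\<close> is regular, so the line through its value with direction \<open>a\<close> consists, near
  this value, of values of the map. The entries of the direction are nonzero and distinct, so only finitely
  many points of the line are zeros of the discriminant.
\<close>

lemma crit_disc_nonzero_somewhere: "\<exists>x\<in>cn N. crit_disc N (himg N (crit_value N) x) \<noteq> 0"
proof -
  define a where "a = (\<lambda>i. if i < N then of_nat (Suc i) else (0::complex))"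
  have a: "a \<in> cn N" by (simp add: a_def cn_def)
  have reg: "regular_at N (crit_value N) a"
    by (rule crit_value_regular[OF a]) (auto simp: a_def inj_on_def simp del: of_nat_Suc)
  have one_pos: "(0::real) < 1" by simp
  from regular_local_section[of N "Suc N" "crit_value N" a a 1, OF polyfun_crit_value reg a a one_pos]
  obtain d s where ds: "d > 0" "\<forall>t\<in>ball 0 d. s t \<in> cn N \<and> nrm N (vdiff (s t) a) < 1 \<and>
      (\<forall>j<N. crit_value N j (s t) = crit_value N j a + t * a j)"
    by blast
  then have s: "d > 0" "\<And>t. t \<in> ball 0 d \<Longrightarrow> s t \<in> cn N \<and> (\<forall>j<N. crit_value N j (s t) = crit_value N j a + t * a j)"
    by blast+
  have lin: "finite {t. b + t * c = (0::complex)}" if "c \<noteq> 0" for b c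
    using poly_roots_finite[of "[:b, c:]"] that by simp
  define b where "b = (\<lambda>j. crit_value N j a)"
  define E where "E = (\<Union>j<N. {t. b j + t * a j = 0} \<union> {t. (b j + (-1) ^ Suc N) + t * a j = 0}) \<union>
    (\<Union>j<N. \<Union>i<j. {t. (b i - b j) + t * (a i - a j) = 0})"
  have a0: "a j \<noteq> 0" if "j < N" for j using that by (simp add: a_def del: of_nat_Suc)
  have a1: "a i - a j \<noteq> 0" if "j < N" "i < j" for i j using that by (simp add: a_def)
  have "finite E" unfolding E_def by (intro finite_UnI finite_UN_I finite_lessThan lin) (use a0 a1 in auto)
  then have "\<forall>\<^sub>F t in at 0. t \<notin> E" by (rule eventually_avoids_finite)
  moreover have "\<forall>\<^sub>F t in at 0. t \<in> ball 0 d" by (rule eventually_at_in_open') (use s in auto)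
  ultimately have "\<forall>\<^sub>F t in at 0. t \<notin> E \<and> t \<in> ball 0 d" by eventually_elim simp
  then obtain t where t: "t \<notin> E" "t \<in> ball 0 d" using eventually_happens'[OF at_neq_bot] by blast
  define c where "c = himg N (crit_value N) (s t)"
  have c: "c j = b j + t * a j" if "j < N" for j using s(2)[OF t(2)] that by (simp add: c_def himg_def b_def)
  have "inj_on c {..<N}"
  proof (rule linorder_inj_onI)
    fix i j assume ij: "i < j" "i \<in> {..<N}" "j \<in> {..<N}"
    then have nz: "(b i - b j) + t * (a i - a j) \<noteq> 0" using t(1) unfolding E_def by blast
    have "c i - c j = (b i - b j) + t * (a i - a j)"
      using c[of i] c[of j] ij by (simp add: right_diff_distrib)
    then show "c i \<noteq> c j" using nz by (metis diff_self)
  qed auto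
  moreover have "c j \<noteq> 0 \<and> c j + (-1) ^ Suc N \<noteq> 0" if j: "j < N" for j
  proof -
    have "b j + t * a j \<noteq> 0" "(b j + (-1) ^ Suc N) + t * a j \<noteq> 0" using t(1) j unfolding E_def by blast+
    then show ?thesis unfolding c[OF j] by (simp only: add_ac) simp
  qed
  ultimately have "crit_disc N c \<noteq> 0" unfolding crit_disc_nonzero_iff by blast
  then show ?thesis using s(2)[OF t(2)] unfolding c_def by blast
qed

text \<open>
  The fibres of the locale instance below, in a form that does not mention its constants.
\<close>

definition crit_fibre :: "nat \<Rightarrow> (nat \<Rightarrow> complex) \<Rightarrow> (nat \<Rightarrow> complex) set"
  where "crit_fibre N c = {x \<in> cn N. himg N (crit_value N) x = c}"

text \<open>
  Distinct nonzero critical values belong to distinct nonzero critical points, so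
  \<open>crit_value_regular\<close> applies over every value with nonzero discriminant.
\<close>

lemma crit_value_proper_polynomial_map:
  "\<exists>m C. proper_polynomial_map N (Suc N) m (crit_value N) (crit_disc N) C"
proof -
  obtain C where C: "C > 0" "\<And>x. x \<in> cn N \<Longrightarrow> nrm N x ^ Suc N \<le> C * (1 + nrm N (himg N (crit_value N) x))"
    using crit_value_proper by blast
  obtain m where m: "polyfun N m (crit_disc N)" using polyfun_crit_disc by blast
  have "regular_at N (crit_value N) x" if x: "x \<in> cn N" and "crit_disc N (himg N (crit_value N) x) \<noteq> 0" for x
  proof -
    define e where "e = himg N (crit_value N) x"
    have e: "\<And>j. j < N \<Longrightarrow> e j \<noteq> 0" "inj_on e {..<N}" using that(2) by (auto simp: crit_disc_nonzero_iff e_def)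
    have ej: "e j = poly (crit_primitive N x) (x j)" if "j < N" for j
      using that by (simp add: e_def himg_def crit_value_def)
    show ?thesis
    proof (rule crit_value_regular[OF x])
      show "inj_on x {..<N}" using e(2) ej by (auto simp: inj_on_def)
      show "x j \<noteq> 0" if "j < N" for j using e(1)[OF that] ej[OF that] crit_primitive_0 by auto
    qed
  qed
  note regular = this
  have "proper_polynomial_map N (Suc N) m (crit_value N) (crit_disc N) C"
    by (rule proper_polynomial_map.intro[OF zero_less_Suc C(1) polyfun_crit_value m C(2) regular
          crit_disc_nonzero_somewhere])
  then show ?thesis by blast
qed

theorem card_crit_fibre:
  assumes "c \<in> cn N" "crit_disc N c \<noteq> 0"
  shows "finite (crit_fibre N c)" "card (crit_fibre N c) = Suc N ^ N"
proof -
  from crit_value_proper_polynomial_map[of N]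
  obtain m C where map: "proper_polynomial_map N (Suc N) m (crit_value N) (crit_disc N) C" by (elim exE)
  have "crit_fibre N c = proper_polynomial_map.fibre N (crit_value N) c"
    unfolding crit_fibre_def proper_polynomial_map.fibre_def[OF map] ..
  then show "finite (crit_fibre N c)" "card (crit_fibre N c) = Suc N ^ N"
    using proper_polynomial_map.finite_fibre[OF map assms] proper_polynomial_map.card_fibre[OF map assms]
    by simp_all
qed

text \<open>
  Each point \<open>a\<close> of \<open>A\<close> is approximated by a point \<open>X a\<close> of one and the same regular fibre. Multiplication
  by an \<open>(N + 1)\<close>-st root of unity preserves this fibre, because the map is homogeneous of degree
  \<open>N + 1\<close>. If the approximation is finer than half the distance from a rotation of a point of \<open>A\<close> to any other point
  of \<open>A\<close>, the rotations of the points \<open>X a\<close> are pairwise distinct.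
\<close>

theorem inequivalent_points_bound:
  assumes N: "N > 0" and A: "finite A" "A \<subseteq> crit_fibre N c0"
    and ineq: "\<And>a b \<zeta>. a \<in> A \<Longrightarrow> b \<in> A \<Longrightarrow> \<zeta> ^ Suc N = 1 \<Longrightarrow> (\<lambda>i. \<zeta> * a i) = b \<Longrightarrow> a = b"
  shows "card A * Suc N \<le> Suc N ^ N"
proof (cases "A = {}")
  case False
  from crit_value_proper_polynomial_map[of N]
  obtain m C where map: "proper_polynomial_map N (Suc N) m (crit_value N) (crit_disc N) C" by (elim exE)
  have fibre: "proper_polynomial_map.fibre N (crit_value N) c = crit_fibre N c" for c
    unfolding crit_fibre_def proper_polynomial_map.fibre_def[OF map] ..
  note fibre_approximation = proper_polynomial_map.fibre_approximation[OF map, unfolded fibre]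
  define U where "U = {z :: complex. z ^ Suc N = 1}"
  have cU: "card U = Suc N" unfolding U_def by (rule card_roots_unity_eq) simp
  have finU: "finite U" using cU by (intro card_ge_0_finite) simp
  have Un: "cmod z = 1" if "z \<in> U" for z
  proof -
    have "cmod z ^ Suc N = 1 ^ Suc N" using that by (simp only: U_def mem_Collect_eq norm_power[symmetric] norm_one power_one)
    then show ?thesis by (rule power_eq_imp_eq_base) auto
  qed
  have Acn: "a \<in> cn N" "himg N (crit_value N) a = c0" if "a \<in> A" for a using A that by (auto simp: crit_fibre_def)
  have c0: "c0 \<in> cn N" using False Acn himg_in_cn by blast
  define P where "P = {(z, a, b) \<in> U \<times> A \<times> A. a \<noteq> b}"
  have finP: "finite P" unfolding P_def by (rule finite_subset[of _ "U \<times> A \<times> A"]) (use finU A in auto)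
  define dst where "dst = (\<lambda>(z, a, b). nrm N (vdiff (\<lambda>i. z * a i) b))"
  have dpos: "dst zab > 0" if "zab \<in> P" for zab
  proof -
    obtain z a b where zab: "zab = (z, a, b)" "z \<in> U" "a \<in> A" "b \<in> A" "a \<noteq> b" using \<open>zab \<in> P\<close> by (auto simp: P_def)
    have "(\<lambda>i. z * a i) \<noteq> b" using ineq[OF zab(3,4)] zab by (auto simp: U_def)
    then have "vdiff (\<lambda>i. z * a i) b \<noteq> (\<lambda>_. 0)" by (auto simp: fun_eq_iff)
    moreover have "vdiff (\<lambda>i. z * a i) b \<in> cn N" using Acn(1)[OF zab(3)] Acn(1)[OF zab(4)] by (auto simp: cn_def)
    ultimately have "nrm N (vdiff (\<lambda>i. z * a i) b) \<noteq> 0" using nrm_zero_iff by blast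
    then have "nrm N (vdiff (\<lambda>i. z * a i) b) > 0" using nrm_nonneg[of N "vdiff (\<lambda>i. z * a i) b"] by linarith
    then show ?thesis by (simp add: zab(1) dst_def)
  qed
  define \<epsilon> where "\<epsilon> = Min (insert 1 (dst ` P)) / 2"
  have ep: "\<epsilon> > 0" using dpos finP by (simp add: \<epsilon>_def)
  have epd: "2 * \<epsilon> \<le> dst zab" if "zab \<in> P" for zab
    using finP that by (simp add: \<epsilon>_def Min_le)
  have "\<forall>a\<in>A. \<exists>\<delta>>0. \<forall>c\<in>cn N. crit_disc N c \<noteq> 0 \<longrightarrow> nrm N (vdiff c c0) < \<delta> \<longrightarrow> (\<exists>x\<in>crit_fibre N c. nrm N (vdiff x a) < \<epsilon>)"
  proof
    fix a assume "a \<in> A"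
    from fibre_approximation[OF Acn(1)[OF this] ep] Acn(2)[OF this]
    show "\<exists>\<delta>>0. \<forall>c\<in>cn N. crit_disc N c \<noteq> 0 \<longrightarrow> nrm N (vdiff c c0) < \<delta> \<longrightarrow> (\<exists>x\<in>crit_fibre N c. nrm N (vdiff x a) < \<epsilon>)"
      by simp
  qed
  from bchoice[OF this] obtain \<delta> where \<delta>: "\<And>a. a \<in> A \<Longrightarrow> \<delta> a > 0"
    "\<And>a c. a \<in> A \<Longrightarrow> c \<in> cn N \<Longrightarrow> crit_disc N c \<noteq> 0 \<Longrightarrow> nrm N (vdiff c c0) < \<delta> a \<Longrightarrow> \<exists>x\<in>crit_fibre N c. nrm N (vdiff x a) < \<epsilon>"
    by blast
  define \<delta>0 where "\<delta>0 = Min (insert 1 (\<delta> ` A))"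
  have d0: "\<delta>0 > 0" "\<And>a. a \<in> A \<Longrightarrow> \<delta>0 \<le> \<delta> a" using \<delta>(1) A(1) by (auto simp: \<delta>0_def)
  obtain c where c: "c \<in> cn N" "crit_disc N c \<noteq> 0" "nrm N (vdiff c c0) < \<delta>0"
  proof -
    obtain x1 where x1: "x1 \<in> cn N" "crit_disc N (himg N (crit_value N) x1) \<noteq> 0" using crit_disc_nonzero_somewhere by blast
    define v where "v = vdiff (himg N (crit_value N) x1) c0"
    have v: "v \<in> cn N" using c0 by (auto simp: v_def)
    obtain md where md: "polyfun N md (crit_disc N)" using polyfun_crit_disc by blast
    obtain q where q: "\<And>t. crit_disc N (ray c0 v t) = poly q t" using polyfun_ray[OF md] by blast
    have "q \<noteq> 0" using q[of 1] x1 by (auto simp: v_def)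
    then have "\<forall>\<^sub>F t in at 0. t \<notin> {t. poly q t = 0}" by (intro eventually_avoids_finite poly_roots_finite)
    moreover have "\<forall>\<^sub>F t in at 0. nrm N (vdiff (ray c0 v t) c0) < \<delta>0"
    proof (rule order_tendstoD[OF _ d0(1)])
      have "((\<lambda>t. c0 i + t * v i) \<longlongrightarrow> c0 i + 0 * v i) (at 0)" for i by (intro tendsto_intros)
      then show "((\<lambda>t. nrm N (vdiff (ray c0 v t) c0)) \<longlongrightarrow> 0) (at 0)"
        unfolding tendsto_nrm_iff by (simp add: ray_def)
    qed
    ultimately have "\<forall>\<^sub>F t in at (0::complex). crit_disc N (ray c0 v t) \<noteq> 0 \<and> nrm N (vdiff (ray c0 v t) c0) < \<delta>0"
      by eventually_elim (auto simp: q)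
    then obtain t where "crit_disc N (ray c0 v t) \<noteq> 0 \<and> nrm N (vdiff (ray c0 v t) c0) < \<delta>0"
      using eventually_happens'[OF at_neq_bot] by blast
    then show ?thesis using that[of "ray c0 v t"] c0 v by blast
  qed
  have "\<forall>a\<in>A. \<exists>x. x \<in> crit_fibre N c \<and> nrm N (vdiff x a) < \<epsilon>"
  proof
    fix a assume a: "a \<in> A"
    have "nrm N (vdiff c c0) < \<delta> a" using c(3) d0(2)[OF a] by linarith
    from \<delta>(2)[OF a c(1,2) this] show "\<exists>x. x \<in> crit_fibre N c \<and> nrm N (vdiff x a) < \<epsilon>" by blast
  qed
  from bchoice[OF this] obtain X where X: "\<And>a. a \<in> A \<Longrightarrow> X a \<in> crit_fibre N c" "\<And>a. a \<in> A \<Longrightarrow> nrm N (vdiff (X a) a) < \<epsilon>" by blast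
  define f where "f = (\<lambda>(a, z). (\<lambda>i. z * X a i))"
  have "inj_on f (A \<times> U)"
  proof (rule inj_onI, clarify)
    fix a z b z' assume az: "a \<in> A" "z \<in> U" "b \<in> A" "z' \<in> U" "f (a, z) = f (b, z')"
    have zz: "z \<noteq> 0" "z' \<noteq> 0" using Un[OF az(2)] Un[OF az(4)] by auto
    have eqi: "z * X a i = z' * X b i" for i using fun_cong[OF az(5), of i] by (simp add: f_def)
    define y where "y = z / z'"
    have y: "y \<in> U" using az zz by (simp add: U_def y_def power_divide)
    have Xb: "X b = (\<lambda>i. y * X a i)" using eqi zz by (auto simp: y_def field_simps)
    have ab: "a = b"
    proof (rule ccontr)
      assume "a \<noteq> b"
      then have "2 * \<epsilon> \<le> nrm N (vdiff (\<lambda>i. y * a i) b)" using epd[of "(y, a, b)"] az y by (simp add: P_def dst_def)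
      also have "\<dots> \<le> nrm N (vdiff (\<lambda>i. y * a i) (X b)) + nrm N (vdiff (X b) b)" by (rule nrm_triangle_diff)
      also have "nrm N (vdiff (\<lambda>i. y * a i) (X b)) = nrm N (vdiff a (X a))"
        unfolding Xb using nrm_scale[of N y "vdiff a (X a)"] Un[OF y] by (simp add: right_diff_distrib)
      also have "\<dots> + nrm N (vdiff (X b) b) < 2 * \<epsilon>"
        using X(2)[OF az(1)] X(2)[OF az(3)] nrm_commute[of N a "X a"] by linarith
      finally show False by simp
    qed
    \<comment> \<open>the rotations of a single point are distinct, as it is not \<open>0\<close>\<close>
    have "X a \<noteq> (\<lambda>_. 0)"
    proof
      assume X0: "X a = (\<lambda>_. 0)"
      have "himg N (crit_value N) (X a) = (\<lambda>_. 0)" unfolding X0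
        by (auto simp: himg_def crit_value_def crit_primitive_0)
      moreover have "himg N (crit_value N) (X a) = c" using X(1)[OF az(1)] by (simp add: crit_fibre_def)
      ultimately have "c = (\<lambda>_. 0)" by simp
      then show False using c(2) N by (auto simp: crit_disc_nonzero_iff)
    qed
    then obtain i where i: "X a i \<noteq> 0" by auto
    have "z = z'" using eqi[of i] i ab by simp
    with ab show "a = b \<and> z = z'" by simp
  qed
  then have "card (A \<times> U) = card (f ` (A \<times> U))" by (simp add: card_image)
  also have "\<dots> \<le> card (crit_fibre N c)"
  proof (rule card_mono[OF card_crit_fibre(1)[OF c(1,2)]], clarify)
    fix a z assume az: "a \<in> A" "z \<in> U"
    have Xa: "X a \<in> cn N" "himg N (crit_value N) (X a) = c" using X(1)[OF az(1)] by (auto simp: crit_fibre_def)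
    have "himg N (crit_value N) (\<lambda>i. z * X a i) = c"
    proof
      fix j
      have "z ^ Suc N = 1" using az(2) by (simp add: U_def)
      then show "himg N (crit_value N) (\<lambda>i. z * X a i) j = c j"
        using fun_cong[OF Xa(2), of j] by (simp only: himg_def crit_value_scale mult_1)
    qed
    then show "f (a, z) \<in> crit_fibre N c" using Xa(1) by (auto simp: crit_fibre_def f_def cn_def)
  qed
  also have "\<dots> = Suc N ^ N" by (rule card_crit_fibre(2)[OF c(1,2)])
  finally show ?thesis by (simp add: card_cartesian_product cU)
qed simp

section \<open>Analytic types of quasi-homogeneous polynomials\<close>

lemma holomorphic2_on_const: "holomorphic2_on (\<lambda>_. c) U"
  unfolding holomorphic2_on_def
proof
  fix z :: "complex \<times> complex"
  have "((\<lambda>_. c) has_derivative (\<lambda>(u, v). 0 * u + 0 * v)) (at z)"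
    by (simp add: case_prod_unfold)
  then show "\<exists>a b. ((\<lambda>_. c) has_derivative (\<lambda>(u, v). a * u + b * v)) (at z)" by blast
qed

lemma holomorphic2_on_fst: "holomorphic2_on fst U"
  unfolding holomorphic2_on_def
proof
  fix z :: "complex \<times> complex"
  have "(fst has_derivative (\<lambda>(u, v). 1 * u + 0 * v)) (at z)"
    by (auto intro!: derivative_eq_intros simp: case_prod_unfold)
  then show "\<exists>a b. (fst has_derivative (\<lambda>(u, v). a * u + b * v)) (at z)" by blast
qed

lemma holomorphic2_on_snd: "holomorphic2_on snd U"
  unfolding holomorphic2_on_def
proof
  fix z :: "complex \<times> complex"
  have "(snd has_derivative (\<lambda>(u, v). 0 * u + 1 * v)) (at z)"
    by (auto intro!: derivative_eq_intros simp: case_prod_unfold)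
  then show "\<exists>a b. (snd has_derivative (\<lambda>(u, v). a * u + b * v)) (at z)" by blast
qed

lemma holomorphic2_on_diff:
  assumes "holomorphic2_on f U" "holomorphic2_on g U"
  shows "holomorphic2_on (\<lambda>z. f z - g z) U"
  unfolding holomorphic2_on_def
proof
  fix z assume z: "z \<in> U"
  obtain a b where f: "(f has_derivative (\<lambda>(u, v). a * u + b * v)) (at z)"
    using assms(1) z by (auto simp: holomorphic2_on_def)
  obtain a' b' where g: "(g has_derivative (\<lambda>(u, v). a' * u + b' * v)) (at z)"
    using assms(2) z by (auto simp: holomorphic2_on_def)
  have "((\<lambda>z. f z - g z) has_derivative (\<lambda>(u, v). (a - a') * u + (b - b') * v)) (at z)"
    using has_derivative_diff[OF f g] by (simp add: case_prod_unfold algebra_simps)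
  then show "\<exists>a b. ((\<lambda>z. f z - g z) has_derivative (\<lambda>(u, v). a * u + b * v)) (at z)" by blast
qed

lemma holomorphic2_on_mult:
  assumes "holomorphic2_on f U" "holomorphic2_on g U"
  shows "holomorphic2_on (\<lambda>z. f z * g z) U"
  unfolding holomorphic2_on_def
proof
  fix z assume z: "z \<in> U"
  obtain a b where f: "(f has_derivative (\<lambda>(u, v). a * u + b * v)) (at z)"
    using assms(1) z by (auto simp: holomorphic2_on_def)
  obtain a' b' where g: "(g has_derivative (\<lambda>(u, v). a' * u + b' * v)) (at z)"
    using assms(2) z by (auto simp: holomorphic2_on_def)
  have "((\<lambda>z. f z * g z) has_derivative
      (\<lambda>(u, v). (f z * a' + a * g z) * u + (f z * b' + b * g z) * v)) (at z)"
    using has_derivative_mult[OF f g] by (simp add: case_prod_unfold algebra_simps)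
  then show "\<exists>a b. ((\<lambda>z. f z * g z) has_derivative (\<lambda>(u, v). a * u + b * v)) (at z)" by blast
qed

lemma holomorphic2_on_power: "holomorphic2_on f U \<Longrightarrow> holomorphic2_on (\<lambda>z. f z ^ k) U"
  by (induction k) (auto intro: holomorphic2_on_const holomorphic2_on_mult)

lemma holomorphic2_on_prod:
  "(\<And>i. i \<in> I \<Longrightarrow> holomorphic2_on (f i) U) \<Longrightarrow> holomorphic2_on (\<lambda>z. \<Prod>i\<in>I. f i z) U"
  by (induction I rule: infinite_finite_induct) (auto intro: holomorphic2_on_const holomorphic2_on_mult)

lemma holomorphic2_on_rescale:
  assumes f: "holomorphic2_on f V" and a: "a \<noteq> 0"
  shows "holomorphic2_on (\<lambda>w. f (fst w / a, snd w)) {w. (fst w / a, snd w) \<in> V}"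
  unfolding holomorphic2_on_def
proof
  fix w assume "w \<in> {w. (fst w / a, snd w) \<in> V}"
  then obtain A B where f: "(f has_derivative (\<lambda>(u, v). A * u + B * v)) (at (fst w / a, snd w))"
    using f by (auto simp: holomorphic2_on_def)
  have "((\<lambda>w. (fst w / a, snd w)) has_derivative (\<lambda>h. (fst h / a, snd h))) (at w)"
    using a by (auto intro!: derivative_eq_intros)
  from has_derivative_compose[OF this f]
  have "((\<lambda>w. f (fst w / a, snd w)) has_derivative (\<lambda>(u, v). (A / a) * u + B * v)) (at w)"
    by (simp add: case_prod_unfold)
  then show "\<exists>A B. ((\<lambda>w. f (fst w / a, snd w)) has_derivative (\<lambda>(u, v). A * u + B * v)) (at w)" by blast
qed

lemma Diff0_id: "(\<lambda>z. z) \<in> Diff0"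
proof -
  have "holomorphic2_map_on (\<lambda>z. z) UNIV"
    by (auto simp: holomorphic2_map_on_def intro: holomorphic2_on_fst holomorphic2_on_snd)
  then show ?thesis unfolding Diff0_def
    by (intro CollectI conjI refl exI[of _ UNIV] exI[of _ "\<lambda>z. z"]) (auto simp: bij_betw_def)
qed

lemma Diff0_rescale:
  assumes Phi: "\<Phi> \<in> Diff0" and a: "a \<noteq> 0"
  shows "(\<lambda>z. (a * fst (\<Phi> z), snd (\<Phi> z))) \<in> Diff0"
proof -
  obtain U V \<Psi> where D: "\<Phi> 0 = 0" "open U" "open V" "0 \<in> U" "bij_betw \<Phi> U V" "\<forall>z\<in>U. \<Psi> (\<Phi> z) = z"
      "holomorphic2_map_on \<Phi> U" "holomorphic2_map_on \<Psi> V"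
    using Phi by (auto simp: Diff0_def)
  define L where "L = (\<lambda>w :: complex \<times> complex. (fst w / a, snd w))"
  define V' where "V' = {w. L w \<in> V}"
  define \<Phi>' where "\<Phi>' = (\<lambda>z. (a * fst (\<Phi> z), snd (\<Phi> z)))"
  define \<Psi>' where "\<Psi>' = (\<lambda>w. \<Psi> (L w))"
  have L\<Phi>: "L (\<Phi>' z) = \<Phi> z" for z using a by (simp add: L_def \<Phi>'_def)
  have "continuous_on UNIV L" unfolding L_def by (intro continuous_intros) (use a in auto)
  then have "open V'" using open_vimage[OF D(3)] by (simp add: V'_def vimage_def)
  moreover have "bij_betw \<Phi>' U V'"
  proof (rule bij_betw_imageI)
    show "inj_on \<Phi>' U"
      using D(5) L\<Phi> by (metis (no_types, lifting) bij_betw_def inj_on_def)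
    show "\<Phi>' ` U = V'"
    proof (intro equalityI subsetI)
      fix w assume "w \<in> V'"
      then obtain z where z: "z \<in> U" "\<Phi> z = L w" using D(5) by (auto simp: V'_def bij_betw_def image_iff)
      then have "\<Phi>' z = w" using a by (simp add: \<Phi>'_def L_def prod_eq_iff)
      then show "w \<in> \<Phi>' ` U" using z by blast
    qed (use D(5) L\<Phi> in \<open>auto simp: V'_def bij_betw_def\<close>)
  qed
  moreover have "holomorphic2_map_on \<Phi>' U"
    using D(7) unfolding holomorphic2_map_on_def \<Phi>'_def
    by (auto intro: holomorphic2_on_mult holomorphic2_on_const)
  moreover have "holomorphic2_map_on \<Psi>' V'"
    using D(8) a unfolding holomorphic2_map_on_def \<Psi>'_def V'_def L_def
    by (auto intro: holomorphic2_on_rescale[of "\<lambda>z. fst (\<Psi> z)"] holomorphic2_on_rescale[of "\<lambda>z. snd (\<Psi> z)"])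
  moreover have "\<forall>z\<in>U. \<Psi>' (\<Phi>' z) = z" using D(6) L\<Phi> by (simp add: \<Psi>'_def)
  moreover have "\<Phi>' 0 = 0" using D(1) by (simp add: \<Phi>'_def zero_prod_def)
  ultimately show ?thesis unfolding \<Phi>'_def[symmetric] using D(2,4)
    unfolding Diff0_def by blast
qed

lemma qh_poly_in_function_germs:
  assumes "\<Lambda> \<in> root_sets n" "n > 0" "p > 0" "q > 0"
  shows "qh_poly p q \<Lambda> \<in> function_germs"
proof -
  have eq: "qh_poly p q \<Lambda> = (\<lambda>z. \<Prod>l\<in>\<Lambda>. snd z ^ p - l * fst z ^ q)"
    by (auto simp: qh_poly_def)
  have "holomorphic2_on (qh_poly p q \<Lambda>) UNIV" unfolding eq
    by (intro holomorphic2_on_prod holomorphic2_on_diff holomorphic2_on_mult holomorphic2_on_power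
        holomorphic2_on_const holomorphic2_on_fst holomorphic2_on_snd)
  moreover have "qh_poly p q \<Lambda> 0 = 0"
  proof -
    obtain l where "l \<in> \<Lambda>" "finite \<Lambda>" using assms(1,2) by (auto simp: root_sets_def dest: card_gt_0_iff[THEN iffD1])
    then show ?thesis using assms by (auto simp: eq power_0_left intro!: prod_zero bexI[of _ l])
  qed
  ultimately show ?thesis unfolding function_germs_def by blast
qed

text \<open>
  Rescaling the first coordinate realizes rotations of the set of roots.
\<close>

lemma qh_poly_rescale:
  assumes a: "a ^ q = \<zeta>" and z: "\<zeta> \<noteq> 0"
  shows "qh_poly p q ((\<lambda>l. \<zeta> * l) ` \<Lambda>) (x, y) = qh_poly p q \<Lambda> (a * x, y)"
proof -
  have "inj_on (\<lambda>l. \<zeta> * l) \<Lambda>" using z by (auto simp: inj_on_def)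
  then show ?thesis
    by (simp add: qh_poly_def prod.reindex power_mult_distrib a mult_ac)
qed

lemma analytic_type_rescale_subset:
  assumes f: "f \<in> function_germs" and f': "f' \<in> function_germs" and a: "a \<noteq> 0"
    and eq: "\<And>x y. f' (x, y) = f (a * x, y)"
  shows "analytic_type f' \<subseteq> analytic_type f"
proof
  fix g assume "g \<in> analytic_type f'"
  then obtain \<Phi> where g: "g \<in> function_germs" "\<Phi> \<in> Diff0" "\<forall>\<^sub>F z in nhds 0. g z = f' (\<Phi> z)"
    by (auto simp: analytic_type_def analytic_equivalence_def)
  have "f' (\<Phi> z) = f (a * fst (\<Phi> z), snd (\<Phi> z))" for z
    using eq[of "fst (\<Phi> z)" "snd (\<Phi> z)"] by simp
  then have "\<forall>\<^sub>F z in nhds 0. g z = f (a * fst (\<Phi> z), snd (\<Phi> z))" using g(3) by simp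
  then show "g \<in> analytic_type f" using g(1) f Diff0_rescale[OF g(2) a]
    by (auto simp: analytic_type_def analytic_equivalence_def)
qed

lemma analytic_type_rotation:
  assumes L: "\<Lambda> \<in> root_sets n" and n: "n > 0" "p > 0" "q > 0" and z: "\<zeta> \<noteq> 0"
  shows "analytic_type (qh_poly p q ((\<lambda>l. \<zeta> * l) ` \<Lambda>)) = analytic_type (qh_poly p q \<Lambda>)"
proof -
  obtain a where a: "a ^ q = \<zeta>" using exists_complex_root[of q \<zeta>] n by auto
  have a0: "a \<noteq> 0" using a z n by auto
  have "inj_on (\<lambda>l. \<zeta> * l) \<Lambda>" using z by (auto simp: inj_on_def)
  then have L': "(\<lambda>l. \<zeta> * l) ` \<Lambda> \<in> root_sets n" using L z by (auto simp: root_sets_def card_image)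
  note germs = qh_poly_in_function_germs[OF L n] qh_poly_in_function_germs[OF L' n]
  show ?thesis
  proof
    show "analytic_type (qh_poly p q ((\<lambda>l. \<zeta> * l) ` \<Lambda>)) \<subseteq> analytic_type (qh_poly p q \<Lambda>)"
      by (rule analytic_type_rescale_subset[OF germs a0]) (rule qh_poly_rescale[OF a z])
    have "qh_poly p q \<Lambda> (x, y) = qh_poly p q ((\<lambda>l. \<zeta> * l) ` \<Lambda>) (1 / a * x, y)" for x y
      using a0 by (simp add: qh_poly_rescale[OF a z])
    then show "analytic_type (qh_poly p q \<Lambda>) \<subseteq> analytic_type (qh_poly p q ((\<lambda>l. \<zeta> * l) ` \<Lambda>))"
      using analytic_type_rescale_subset[OF germs(2,1), of "1 / a"] a0 by simp
  qed
qed

lemma holomorphic2_on_continuous_on: "holomorphic2_on F U \<Longrightarrow> continuous_on U F"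
  unfolding holomorphic2_on_def
  by (meson continuous_at_imp_continuous_on has_derivative_continuous)

lemma holomorphic2_section_derivative:
  assumes "(F has_derivative (\<lambda>(u, v). a * u + b * v)) (at (x, y))"
  shows "((\<lambda>y. F (x, y)) has_field_derivative b) (at y)"
    and "((\<lambda>x. F (x, y)) has_field_derivative a) (at x)"
proof -
  have "((\<lambda>y. (x, y)) has_derivative (\<lambda>v. (0, v))) (at y)"
    by (auto intro!: derivative_eq_intros)
  from has_derivative_compose[OF this assms]
  show "((\<lambda>y. F (x, y)) has_field_derivative b) (at y)" by (simp add: has_field_derivative_def)
  have "((\<lambda>x. (x, y)) has_derivative (\<lambda>u. (u, 0))) (at x)"
    by (auto intro!: derivative_eq_intros)
  from has_derivative_compose[OF this assms]
  show "((\<lambda>x. F (x, y)) has_field_derivative a) (at x)" by (simp add: has_field_derivative_def)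
qed

text \<open>
  The error is measured by \<open>\<bar>y\<bar>\<close> alone, which matters along curves where \<open>y\<close> is much smaller than \<open>x\<close>.
  For small \<open>x\<close> the function \<open>F (x, y) - F (0, y)\<close> of \<open>y\<close> is uniformly small on a fixed disc, and the
  Schwarz lemma bounds its increments by a small multiple of \<open>\<bar>y\<bar>\<close>.
\<close>

lemma uniform_partial_derivative:
  assumes U: "open U" "(0, 0) \<in> U" and F: "holomorphic2_on F U"
    and der: "(F has_derivative (\<lambda>(u, v). c * u + e * v)) (at (0, 0))" and ep: "\<epsilon> > 0"
  shows "\<exists>\<delta>>0. \<forall>x y. cmod x < \<delta> \<longrightarrow> cmod y < \<delta> \<longrightarrow> cmod (F (x, y) - F (x, 0) - e * y) \<le> \<epsilon> * cmod y"
proof -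
  obtain r0 where r0: "r0 > 0" "ball (0, 0) r0 \<subseteq> U" using U openE by blast
  define r where "r = r0 / 3"
  have r: "r > 0" using r0 by (simp add: r_def)
  have inU: "(x, y) \<in> U" if "cmod x \<le> r" "cmod y \<le> r" for x y
  proof -
    have "norm (x, y) \<le> cmod x + cmod y" by (rule norm_Pair_le)
    also have "\<dots> < r0" using that r0 by (simp add: r_def)
    finally show ?thesis using r0(2) by (force simp: zero_prod_def[symmetric])
  qed
  define K where "K = cball (0::complex) r \<times> cball (0::complex) r"
  have "compact K" unfolding K_def by (intro compact_Times compact_cball)
  moreover have "continuous_on K F"
    by (rule continuous_on_subset[OF holomorphic2_on_continuous_on[OF F]]) (use inU in \<open>auto simp: K_def\<close>)
  ultimately have uc: "uniformly_continuous_on K F" by (intro compact_uniformly_continuous)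
  define \<eta> where "\<eta> = \<epsilon> * r / 4"
  have eta: "\<eta> > 0" using ep r by (simp add: \<eta>_def)
  obtain d1 where d1: "d1 > 0" "\<And>z w. z \<in> K \<Longrightarrow> w \<in> K \<Longrightarrow> dist w z < d1 \<Longrightarrow> dist (F w) (F z) < \<eta>"
    using uc eta unfolding uniformly_continuous_on_def by blast
  have "((\<lambda>y. F (0, y)) has_field_derivative e) (at 0)" by (rule holomorphic2_section_derivative(1)[OF der])
  then have "(\<lambda>y. (F (0, y) - F (0, 0)) / y) \<midarrow>0\<rightarrow> e" by (simp add: has_field_derivative_iff)
  then obtain d2 where d2: "d2 > 0" "\<And>y. y \<noteq> 0 \<Longrightarrow> cmod y < d2 \<Longrightarrow> cmod ((F (0, y) - F (0, 0)) / y - e) < \<epsilon> / 2"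
    using LIM_D[of "\<lambda>y. (F (0, y) - F (0, 0)) / y" e 0 "\<epsilon> / 2"] ep by auto
  define \<delta> where "\<delta> = min (min d1 d2) r"
  have "cmod (F (x, y) - F (x, 0) - e * y) \<le> \<epsilon> * cmod y" if xy: "cmod x < \<delta>" "cmod y < \<delta>" for x y
  proof -
    define g where "g = (\<lambda>y. F (x, y) - F (0, y))"
    have gb: "cmod (g w) < \<eta>" if "cmod w \<le> r" for w
    proof -
      have "dist (x, w) (0, w) < d1" using xy by (simp add: dist_Pair_Pair \<delta>_def)
      then show ?thesis using d1(2)[of "(0, w)" "(x, w)"] that xy r by (auto simp: K_def g_def dist_norm \<delta>_def)
    qed
    define G where "G = (\<lambda>z. (g (of_real r * z) - g 0) / of_real (2 * \<eta>))"
    have ghol: "g holomorphic_on ball 0 r"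
    proof (rule holomorphic_onI)
      fix w assume "w \<in> ball (0::complex) r"
      then have "(x, w) \<in> U" "(0, w) \<in> U" using inU xy r by (auto simp: \<delta>_def)
      then obtain a b a' b' where "(F has_derivative (\<lambda>(u, v). a * u + b * v)) (at (x, w))"
          "(F has_derivative (\<lambda>(u, v). a' * u + b' * v)) (at (0, w))"
        using F unfolding holomorphic2_on_def by metis
      then have "(g has_field_derivative (b - b')) (at w)"
        unfolding g_def by (intro DERIV_diff holomorphic2_section_derivative(1))
      then show "g field_differentiable at w within ball 0 r"
        using field_differentiable_at_within field_differentiable_def by blast
    qed
    have gle: "cmod (g y - g 0) \<le> \<epsilon> / 2 * cmod y"
    proof -
      have "cmod (G (y / of_real r)) \<le> cmod (y / of_real r)"
      proof (rule Schwarz_Lemma(1))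
        have "(g \<circ> (\<lambda>z. of_real r * z)) holomorphic_on ball 0 1"
          by (rule holomorphic_on_compose_gen[OF _ ghol])
             (use r in \<open>auto intro!: holomorphic_intros simp: norm_mult\<close>)
        then have "(\<lambda>z. g (of_real r * z)) holomorphic_on ball 0 1" by (simp add: o_def)
        then show "G holomorphic_on ball 0 1" unfolding G_def
          by (intro holomorphic_intros) (use eta in auto)
        show "G 0 = 0" by (simp add: G_def)
        show "cmod (y / of_real r) < 1" using xy r by (simp add: norm_divide \<delta>_def)
        fix z :: complex assume z: "cmod z < 1"
        have "cmod (of_real r * z) \<le> r" using z r by (simp add: norm_mult mult_left_le)
        then have "cmod (g (of_real r * z) - g 0) < 2 * \<eta>"
          using gb[of "of_real r * z"] gb[of 0] norm_triangle_ineq4[of "g (of_real r * z)" "g 0"] r by simp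
        then show "cmod (G z) < 1" using eta by (simp add: G_def norm_divide)
      qed
      then have "cmod (g y - g 0) / (2 * \<eta>) \<le> cmod y / r"
        using r eta by (simp add: G_def norm_divide)
      then have "cmod (g y - g 0) \<le> cmod y / r * (2 * \<eta>)" using eta by (simp add: pos_divide_le_eq)
      also have "\<dots> = \<epsilon> / 2 * cmod y" using r by (simp add: \<eta>_def)
      finally show ?thesis .
    qed
    have "cmod (F (0, y) - F (0, 0) - e * y) \<le> \<epsilon> / 2 * cmod y"
    proof (cases "y = 0")
      case False
      have "F (0, y) - F (0, 0) - e * y = ((F (0, y) - F (0, 0)) / y - e) * y" using False by (simp add: field_simps)
      then have "cmod (F (0, y) - F (0, 0) - e * y) = cmod ((F (0, y) - F (0, 0)) / y - e) * cmod y"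
        by (simp add: norm_mult)
      also have "\<dots> \<le> \<epsilon> / 2 * cmod y"
        using d2(2)[OF False] xy by (intro mult_right_mono) (auto simp: \<delta>_def)
      finally show ?thesis .
    qed simp
    moreover have split: "F (x, y) - F (x, 0) - e * y = (g y - g 0) + (F (0, y) - F (0, 0) - e * y)"
      by (simp add: g_def)
    ultimately show ?thesis
      using gle norm_triangle_ineq[of "g y - g 0" "F (0, y) - F (0, 0) - e * y"] unfolding split by linarith
  qed
  moreover have "\<delta> > 0" using d1 d2 r by (simp add: \<delta>_def)
  ultimately show ?thesis by blast
qed

text \<open>
  The linear part of a biholomorphism is invertible. This is used in the triangular case \<open>c = 0\<close>, where it
  says that the diagonal entries do not vanish.
\<close>

lemma Diff0_derivative:
  assumes "\<Phi> \<in> Diff0"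
  obtains U a b c e where "open U" "0 \<in> U" "\<Phi> 0 = 0"
    "holomorphic2_on (\<lambda>z. snd (\<Phi> z)) U"
    "((\<lambda>z. fst (\<Phi> z)) has_derivative (\<lambda>(u, v). a * u + b * v)) (at 0)"
    "((\<lambda>z. snd (\<Phi> z)) has_derivative (\<lambda>(u, v). c * u + e * v)) (at 0)"
    "c = 0 \<Longrightarrow> a \<noteq> 0 \<and> e \<noteq> 0"
proof -
  obtain U V \<Psi> where D: "\<Phi> 0 = 0" "open U" "open V" "0 \<in> U" "bij_betw \<Phi> U V" "\<forall>z\<in>U. \<Psi> (\<Phi> z) = z"
      "holomorphic2_map_on \<Phi> U" "holomorphic2_map_on \<Psi> V"
    using assms by (auto simp: Diff0_def)
  have V0: "0 \<in> V" using bij_betwE[OF D(5)] D(1,4) by metis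
  obtain a b where f1: "((\<lambda>z. fst (\<Phi> z)) has_derivative (\<lambda>(u, v). a * u + b * v)) (at 0)"
    using D(4,7) by (auto simp: holomorphic2_map_on_def holomorphic2_on_def)
  obtain c e where f2: "((\<lambda>z. snd (\<Phi> z)) has_derivative (\<lambda>(u, v). c * u + e * v)) (at 0)"
    using D(4,7) by (auto simp: holomorphic2_map_on_def holomorphic2_on_def)
  obtain A B where g1: "((\<lambda>z. fst (\<Psi> z)) has_derivative (\<lambda>(u, v). A * u + B * v)) (at (\<Phi> 0))"
    using V0 D(1,8) by (auto simp: holomorphic2_map_on_def holomorphic2_on_def)
  obtain C E where g2: "((\<lambda>z. snd (\<Psi> z)) has_derivative (\<lambda>(u, v). C * u + E * v)) (at (\<Phi> 0))"
    using V0 D(1,8) by (auto simp: holomorphic2_map_on_def holomorphic2_on_def)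
  have f: "(\<Phi> has_derivative (\<lambda>(u, v). (a * u + b * v, c * u + e * v))) (at 0)"
    using has_derivative_Pair[OF f1 f2] by (simp add: case_prod_unfold)
  have "((\<lambda>z. fst (\<Psi> (\<Phi> z))) has_derivative (\<lambda>(u, v). A * (a * u + b * v) + B * (c * u + e * v))) (at 0)"
    using has_derivative_compose[OF f g1] by (simp add: case_prod_unfold)
  then have "(fst has_derivative (\<lambda>(u, v). A * (a * u + b * v) + B * (c * u + e * v))) (at 0)"
    by (rule has_derivative_transform_within_open[OF _ D(2,4)]) (use D(6) in auto)
  from has_derivative_unique[OF this bounded_linear.has_derivative[OF bounded_linear_fst has_derivative_ident]]
  have 1: "A * (a * u + b * v) + B * (c * u + e * v) = u" for u v by (auto simp: fun_eq_iff)
  have "((\<lambda>z. snd (\<Psi> (\<Phi> z))) has_derivative (\<lambda>(u, v). C * (a * u + b * v) + E * (c * u + e * v))) (at 0)"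
    using has_derivative_compose[OF f g2] by (simp add: case_prod_unfold)
  then have "(snd has_derivative (\<lambda>(u, v). C * (a * u + b * v) + E * (c * u + e * v))) (at 0)"
    by (rule has_derivative_transform_within_open[OF _ D(2,4)]) (use D(6) in auto)
  from has_derivative_unique[OF this bounded_linear.has_derivative[OF bounded_linear_snd has_derivative_ident]]
  have 2: "C * (a * u + b * v) + E * (c * u + e * v) = v" for u v by (auto simp: fun_eq_iff)
  have "a \<noteq> 0 \<and> e \<noteq> 0" if c: "c = 0"
  proof -
    have "A * a = 1" using 1[of 1 0] c by simp
    then have a: "a \<noteq> 0" by auto
    then have "C = 0" using 2[of 1 0] c by simp
    then have "E * e = 1" using 2[of 0 1] by simp
    then show ?thesis using a by auto
  qed
  with that[OF D(2,4,1) _ f1 f2] D(7) show ?thesis by (simp add: holomorphic2_map_on_def)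
qed

text \<open>
  Unless \<open>h\<close> vanishes near \<open>0\<close>, the order at \<open>0\<close> of \<open>h (s ^ p)\<close> is \<open>p m\<close>, where \<open>m\<close> is the order of \<open>h\<close>. It is at least \<open>q\<close> by the bound,
  and different from \<open>q\<close> because \<open>p > 1\<close> is coprime to \<open>q\<close>; so it is greater than \<open>q\<close>. As \<open>q > p\<close>, this
  also gives \<open>m > 1\<close>.
\<close>

lemma power_order_gap:
  assumes h: "h holomorphic_on ball 0 r" "r > 0" "h 0 = (0::complex)"
    and pq: "1 < p" "p < q" "coprime p q"
    and bd: "\<forall>\<^sub>F s in at 0. cmod (h (s ^ p) / s ^ q) \<le> B"
  shows "((\<lambda>s. h (s ^ p) / s ^ q) \<longlongrightarrow> 0) (at 0)" "((\<lambda>x. h x / x) \<longlongrightarrow> 0) (at 0)"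
proof -
  have sp: "((\<lambda>s::complex. s ^ p) \<longlongrightarrow> 0) (at 0)"
  proof -
    have "((\<lambda>s::complex. s ^ p) \<longlongrightarrow> 0 ^ p) (at 0)" by (intro tendsto_intros)
    then show ?thesis using pq by (simp add: power_0_left)
  qed
  have "((\<lambda>s. h (s ^ p) / s ^ q) \<longlongrightarrow> 0) (at 0) \<and> ((\<lambda>x. h x / x) \<longlongrightarrow> 0) (at 0)"
  proof (cases "h constant_on ball 0 r")
    case True
    then have h0: "h x = 0" if "x \<in> ball 0 r" for x
      using h that unfolding constant_on_def by (metis centre_in_ball)
    have "\<forall>\<^sub>F s::complex in at 0. s ^ p \<in> ball 0 r"
      by (rule topological_tendstoD[OF sp]) (use h in auto)
    then have "\<forall>\<^sub>F s in at 0. h (s ^ p) / s ^ q = 0" by eventually_elim (simp add: h0)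
    moreover have "\<forall>\<^sub>F x::complex in at 0. x \<in> ball 0 r" by (rule eventually_at_in_open') (use h in auto)
    then have "\<forall>\<^sub>F x in at 0. h x / x = 0" by eventually_elim (simp add: h0)
    ultimately show ?thesis by (auto intro: tendsto_eventually)
  next
    case False
    have zin: "0 \<in> ball (0::complex) r" using h(2) by simp
    \<comment> \<open>\<open>h x = x\<^sup>m k x\<close> with \<open>k 0 \<noteq> 0\<close>\<close>
    obtain k \<delta> m where k: "0 < m" "0 < \<delta>" "ball (0::complex) \<delta> \<subseteq> ball 0 r" "k holomorphic_on ball 0 \<delta>"
        "\<And>w. w \<in> ball 0 \<delta> \<Longrightarrow> h w = (w - 0) ^ m * k w" "\<And>w. w \<in> ball 0 \<delta> \<Longrightarrow> k w \<noteq> 0"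
      by (rule holomorphic_factor_zero_nonconstant[OF h(1) open_ball connected_ball zin h(3) False]) (rule that)
    have k0: "k 0 \<noteq> 0" using k(2,6) by simp
    have "continuous (at 0) k"
      using k(2,4) by (intro continuous_on_interior[of "ball 0 \<delta>"] holomorphic_on_imp_continuous_on) auto
    then have klim: "(k \<longlongrightarrow> k 0) (at 0)" by (simp add: continuous_at)
    have sp': "filterlim (\<lambda>s::complex. s ^ p) (at 0) (at 0)"
      by (rule filterlim_atI[OF sp], rule eventually_mono[OF eventually_neq_at_within[of 0]]) simp
    have kslim: "((\<lambda>s. k (s ^ p)) \<longlongrightarrow> k 0) (at 0)" by (rule filterlim_compose[OF klim sp'])
    have ev: "\<forall>\<^sub>F s in at 0. s \<noteq> 0 \<and> h (s ^ p) = s ^ (p * m) * k (s ^ p)"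
    proof -
      have "\<forall>\<^sub>F s::complex in at 0. s ^ p \<in> ball 0 \<delta>"
        by (rule topological_tendstoD[OF sp]) (use k(2) in auto)
      moreover have "\<forall>\<^sub>F s::complex in at 0. s \<noteq> 0" by (rule eventually_neq_at_within)
      ultimately show ?thesis by eventually_elim (simp add: k(5) power_mult)
    qed
    have gt: "q < p * m"
    proof (rule ccontr)
      assume "\<not> q < p * m"
      moreover have "p * m \<noteq> q" using pq by (metis coprime_mult_self_left_iff coprime_commute dvd_triv_left coprime_absorb_left nat_dvd_1_iff_1 less_irrefl)
      ultimately have lt: "p * m < q" by simp
      have "((\<lambda>s. B * cmod s ^ (q - p * m)) \<longlongrightarrow> B * cmod 0 ^ (q - p * m)) (at 0)"
        by (intro tendsto_intros)
      then have "((\<lambda>s::complex. B * cmod s ^ (q - p * m)) \<longlongrightarrow> 0) (at 0)" using lt by (simp add: power_0_left)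
      moreover have "\<forall>\<^sub>F s in at 0. cmod (k (s ^ p)) \<le> B * cmod s ^ (q - p * m)"
        using ev bd
      proof eventually_elim
        case (elim s)
        have q: "q = p * m + (q - p * m)" using lt by simp
        have "k (s ^ p) = (h (s ^ p) / s ^ q) * s ^ (q - p * m)"
          using elim by (subst q) (simp add: power_add)
        then have "cmod (k (s ^ p)) = cmod (h (s ^ p) / s ^ q) * cmod s ^ (q - p * m)"
          by (simp only: norm_mult norm_power)
        also have "\<dots> \<le> B * cmod s ^ (q - p * m)" using elim by (intro mult_right_mono) auto
        finally show ?case .
      qed
      ultimately have "((\<lambda>s. k (s ^ p)) \<longlongrightarrow> 0) (at 0)" by (rule Lim_null_comparison[rotated])
      then show False using kslim k0 tendsto_unique[OF trivial_limit_at] by blast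
    qed
    have "((\<lambda>s. s ^ (p * m - q) * k (s ^ p)) \<longlongrightarrow> 0 ^ (p * m - q) * k 0) (at 0)"
      by (intro tendsto_intros kslim)
    then have "((\<lambda>s. s ^ (p * m - q) * k (s ^ p)) \<longlongrightarrow> 0) (at 0)" using gt by (simp add: power_0_left)
    moreover have "\<forall>\<^sub>F s in at 0. s ^ (p * m - q) * k (s ^ p) = h (s ^ p) / s ^ q"
      using ev
    proof eventually_elim
      case (elim s)
      have "s ^ (p * m) = s ^ q * s ^ (p * m - q)" using gt by (simp add: power_add[symmetric])
      then show ?case using elim by simp
    qed
    ultimately have 1: "((\<lambda>s. h (s ^ p) / s ^ q) \<longlongrightarrow> 0) (at 0)" by (rule Lim_transform_eventually)
    have m: "m > 1"
    proof (rule ccontr)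
      assume "\<not> m > 1"
      then have "p * m \<le> p * 1" by (intro mult_left_mono) auto
      then show False using gt pq by linarith
    qed
    have "((\<lambda>x. x ^ (m - 1) * k x) \<longlongrightarrow> 0 ^ (m - 1) * k 0) (at 0)" by (intro tendsto_intros klim)
    then have "((\<lambda>x. x ^ (m - 1) * k x) \<longlongrightarrow> 0) (at 0)" using m by (simp add: power_0_left)
    moreover have "\<forall>\<^sub>F x in at 0. x ^ (m - 1) * k x = h x / x"
    proof -
      have "\<forall>\<^sub>F x::complex in at 0. x \<in> ball 0 \<delta>" by (rule eventually_at_in_open') (use k(2) in auto)
      moreover have "\<forall>\<^sub>F s::complex in at 0. s \<noteq> 0" by (rule eventually_neq_at_within)
      ultimately show ?thesis
      proof eventually_elim
        case (elim x)
        have "x ^ m = x * x ^ (m - 1)" using m by (cases m) auto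
        then show ?case using elim by (simp add: k(5))
      qed
    qed
    ultimately have "((\<lambda>x. h x / x) \<longlongrightarrow> 0) (at 0)" by (rule Lim_transform_eventually)
    with 1 show ?thesis by blast
  qed
  then show "((\<lambda>s. h (s ^ p) / s ^ q) \<longlongrightarrow> 0) (at 0)" "((\<lambda>x. h x / x) \<longlongrightarrow> 0) (at 0)" by auto
qed

text \<open>
  For a root \<open>l = \<alpha>\<^sup>p\<close> in \<open>\<Lambda>'\<close> the function of \<open>\<Lambda>'\<close> vanishes along the curve \<open>(s\<^sup>p, \<alpha> s\<^sup>q)\<close>, so the
  function of \<open>\<Lambda>\<close> vanishes along the image of this curve under \<open>\<Phi>\<close>. The first coordinate of the image is
  \<open>a s\<^sup>p\<close> to leading order. The second coordinate is \<open>h (s ^ p) + e \<alpha> s\<^sup>q\<close> up to an error of smaller order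
  than \<open>s\<^sup>q\<close>, where \<open>h\<close> is its restriction to the first axis. Vanishing on the image bounds the second
  coordinate by a multiple of \<open>s\<^sup>q\<close>, so \<open>power_order_gap\<close> makes the contribution of \<open>h\<close> negligible. In the
  limit, \<open>(e \<alpha>)\<^sup>p = m a\<^sup>q\<close> for a root \<open>m\<close> in \<open>\<Lambda>\<close>, that is, \<open>m = (e\<^sup>p / a\<^sup>q) l\<close>; the factor does not depend
  on \<open>l\<close>.
\<close>

lemma Diff0_multiplier:
  assumes Phi: "\<Phi> \<in> Diff0" and pq: "1 < p" "p < q" "coprime p q"
    and L: "\<Lambda> \<in> root_sets n" and L': "\<Lambda>' \<in> root_sets n" and n: "n > 0"
    and ev: "\<forall>\<^sub>F z in nhds 0. qh_poly p q \<Lambda>' z = qh_poly p q \<Lambda> (\<Phi> z)"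
  shows "\<exists>\<mu>. \<mu> \<noteq> 0 \<and> (\<forall>l\<in>\<Lambda>'. \<mu> * l \<in> \<Lambda>)"
proof -
  obtain U a b c e where U: "open U" "0 \<in> U" "\<Phi> 0 = 0" and hol: "holomorphic2_on (\<lambda>z. snd (\<Phi> z)) U"
    and d1: "((\<lambda>z. fst (\<Phi> z)) has_derivative (\<lambda>(u, v). a * u + b * v)) (at 0)"
    and d2: "((\<lambda>z. snd (\<Phi> z)) has_derivative (\<lambda>(u, v). c * u + e * v)) (at 0)"
    and ae: "c = 0 \<Longrightarrow> a \<noteq> 0 \<and> e \<noteq> 0"
    by (rule Diff0_derivative[OF Phi]) (rule that)
  define F where "F = (\<lambda>z. snd (\<Phi> z))"
  define f where "f = (\<lambda>z. fst (\<Phi> z))"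
  define h where "h = (\<lambda>x. F (x, 0))"
  have finL: "finite \<Lambda>" "card \<Lambda> = n" using L by (auto simp: root_sets_def)
  have dF: "(F has_derivative (\<lambda>(u, v). c * u + e * v)) (at (0, 0))" using d2 by (simp add: F_def zero_prod_def)
  obtain r0 where r0: "r0 > 0" "ball 0 r0 \<subseteq> U" using U openE by blast
  have hhol: "h holomorphic_on ball 0 r0"
  proof (rule holomorphic_onI)
    fix x :: complex assume x: "x \<in> ball 0 r0"
    have "(x, 0) \<in> ball (0 :: complex \<times> complex) r0"
      using x by (simp add: zero_prod_def dist_Pair_Pair dist_norm)
    then have "(x, 0) \<in> U" using r0 by blast
    then obtain A B where "(F has_derivative (\<lambda>(u, v). A * u + B * v)) (at (x, 0))"
      using hol by (auto simp: holomorphic2_on_def F_def)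
    from holomorphic2_section_derivative(2)[OF this]
    show "h field_differentiable at x within ball 0 r0"
      unfolding h_def using field_differentiable_at_within field_differentiable_def by blast
  qed
  have h0: "h 0 = 0" using U(3) by (simp add: h_def F_def zero_prod_def)
  have hc: "((\<lambda>x. h x / x) \<longlongrightarrow> c) (at 0)"
    using holomorphic2_section_derivative(2)[OF dF] h0 by (simp add: has_field_derivative_iff h_def)
  have core: "c = 0 \<and> (\<exists>m\<in>\<Lambda>. e ^ p * l = m * a ^ q)" if l: "l \<in> \<Lambda>'" for l
  proof -
    obtain \<alpha> where al: "\<alpha> ^ p = l" using exists_complex_root[of p l] pq by auto
    define w where "w = (\<lambda>s::complex. (s ^ p, \<alpha> * s ^ q))"
    have w0: "(w \<longlongrightarrow> 0) (at 0)"
    proof -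
      have "(w \<longlongrightarrow> (0 ^ p, \<alpha> * 0 ^ q)) (at 0)" unfolding w_def by (intro tendsto_intros)
      then show ?thesis using pq by (simp add: power_0_left zero_prod_def)
    qed
    have neq: "\<forall>\<^sub>F s::complex in at 0. s \<noteq> 0" by (rule eventually_neq_at_within)
    have w1: "filterlim w (at 0) (at 0)"
      by (rule filterlim_atI[OF w0], rule eventually_mono[OF neq]) (simp add: w_def zero_prod_def)
    have q_split: "(s::complex) ^ q = s ^ p * s ^ (q - p)" for s
      using pq by (simp add: power_add[symmetric])
    \<comment> \<open>along the curve the first coordinate of \<open>\<Phi>\<close> is \<open>a s\<^sup>p\<close> to first order\<close>
    have lim1: "((\<lambda>s. f (w s) / s ^ p) \<longlongrightarrow> a) (at 0)"
    proof -
      define E where "E = (\<lambda>z. f z - (a * fst z + b * snd z))"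
      have "((\<lambda>z. norm (E z) / norm z) \<longlongrightarrow> 0) (at 0)"
        using d1 U(3) by (simp add: has_derivative_at E_def f_def case_prod_unfold)
      from filterlim_compose[OF this w1]
      have "((\<lambda>s. norm (E (w s)) / norm (w s)) \<longlongrightarrow> 0) (at 0)" .
      moreover have "((\<lambda>s. 1 + cmod \<alpha> * cmod s ^ (q - p)) \<longlongrightarrow> 1 + cmod \<alpha> * cmod 0 ^ (q - p)) (at 0)"
        by (intro tendsto_intros)
      ultimately have lim: "((\<lambda>s. norm (E (w s)) / norm (w s) * (1 + cmod \<alpha> * cmod s ^ (q - p))) \<longlongrightarrow> 0) (at 0)"
        using tendsto_mult by fastforce
      have "((\<lambda>s. E (w s) / s ^ p) \<longlongrightarrow> 0) (at 0)"
      proof (rule Lim_null_comparison[OF _ lim], rule eventually_mono[OF neq])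
        fix s :: complex assume s: "s \<noteq> 0"
        have "norm (w s) \<le> cmod (s ^ p) + cmod (\<alpha> * s ^ q)" unfolding w_def by (rule norm_Pair_le)
        also have "\<dots> = cmod s ^ p * (1 + cmod \<alpha> * cmod s ^ (q - p))"
          by (simp add: q_split norm_mult norm_power algebra_simps)
        finally have le: "norm (w s) \<le> cmod s ^ p * (1 + cmod \<alpha> * cmod s ^ (q - p))" .
        have wpos: "norm (w s) > 0" using s by (simp add: w_def zero_prod_def)
        have "cmod (E (w s) / s ^ p) = norm (E (w s)) / norm (w s) * (norm (w s) / cmod s ^ p)"
          using wpos by (simp add: norm_divide norm_power)
        also have "\<dots> \<le> norm (E (w s)) / norm (w s) * (1 + cmod \<alpha> * cmod s ^ (q - p))"
          using le s by (intro mult_left_mono) (auto simp: divide_le_eq mult.commute)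
        finally show "cmod (E (w s) / s ^ p) \<le> norm (E (w s)) / norm (w s) * (1 + cmod \<alpha> * cmod s ^ (q - p))" .
      qed
      moreover have "((\<lambda>s. a + b * \<alpha> * s ^ (q - p)) \<longlongrightarrow> a + b * \<alpha> * 0 ^ (q - p)) (at 0)" by (intro tendsto_intros)
      ultimately have "((\<lambda>s. E (w s) / s ^ p + (a + b * \<alpha> * s ^ (q - p))) \<longlongrightarrow> 0 + (a + b * \<alpha> * 0 ^ (q - p))) (at 0)"
        by (rule tendsto_add)
      then have "((\<lambda>s. E (w s) / s ^ p + (a + b * \<alpha> * s ^ (q - p))) \<longlongrightarrow> a) (at 0)"
        using pq by (simp add: power_0_left)
      then show ?thesis
      proof (rule Lim_transform_eventually, intro eventually_mono[OF neq])
        fix s :: complex assume s: "s \<noteq> 0"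
        show "E (w s) / s ^ p + (a + b * \<alpha> * s ^ (q - p)) = f (w s) / s ^ p"
          using s by (simp add: E_def w_def q_split field_simps)
      qed
    qed
    \<comment> \<open>the error of replacing the second coordinate by \<open>h (s ^ p) + e \<alpha> s\<^sup>q\<close>\<close>
    define \<rho> where "\<rho> = (\<lambda>s. (F (w s) - h (s ^ p) - e * (\<alpha> * s ^ q)) / s ^ q)"
    have rho: "(\<rho> \<longlongrightarrow> 0) (at 0)"
    proof (rule tendstoI)
      fix \<epsilon> :: real assume ep: "\<epsilon> > 0"
      define \<epsilon>' where "\<epsilon>' = \<epsilon> / (2 * (cmod \<alpha> + 1))"
      have ca: "cmod \<alpha> + 1 > 0" using norm_ge_zero[of \<alpha>] by linarith
      have ep': "\<epsilon>' > 0" using ep ca by (simp add: \<epsilon>'_def)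
      have U00: "(0, 0) \<in> U" using U(2) by (simp add: zero_prod_def)
      obtain \<delta> where de: "\<delta> > 0" "\<And>x y. cmod x < \<delta> \<Longrightarrow> cmod y < \<delta> \<Longrightarrow> cmod (F (x, y) - F (x, 0) - e * y) \<le> \<epsilon>' * cmod y"
        using uniform_partial_derivative[OF U(1) U00 _ dF ep'] hol unfolding F_def by blast
      have "\<forall>\<^sub>F s in at 0. w s \<in> ball 0 \<delta>" by (rule topological_tendstoD[OF w0]) (use de in auto)
      then show "\<forall>\<^sub>F s in at 0. dist (\<rho> s) 0 < \<epsilon>" using neq
      proof eventually_elim
        case (elim s)
        have "cmod (s ^ p) \<le> norm (w s)" "cmod (\<alpha> * s ^ q) \<le> norm (w s)"
          unfolding w_def using norm_fst_le norm_snd_le by (metis fst_conv, metis snd_conv)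
        then have "cmod (F (s ^ p, \<alpha> * s ^ q) - F (s ^ p, 0) - e * (\<alpha> * s ^ q)) \<le> \<epsilon>' * cmod (\<alpha> * s ^ q)"
          using elim by (intro de(2)) auto
        then have "cmod (\<rho> s) \<le> \<epsilon>' * cmod (\<alpha> * s ^ q) / cmod (s ^ q)"
          unfolding \<rho>_def norm_divide h_def by (intro divide_right_mono) (auto simp: w_def)
        also have "\<dots> = \<epsilon>' * cmod \<alpha>" using elim by (simp add: norm_mult)
        also have "\<dots> \<le> \<epsilon>' * (cmod \<alpha> + 1)" using ep' by simp
        also have "\<dots> = \<epsilon> / 2"
        proof -
          have "\<epsilon> / (2 * x) * x = \<epsilon> / 2" if "x \<noteq> 0" for x :: real using that by simp
          then show ?thesis using ca unfolding \<epsilon>'_def by (metis less_irrefl)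
        qed
        finally show ?case using ep by simp
      qed
    qed
    have ev0: "\<forall>\<^sub>F s in at 0. qh_poly p q \<Lambda> (\<Phi> (w s)) = 0"
    proof -
      have "\<forall>\<^sub>F s in at 0. qh_poly p q \<Lambda>' (w s) = qh_poly p q \<Lambda> (\<Phi> (w s))"
        using ev w0 by (rule eventually_compose_filterlim)
      moreover have "qh_poly p q \<Lambda>' (w s) = 0" for s
      proof -
        have "(\<alpha> * s ^ q) ^ p - l * (s ^ p) ^ q = 0"
          by (simp add: power_mult_distrib al power_mult[symmetric] mult.commute)
        then show ?thesis using l L' unfolding qh_poly_def w_def by (auto simp: root_sets_def intro!: prod_zero bexI[of _ l])
      qed
      ultimately show ?thesis by simp
    qed
    have prod_form: "qh_poly p q \<Lambda> (\<Phi> z) = (\<Prod>m\<in>\<Lambda>. F z ^ p - m * f z ^ q)" for z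
      by (simp add: qh_poly_def case_prod_unfold F_def f_def)
    define M where "M = (\<Sum>m\<in>\<Lambda>. cmod m)"
    have M: "M \<ge> 0" "\<And>m. m \<in> \<Lambda> \<Longrightarrow> cmod m \<le> M" using finL by (auto simp: M_def intro: sum_nonneg member_le_sum)
    define B where "B = M * (cmod a + 1) ^ q"
    have B0: "B \<ge> 0" using M by (simp add: B_def)
    \<comment> \<open>one of the factors vanishes on the image curve, which bounds the second coordinate by the first\<close>
    have bd: "\<forall>\<^sub>F s in at 0. cmod (h (s ^ p) / s ^ q) \<le> 1 + B + cmod (e * \<alpha>) + 1"
    proof -
      have "\<forall>\<^sub>F s in at 0. dist (f (w s) / s ^ p) a < 1" by (rule tendstoD[OF lim1]) simp
      moreover have "\<forall>\<^sub>F s in at 0. dist (\<rho> s) 0 < 1" by (rule tendstoD[OF rho]) simp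
      ultimately show ?thesis using ev0 neq
      proof eventually_elim
        case (elim s)
        have fb: "cmod (f (w s) / s ^ p) \<le> cmod a + 1"
          using elim(1) norm_triangle_sub[of "f (w s) / s ^ p" a] by (simp add: dist_norm)
        obtain m where m: "m \<in> \<Lambda>" "F (w s) ^ p = m * f (w s) ^ q"
          using elim(3) finL unfolding prod_form by auto
        have "(F (w s) / s ^ q) ^ p = m * (f (w s) / s ^ p) ^ q"
          using m(2) by (simp add: power_divide power_mult[symmetric] mult.commute)
        then have "cmod (F (w s) / s ^ q) ^ p = cmod m * cmod (f (w s) / s ^ p) ^ q"
          by (metis norm_mult norm_power)
        also have "\<dots> \<le> B" unfolding B_def using M m(1) fb by (intro mult_mono power_mono) auto
        finally have Fp: "cmod (F (w s) / s ^ q) ^ p \<le> B" .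
        have Fb: "cmod (F (w s) / s ^ q) \<le> 1 + B"
        proof (cases "cmod (F (w s) / s ^ q) \<le> 1")
          case False
          then have "cmod (F (w s) / s ^ q) ^ 1 \<le> cmod (F (w s) / s ^ q) ^ p"
            using pq by (intro power_increasing) auto
          then show ?thesis using Fp by simp
        qed (use B0 in simp)
        have "h (s ^ p) / s ^ q = F (w s) / s ^ q - e * \<alpha> - \<rho> s"
          using elim(4) by (simp add: \<rho>_def field_simps)
        then have "cmod (h (s ^ p) / s ^ q) \<le> cmod (F (w s) / s ^ q) + cmod (e * \<alpha>) + cmod (\<rho> s)"
          by (metis norm_triangle_ineq4 add_right_mono order_trans)
        then show ?case using Fb elim(2) by simp
      qed
    qed
    note gap = power_order_gap[OF hhol r0(1) h0 pq bd]
    have c0: "c = 0" using tendsto_unique[OF trivial_limit_at hc gap(2)] .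
    have "((\<lambda>s. h (s ^ p) / s ^ q + \<rho> s + e * \<alpha>) \<longlongrightarrow> 0 + 0 + e * \<alpha>) (at 0)"
      by (intro tendsto_intros gap(1) rho)
    then have lim2: "((\<lambda>s. F (w s) / s ^ q) \<longlongrightarrow> e * \<alpha>) (at 0)"
    proof (simp, elim Lim_transform_eventually, intro eventually_mono[OF neq])
      fix s :: complex assume "s \<noteq> 0"
      then show "h (s ^ p) / s ^ q + \<rho> s + e * \<alpha> = F (w s) / s ^ q" by (simp add: \<rho>_def field_simps)
    qed
    have "((\<lambda>s. \<Prod>m\<in>\<Lambda>. (F (w s) / s ^ q) ^ p - m * (f (w s) / s ^ p) ^ q) \<longlongrightarrow>
        (\<Prod>m\<in>\<Lambda>. (e * \<alpha>) ^ p - m * a ^ q)) (at 0)"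
      by (intro tendsto_intros lim1 lim2)
    moreover have "((\<lambda>s. \<Prod>m\<in>\<Lambda>. (F (w s) / s ^ q) ^ p - m * (f (w s) / s ^ p) ^ q) \<longlongrightarrow> 0) (at 0)"
    proof (rule tendsto_eventually)
      show "\<forall>\<^sub>F s in at 0. (\<Prod>m\<in>\<Lambda>. (F (w s) / s ^ q) ^ p - m * (f (w s) / s ^ p) ^ q) = 0"
        using ev0
      proof eventually_elim
        case (elim s)
        then obtain m where m: "m \<in> \<Lambda>" "F (w s) ^ p = m * f (w s) ^ q"
          using finL unfolding prod_form by auto
        then have "(F (w s) / s ^ q) ^ p - m * (f (w s) / s ^ p) ^ q = 0"
          by (simp add: power_divide power_mult[symmetric] mult.commute)
        then show ?case using m(1) finL by (auto intro!: prod_zero)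
      qed
    qed
    ultimately have "(\<Prod>m\<in>\<Lambda>. (e * \<alpha>) ^ p - m * a ^ q) = 0"
      using tendsto_unique[OF trivial_limit_at] by blast
    then obtain m where "m \<in> \<Lambda>" "(e * \<alpha>) ^ p = m * a ^ q" using finL by auto
    then show ?thesis using c0 al by (auto simp: power_mult_distrib)
  qed
  obtain l0 where "l0 \<in> \<Lambda>'" using L' n by (auto simp: root_sets_def dest: card_gt_0_iff[THEN iffD1])
  then have c0: "c = 0" using core by blast
  then have ae0: "a \<noteq> 0" "e \<noteq> 0" using ae by auto
  have "e ^ p / a ^ q * l \<in> \<Lambda>" if l: "l \<in> \<Lambda>'" for l
  proof -
    obtain m where m: "m \<in> \<Lambda>" "e ^ p * l = m * a ^ q" using core[OF l] by blast
    then have "e ^ p / a ^ q * l = m" using ae0 by (simp add: field_simps)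
    then show ?thesis using m by simp
  qed
  then show ?thesis using ae0 by (intro exI[of _ "e ^ p / a ^ q"]) auto
qed

lemma Zn_orbit_rotate:
  assumes "\<zeta> ^ n = 1" "n > 0"
  shows "Zn_orbit n ((\<lambda>z. \<zeta> * z) ` \<Lambda>) = Zn_orbit n \<Lambda>"
proof -
  have z: "\<zeta> \<noteq> 0" using assms by (auto simp: power_0_left)
  have 1: "(\<lambda>z. x * z) ` (\<lambda>z. \<zeta> * z) ` \<Lambda> \<in> Zn_orbit n \<Lambda>" if "x ^ n = 1" for x
    unfolding Zn_orbit_def
    by (intro CollectI exI[of _ "x * \<zeta>"]) (use that assms in \<open>simp add: image_image mult.assoc power_mult_distrib\<close>)
  have 2: "(\<lambda>z. x * z) ` \<Lambda> \<in> Zn_orbit n ((\<lambda>z. \<zeta> * z) ` \<Lambda>)" if "x ^ n = 1" for x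
    unfolding Zn_orbit_def
    by (intro CollectI exI[of _ "x / \<zeta>"]) (use that assms z in \<open>simp add: image_image power_divide\<close>)
  show ?thesis
  proof
    show "Zn_orbit n ((\<lambda>z. \<zeta> * z) ` \<Lambda>) \<subseteq> Zn_orbit n \<Lambda>"
      using 1 by (subst Zn_orbit_def) blast
    show "Zn_orbit n \<Lambda> \<subseteq> Zn_orbit n ((\<lambda>z. \<zeta> * z) ` \<Lambda>)"
      using 2 by (subst Zn_orbit_def) blast
  qed
qed

lemma Zn_orbit_self: "\<Lambda> \<in> Zn_orbit n \<Lambda>"
  unfolding Zn_orbit_def by (intro CollectI exI[of _ 1]) auto

lemma Zn_orbit_eq_iff:
  assumes "n > 0"
  shows "Zn_orbit n \<Lambda> = Zn_orbit n \<Lambda>' \<longleftrightarrow> (\<exists>\<zeta>. \<zeta> ^ n = 1 \<and> \<Lambda> = (\<lambda>z. \<zeta> * z) ` \<Lambda>')"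
proof
  assume "Zn_orbit n \<Lambda> = Zn_orbit n \<Lambda>'"
  then have "\<Lambda> \<in> Zn_orbit n \<Lambda>'" using Zn_orbit_self by metis
  then show "\<exists>\<zeta>. \<zeta> ^ n = 1 \<and> \<Lambda> = (\<lambda>z. \<zeta> * z) ` \<Lambda>'" by (auto simp: Zn_orbit_def)
qed (use Zn_orbit_rotate assms in blast)

text \<open>
  Both sets of roots have product \<open>1\<close>, so a constant that multiplies one into the other is an \<open>n\<close>-th root
  of unity.
\<close>

theorem analytic_type_eq_iff_orbit_eq:
  assumes pq: "1 < p" "p < q" "coprime p q" and n: "n > 0"
    and L: "\<Lambda> \<in> V_space n" and L': "\<Lambda>' \<in> V_space n"
  shows "analytic_type (qh_poly p q \<Lambda>) = analytic_type (qh_poly p q \<Lambda>') \<longleftrightarrow> Zn_orbit n \<Lambda> = Zn_orbit n \<Lambda>'"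
proof
  have r: "\<Lambda> \<in> root_sets n" "\<Lambda>' \<in> root_sets n" using L L' by (auto simp: V_space_def)
  have pq0: "p > 0" "q > 0" using pq by auto
  {
    assume eq: "analytic_type (qh_poly p q \<Lambda>) = analytic_type (qh_poly p q \<Lambda>')"
    have "qh_poly p q \<Lambda>' \<in> analytic_type (qh_poly p q \<Lambda>')"
      using qh_poly_in_function_germs[OF r(2) n pq0] Diff0_id
      by (auto simp: analytic_type_def analytic_equivalence_def intro!: bexI[of _ "\<lambda>z. z"])
    then have "qh_poly p q \<Lambda>' \<in> analytic_type (qh_poly p q \<Lambda>)" using eq by simp
    then obtain \<Phi> where "\<Phi> \<in> Diff0" "\<forall>\<^sub>F z in nhds 0. qh_poly p q \<Lambda>' z = qh_poly p q \<Lambda> (\<Phi> z)"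
      by (auto simp: analytic_type_def analytic_equivalence_def)
    from Diff0_multiplier[OF this(1) pq r n this(2)]
    obtain \<mu> where mu: "\<mu> \<noteq> 0" "\<And>l. l \<in> \<Lambda>' \<Longrightarrow> \<mu> * l \<in> \<Lambda>" by blast
    have inj: "inj_on (\<lambda>z. \<mu> * z) \<Lambda>'" using mu(1) by (auto simp: inj_on_def)
    have img: "(\<lambda>z. \<mu> * z) ` \<Lambda>' = \<Lambda>"
      by (rule card_subset_eq) (use mu r in \<open>auto simp: root_sets_def card_image[OF inj]\<close>)
    have "(\<Prod>l\<in>\<Lambda>. l) = (\<Prod>l\<in>\<Lambda>'. \<mu> * l)" unfolding img[symmetric] by (simp add: prod.reindex[OF inj])
    also have "\<dots> = \<mu> ^ n * (\<Prod>l\<in>\<Lambda>'. l)" using r by (simp add: prod.distrib root_sets_def)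
    finally have "\<mu> ^ n = 1" using L L' by (simp add: V_space_def)
    then show "Zn_orbit n \<Lambda> = Zn_orbit n \<Lambda>'" using img Zn_orbit_eq_iff[OF n] by metis
  next
    assume "Zn_orbit n \<Lambda> = Zn_orbit n \<Lambda>'"
    then obtain \<zeta> where z: "\<zeta> ^ n = 1" "\<Lambda> = (\<lambda>z. \<zeta> * z) ` \<Lambda>'" using Zn_orbit_eq_iff[OF n] by blast
    have "\<zeta> \<noteq> 0" using z n by (auto simp: power_0_left)
    from analytic_type_rotation[OF r(2) n pq0 this]
    show "analytic_type (qh_poly p q \<Lambda>) = analytic_type (qh_poly p q \<Lambda>')" using z by simp
  }
qed

section \<open>Polynomials with separated critical values\<close>

text \<open>
  Over the complex numbers \<open>p\<close> is a constant multiple of the product of its linear factors with their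
  multiplicities.
\<close>

lemma dvd_if_order_le:
  fixes p q :: "complex poly"
  assumes "p \<noteq> 0" "q \<noteq> 0" and le: "\<And>a. poly p a = 0 \<Longrightarrow> Polynomial.order a p \<le> Polynomial.order a q"
  shows "p dvd q"
proof -
  define A where "A = {z. poly q z = 0}"
  have fin: "finite A" unfolding A_def by (rule poly_roots_finite) fact
  have sub: "{z. poly p z = 0} \<subseteq> A"
  proof
    fix z assume "z \<in> {z. poly p z = 0}"
    then have z: "poly p z = 0" by simp
    then have "Polynomial.order z p \<noteq> 0" using assms(1) by (simp add: order_root)
    then have "Polynomial.order z q \<noteq> 0" using le[OF z] by simp
    then show "z \<in> A" by (simp add: A_def order_root)
  qed
  have "(\<Prod>z\<in>{z. poly p z = 0}. [:- z, 1:] ^ Polynomial.order z p) = (\<Prod>z\<in>A. [:- z, 1:] ^ Polynomial.order z p)"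
    by (rule prod.mono_neutral_left[OF fin sub]) (auto simp: order_0I)
  also have "\<dots> dvd (\<Prod>z\<in>A. [:- z, 1:] ^ Polynomial.order z q)"
  proof (intro prod_dvd_prod le_imp_power_dvd)
    fix z show "Polynomial.order z p \<le> Polynomial.order z q"
      using le[of z] by (cases "poly p z = 0") (auto simp: order_0I)
  qed
  also have "\<dots> dvd q"
    using complex_poly_decompose[of q] by (metis A_def dvd_refl dvd_smult)
  finally have "Polynomial.smult (lead_coeff p) (\<Prod>z\<in>{z. poly p z = 0}. [:- z, 1:] ^ Polynomial.order z p) dvd q"
    using assms(1) by (simp add: smult_dvd_iff)
  then show ?thesis by (simp only: complex_poly_decompose)
qed

text \<open>
  The condition on \<open>G\<close> is linear, so the property amounts to the nonvanishing of a determinant. Its meaning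
  is given by \<open>separated_values_iff\<close>.
\<close>

definition separated_values :: "complex poly \<Rightarrow> bool"
  where "separated_values Q \<longleftrightarrow>
    (\<forall>G. degree G < degree Q \<longrightarrow> pCons 0 (pderiv Q) dvd Q * pcompose G Q \<longrightarrow> G = 0)"

text \<open>
  Let \<open>S\<close> be the set of values of \<open>Q\<close> at the roots of \<open>T = t Q'\<close>. At a root \<open>a\<close> the order of \<open>T\<close> is at most
  that of \<open>Q - Q(a)\<close>, so \<open>T\<close> divides the product of the \<open>Q - r\<close> with \<open>r \<in> S\<close>. If \<open>S\<close> has fewer than
  \<open>degree Q\<close> elements, \<open>G(u) = \<Prod>(u - r)\<close> violates the separation property; if \<open>0 \<in> S\<close>, the same
  product without the factor for \<open>r = 0\<close> does, since that factor is \<open>Q\<close> itself. Conversely, if the values are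
  distinct and nonzero, the divisibility makes every element of \<open>S\<close> a root of \<open>G\<close>.
\<close>

lemma separated_values_iff:
  fixes Q :: "complex poly"
  assumes deg: "degree Q > 0"
  defines "C \<equiv> {k. poly (pCons 0 (pderiv Q)) k = 0}"
  shows "separated_values Q \<longleftrightarrow> card C = degree Q \<and> inj_on (poly Q) C \<and> (\<forall>k\<in>C. poly Q k \<noteq> 0)"
proof -
  define T where "T = pCons 0 (pderiv Q)"
  have Q'0: "pderiv Q \<noteq> 0" using deg by (simp add: pderiv_eq_0_iff)
  have T0: "T \<noteq> 0" using Q'0 by (simp add: T_def)
  have degT: "degree T = degree Q" using Q'0 deg by (simp add: T_def degree_pderiv)
  have finC: "finite C" unfolding C_def T_def[symmetric] by (rule poly_roots_finite[OF T0])
  have cardC: "card C \<le> degree Q"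
    unfolding C_def T_def[symmetric] using card_poly_roots_bound[OF T0] degT by simp
  define S where "S = poly Q ` C"
  have finS: "finite S" using finC by (simp add: S_def)
  have Qr0: "Q - [:r:] \<noteq> 0" for r using deg by (metis degree_pCons_0 eq_iff_diff_eq_0 less_irrefl)
  have dvd: "T dvd (\<Prod>r\<in>S. Q - [:r:])"
  proof (rule dvd_if_order_le[OF T0])
    show "(\<Prod>r\<in>S. Q - [:r:]) \<noteq> 0" using Qr0 finS by simp
    fix a assume a: "poly T a = 0"
    define r where "r = poly Q a"
    have rS: "r \<in> S" using a by (simp add: S_def r_def C_def T_def)
    have "Polynomial.order a T = Polynomial.order a ([:0, 1:] * pderiv Q)" by (simp add: T_def)
    also have "\<dots> = Polynomial.order a [:0, 1:] + Polynomial.order a (pderiv Q)"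
      by (rule order_mult) (use Q'0 in simp)
    also have "\<dots> \<le> Suc (Polynomial.order a (pderiv Q))"
      using order_degree[of "[:0, 1:]" a] by simp
    also have "\<dots> = Suc (Polynomial.order a (pderiv (Q - [:r:])))" by (simp add: pderiv_diff pderiv_pCons)
    also have "\<dots> = Polynomial.order a (Q - [:r:])"
      by (rule order_pderiv[symmetric, OF Qr0]) (simp add: r_def)
    also have "\<dots> \<le> Polynomial.order a (\<Prod>r\<in>S. Q - [:r:])"
      by (rule dvd_imp_order_le) (use Qr0 finS rS in \<open>auto intro: dvd_prodI\<close>)
    finally show "Polynomial.order a T \<le> Polynomial.order a (\<Prod>r\<in>S. Q - [:r:])" .
  qed
  have comp: "pcompose (\<Prod>r\<in>A. [:- r, 1:]) Q = (\<Prod>r\<in>A. Q - [:r:])" for A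
  proof -
    have "pcompose [:- r, 1:] Q = Q - [:r:]" for r by (simp add: pcompose_pCons)
    then show ?thesis by (simp add: pcompose_prod)
  qed
  show ?thesis
  proof
    assume sep: "separated_values Q"
    have no: "A = {} \<or> \<not> T dvd Q * (\<Prod>r\<in>A. Q - [:r:])" if A: "finite A" "card A < degree Q" for A
    proof (rule ccontr)
      assume "\<not> ?thesis"
      then have "T dvd Q * pcompose (\<Prod>r\<in>A. [:- r, 1:]) Q" by (simp add: comp)
      moreover have "degree (\<Prod>r\<in>A. [:- r, 1:]) < degree Q"
        using A by (subst degree_prod_eq_sum_degree) auto
      ultimately have "(\<Prod>r\<in>A. [:- r, 1:]) = 0" using sep by (auto simp: separated_values_def T_def)
      then show False using A by simp
    qed
    have "0 \<notin> S"
    proof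
      assume 0: "0 \<in> S"
      have "card (S - {0}) < card S" using finS 0 by (rule card_Diff1_less)
      also have "\<dots> \<le> degree Q" using card_image_le[OF finC, of "poly Q"] cardC by (simp add: S_def)
      finally have lt: "card (S - {0}) < degree Q" .
      have eq: "(\<Prod>r\<in>S. Q - [:r:]) = Q * (\<Prod>r\<in>S - {0}. Q - [:r:])"
        by (subst prod.remove[OF finS 0]) simp
      have "pcompose (\<Prod>r\<in>S - {0}. [:- r, 1:]) Q = (\<Prod>r\<in>S - {0}. Q - [:r:])" by (rule comp)
      then have "(\<Prod>r\<in>S - {0}. [:- r, 1:]) = 0"
        using sep dvd eq lt by (auto simp: separated_values_def T_def degree_prod_eq_sum_degree)
      then show False using finS by simp
    qed
    have "card S = degree Q"
    proof (rule ccontr)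
      assume "card S \<noteq> degree Q"
      then have lt: "card S < degree Q"
        using card_image_le[OF finC, of "poly Q"] cardC by (simp add: S_def)
      have "pcompose (\<Prod>r\<in>S. [:- r, 1:]) Q = (\<Prod>r\<in>S. Q - [:r:])" by (rule comp)
      then have "(\<Prod>r\<in>S. [:- r, 1:]) = 0"
        using sep dvd_mult[OF dvd, of Q] lt by (auto simp: separated_values_def T_def degree_prod_eq_sum_degree)
      then show False using finS by simp
    qed
    then have "card C = degree Q" "card (poly Q ` C) = card C"
      using card_image_le[OF finC, of "poly Q"] cardC by (auto simp: S_def)
    then show "card C = degree Q \<and> inj_on (poly Q) C \<and> (\<forall>k\<in>C. poly Q k \<noteq> 0)"
      using eq_card_imp_inj_on[OF finC] \<open>0 \<notin> S\<close> by (auto simp: S_def image_iff)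
  next
    assume R: "card C = degree Q \<and> inj_on (poly Q) C \<and> (\<forall>k\<in>C. poly Q k \<noteq> 0)"
    show "separated_values Q"
      unfolding separated_values_def
    proof (intro allI impI, rule ccontr)
      fix G assume G: "degree G < degree Q" "pCons 0 (pderiv Q) dvd Q * pcompose G Q" "G \<noteq> 0"
      have "poly G r = 0" if rS: "r \<in> S" for r
      proof -
        obtain k where k: "k \<in> C" "r = poly Q k" using rS by (auto simp: S_def)
        obtain w where "Q * pcompose G Q = T * w" using G(2)[folded T_def] by (rule dvdE)
        then have "poly (Q * pcompose G Q) k = poly T k * poly w k" by simp
        moreover have "poly T k = 0" using k(1) by (simp add: C_def T_def)
        moreover have "poly Q k \<noteq> 0" using k(1) R by blast
        ultimately show ?thesis by (simp add: poly_pcompose k(2))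
      qed
      then have "card S \<le> card {r. poly G r = 0}"
        by (intro card_mono poly_roots_finite[OF G(3)]) auto
      also have "\<dots> \<le> degree G" by (rule card_poly_roots_bound[OF G(3)])
      finally show False using R G(1) by (simp add: S_def card_image)
    qed
  qed
qed

text \<open>
  Extends the inverse of \<open>coeff_coords\<close> to all points of \<open>\<complex>\<^sup>n\<close>, including those whose polynomial has
  multiple roots or the root \<open>0\<close>.
\<close>

definition poly_of_coords :: "nat \<Rightarrow> complex list \<Rightarrow> complex poly"
  where "poly_of_coords n v = Polynomial.monom 1 n + (\<Sum>l\<in>{1..n}. Polynomial.monom ((-1) ^ l * v ! (l - 1)) (n - l))"

lemma coeff_poly_of_coords:
  "coeff (poly_of_coords n v) r = (if r = n then 1 else if r < n then (-1) ^ (n - r) * v ! (n - r - 1) else 0)"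
proof -
  have "(\<Sum>l\<in>{1..n}. coeff (Polynomial.monom ((-1) ^ l * v ! (l - 1)) (n - l)) r) =
      (\<Sum>l\<in>{1..n}. if l = n - r \<and> r < n then (-1) ^ (n - r) * v ! (n - r - 1) else 0)"
    by (intro sum.cong) (auto simp: coeff_monom)
  also have "\<dots> = (if r < n then (-1) ^ (n - r) * v ! (n - r - 1) else 0)"
    by (cases "r < n") (auto simp: sum.delta)
  finally have s: "(\<Sum>l\<in>{1..n}. coeff (Polynomial.monom ((-1) ^ l * v ! (l - 1)) (n - l)) r) =
      (if r < n then (-1) ^ (n - r) * v ! (n - r - 1) else 0)" .
  show ?thesis unfolding poly_of_coords_def coeff_add coeff_sum s by (auto simp: coeff_monom)
qed

lemma degree_poly_of_coords: "degree (poly_of_coords n v) = n"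
  and lead_poly_of_coords: "coeff (poly_of_coords n v) n = 1"
proof -
  show 1: "coeff (poly_of_coords n v) n = 1" by (simp add: coeff_poly_of_coords)
  have "degree (poly_of_coords n v) \<le> n" by (rule degree_le) (simp add: coeff_poly_of_coords)
  moreover have "n \<le> degree (poly_of_coords n v)" by (rule le_degree) (simp add: 1)
  ultimately show "degree (poly_of_coords n v) = n" by simp
qed

lemma poly_of_coords_inj:
  assumes "length v = n" "length v' = n" "poly_of_coords n v = poly_of_coords n v'"
  shows "v = v'"
proof (rule nth_equalityI)
  fix i assume "i < length v"
  then have i: "i < n" using assms by simp
  then have "coeff (poly_of_coords n v) (n - Suc i) = (-1) ^ Suc i * v ! i" for v
    by (simp add: coeff_poly_of_coords)
  then have "(-1) ^ Suc i * v ! i = (-1) ^ Suc i * v' ! i" using assms(3) by metis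
  then show "v ! i = v' ! i" by simp
qed (use assms in simp)

lemma Q_poly_esym:
  assumes "finite \<Lambda>" "card \<Lambda> = n"
  shows "Q_poly \<Lambda> = (\<Sum>l\<le>n. Polynomial.monom ((-1) ^ l * sigma_set l \<Lambda>) (n - l))"
  using prod_linear_esym[OF assms(1), of "\<lambda>z. z"] assms(2) by (simp add: Q_poly_def sigma_set_def)

lemma poly_of_coeff_coords:
  assumes "finite \<Lambda>" "card \<Lambda> = n"
  shows "poly_of_coords n (coeff_coords n \<Lambda>) = Q_poly \<Lambda>"
proof -
  have "coeff_coords n \<Lambda> ! (l - 1) = sigma_set l \<Lambda>" if "l \<in> {1..n}" for l
    using that unfolding coeff_coords_def by (subst nth_map) (auto simp del: upt_Suc)
  then have "poly_of_coords n (coeff_coords n \<Lambda>) =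
      Polynomial.monom 1 n + (\<Sum>l\<in>{1..n}. Polynomial.monom ((-1) ^ l * sigma_set l \<Lambda>) (n - l))"
    unfolding poly_of_coords_def by (intro arg_cong2[of _ _ _ _ "(+)"] sum.cong) auto
  also have "\<dots> = (\<Sum>l\<in>insert 0 {1..n}. Polynomial.monom ((-1) ^ l * sigma_set l \<Lambda>) (n - l))"
    using esym_0[OF assms(1), of "\<lambda>z. z"] by (simp add: sigma_set_def)
  also have "insert 0 {1..n} = {..n}" by auto
  finally show ?thesis by (simp add: Q_poly_esym[OF assms])
qed

lemma polynomial_fun_cmult: "polynomial_fun n f \<Longrightarrow> polynomial_fun n (\<lambda>v. c * f v)"
  by (intro polynomial_fun.mult polynomial_fun.const)

lemma polynomial_fun_sum:
  "(\<And>i. i \<in> I \<Longrightarrow> polynomial_fun n (f i)) \<Longrightarrow> polynomial_fun n (\<lambda>v. \<Sum>i\<in>I. f i v)"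
  by (induction I rule: infinite_finite_induct) (auto intro: polynomial_fun.intros)

lemma polynomial_fun_prod:
  "(\<And>i. i \<in> I \<Longrightarrow> polynomial_fun n (f i)) \<Longrightarrow> polynomial_fun n (\<lambda>v. \<Prod>i\<in>I. f i v)"
  by (induction I rule: infinite_finite_induct) (auto intro: polynomial_fun.intros)

lemma polynomial_fun_coeff: "polynomial_fun n (\<lambda>v. coeff (poly_of_coords n v) r)"
proof -
  consider "r = n" | "r < n" | "r > n" by linarith
  then show ?thesis
  proof cases
    case 2
    then have "polynomial_fun n (\<lambda>v. (-1) ^ (n - r) * v ! (n - r - 1))"
      by (intro polynomial_fun_cmult polynomial_fun.coord) simp
    then show ?thesis using 2 by (simp add: coeff_poly_of_coords)
  qed (auto simp: coeff_poly_of_coords intro: polynomial_fun.const)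
qed

lemma polynomial_fun_coeff_mult:
  assumes "\<And>r. polynomial_fun n (\<lambda>v. coeff (P v) r)" "\<And>r. polynomial_fun n (\<lambda>v. coeff (P' v) r)"
  shows "polynomial_fun n (\<lambda>v. coeff (P v * P' v) r)"
  unfolding coeff_mult by (intro polynomial_fun_sum polynomial_fun.mult assms)

lemma polynomial_fun_coeff_power:
  assumes "\<And>r. polynomial_fun n (\<lambda>v. coeff (P v) r)"
  shows "polynomial_fun n (\<lambda>v. coeff (P v ^ k) r)"
proof (induction k arbitrary: r)
  case 0
  then show ?case by (simp add: polynomial_fun.const)
next
  case (Suc k)
  show ?case unfolding power_Suc by (rule polynomial_fun_coeff_mult[OF assms Suc])
qed

text \<open>
  The matrix of the linear map \<open>(G, w) \<mapsto> Q G(Q) - w t Q'\<close> in terms of coefficients, where \<open>G\<close> has degree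
  less than \<open>n\<close> and \<open>w\<close> has degree at most \<open>n\<^sup>2 - n\<close>. The result has degree at most \<open>n\<^sup>2\<close>, so the matrix is
  square.
\<close>

definition value_matrix :: "nat \<Rightarrow> complex poly \<Rightarrow> complex mat"
  where "value_matrix n Q = mat (n * n + 1) (n * n + 1) (\<lambda>(r, c).
    if c < n then coeff (Q ^ Suc c) r
    else - coeff (Polynomial.monom 1 (c - n) * pCons 0 (pderiv Q)) r)"

lemma polynomial_fun_det_value_matrix:
  "polynomial_fun n (\<lambda>v. Determinant.det (value_matrix n (poly_of_coords n v)))"
proof -
  have p: "polynomial_fun n (\<lambda>v. coeff (pCons 0 (pderiv (poly_of_coords n v))) r)" for r
    by (cases r) (auto simp: coeff_pderiv intro: polynomial_fun.const polynomial_fun_cmult polynomial_fun_coeff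
        simp del: of_nat_Suc)
  have e: "polynomial_fun n (\<lambda>v. if c < n then coeff (poly_of_coords n v ^ Suc c) r
    else - coeff (Polynomial.monom 1 (c - n) * pCons 0 (pderiv (poly_of_coords n v))) r)" for r c
  proof (cases "c < n")
    case True
    then show ?thesis
      using polynomial_fun_coeff_power[OF polynomial_fun_coeff, of n "Suc c" r] by (simp del: power_Suc)
  next
    case False
    have "polynomial_fun n (\<lambda>v. (-1) * coeff (Polynomial.monom 1 (c - n) * pCons 0 (pderiv (poly_of_coords n v))) r)"
      by (intro polynomial_fun_cmult polynomial_fun_coeff_mult p polynomial_fun.const)
    then show ?thesis using False by simp
  qed
  have "Determinant.det (value_matrix n Q) = (\<Sum>\<pi> | \<pi> permutes {0..<n * n + 1}. signof \<pi> *
      (\<Prod>i = 0..<n * n + 1. (if \<pi> i < n then coeff (Q ^ Suc (\<pi> i)) i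
        else - coeff (Polynomial.monom 1 (\<pi> i - n) * pCons 0 (pderiv Q)) i)))" for Q
  proof -
    have "value_matrix n Q \<in> carrier_mat (n * n + 1) (n * n + 1)" by (simp add: value_matrix_def)
    have "\<pi> i < n * n + 1" if "\<pi> permutes {0..<n * n + 1}" "i \<in> {0..<n * n + 1}" for \<pi> i
      using permutes_in_image[OF that(1), of i] that(2) by simp
    note perm = this
    from det_def'[OF \<open>value_matrix n Q \<in> _\<close>] show ?thesis
      by (simp only:) (intro sum.cong refl arg_cong2[of _ _ _ _ "(*)"] prod.cong,
        use perm in \<open>auto simp: value_matrix_def\<close>)
  qed
  then show ?thesis by (simp only:) (intro polynomial_fun_sum polynomial_fun_cmult polynomial_fun_prod e)
qed

text \<open>
  A vector in the kernel is a pair \<open>(G, w)\<close> with \<open>Q G(Q) = w t Q'\<close>, and \<open>G = 0\<close> implies \<open>w = 0\<close>. A cofactor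
  \<open>w\<close> of any divisibility that violates the separation property has degree at most \<open>n\<^sup>2 - n\<close>, so it is
  represented in the kernel.
\<close>

lemma det_value_matrix_nonzero_iff:
  assumes deg: "degree Q = n" and n: "n > 0"
  shows "Determinant.det (value_matrix n Q) \<noteq> 0 \<longleftrightarrow> separated_values Q"
proof -
  define m where "m = n * n + 1"
  define T where "T = pCons 0 (pderiv Q)"
  define k where "k = m - n"
  have "n \<le> n * n" using n by simp
  then have mk: "m = n + k" "n \<le> n * n" unfolding k_def m_def by linarith+
  have Q'0: "pderiv Q \<noteq> 0" using deg n by (simp add: pderiv_eq_0_iff)
  have T0: "T \<noteq> 0" using Q'0 by (simp add: T_def)
  have degT: "degree T = n" using Q'0 deg n by (simp add: T_def degree_pderiv)
  define A where "A = value_matrix n Q"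
  have A: "A \<in> carrier_mat m m" by (simp add: A_def value_matrix_def m_def)
  define G where "G = (\<lambda>x :: nat \<Rightarrow> complex. \<Sum>c<n. Polynomial.monom (x c) c)"
  define w where "w = (\<lambda>x :: nat \<Rightarrow> complex. \<Sum>c<k. Polynomial.monom (x (n + c)) c)"
  define E where "E = (\<lambda>x. Q * pcompose (G x) Q - w x * T)"
  have Gc: "coeff (G x) c = (if c < n then x c else 0)" for x c by (simp add: G_def coeff_sum)
  have wc: "coeff (w x) c = (if c < k then x (n + c) else 0)" for x c by (simp add: w_def coeff_sum)
  have row: "vec_index (A *\<^sub>v vec m x) r = coeff (E x) r" if r: "r < m" for x r
  proof -
    have "vec_index (A *\<^sub>v vec m x) r = (\<Sum>c<m. index_mat A (r, c) * x c)"
      using r A by (simp add: scalar_prod_def lessThan_atLeast0)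
    also have "\<dots> = (\<Sum>c<n. coeff (Q ^ Suc c) r * x c) +
        (\<Sum>c\<in>{n..<n + k}. - coeff (Polynomial.monom 1 (c - n) * T) r * x c)"
    proof -
      have split: "{..<m} = {..<n} \<union> {n..<n + k}" using mk(1) by auto
      have "(\<Sum>c<m. index_mat A (r, c) * x c) =
          (\<Sum>c<n. index_mat A (r, c) * x c) + (\<Sum>c\<in>{n..<n + k}. index_mat A (r, c) * x c)"
        unfolding split by (rule sum.union_disjoint) auto
      also have "\<dots> = (\<Sum>c<n. coeff (Q ^ Suc c) r * x c) +
        (\<Sum>c\<in>{n..<n + k}. - coeff (Polynomial.monom 1 (c - n) * T) r * x c)"
        by (intro arg_cong2[of _ _ _ _ "(+)"] sum.cong)
           (use r mk in \<open>auto simp: A_def value_matrix_def T_def m_def\<close>)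
      finally show ?thesis .
    qed
    also have "(\<Sum>c\<in>{n..<n + k}. - coeff (Polynomial.monom 1 (c - n) * T) r * x c) =
        (\<Sum>c<k. - coeff (Polynomial.monom 1 c * T) r * x (n + c))"
      by (rule sum.reindex_bij_witness[of _ "\<lambda>c. n + c" "\<lambda>c. c - n"]) auto
    also have "(\<Sum>c<n. coeff (Q ^ Suc c) r * x c) = coeff (Q * pcompose (G x) Q) r"
    proof -
      have "pcompose (Polynomial.monom (x c) c) Q = Polynomial.smult (x c) (Q ^ c)" for c
      proof -
        have "pcompose ([:0, 1:] ^ c) Q = Q ^ c"
          by (induction c) (simp_all add: pcompose_mult pcompose_pCons pcompose_1)
        then show ?thesis by (simp add: monom_altdef pcompose_smult)
      qed
      then have "Q * pcompose (G x) Q = (\<Sum>c<n. Polynomial.smult (x c) (Q ^ Suc c))"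
        by (simp add: G_def pcompose_sum sum_distrib_left)
      then show ?thesis by (simp add: coeff_sum mult.commute)
    qed
    also have "(\<Sum>c<k. - coeff (Polynomial.monom 1 c * T) r * x (n + c)) = - coeff (w x * T) r"
    proof -
      have "Polynomial.monom (x (n + c)) c = Polynomial.smult (x (n + c)) (Polynomial.monom 1 c)" for c
        by (simp add: smult_monom)
      then have "w x * T = (\<Sum>c<k. Polynomial.smult (x (n + c)) (Polynomial.monom 1 c * T))"
        by (simp add: w_def sum_distrib_right)
      then show ?thesis by (simp add: coeff_sum sum_negf mult.commute)
    qed
    finally show ?thesis by (simp add: E_def)
  qed
  have degG: "degree (G x) < n" for x
    using n by (intro degree_lessI) (auto simp: Gc)
  have degE: "degree (E x) < m" for x
  proof -
    have "degree (Q * pcompose (G x) Q) \<le> n + degree (G x) * n"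
      using degree_mult_le[of Q "pcompose (G x) Q"] degree_pcompose_le[of "G x" Q] deg by simp
    also have "\<dots> \<le> n + (n - 1) * n" using degG[of x] by (intro add_left_mono mult_right_mono) auto
    also have "\<dots> < m" using n by (cases n) (simp_all add: m_def)
    finally have 1: "degree (Q * pcompose (G x) Q) < m" .
    have "k > 0" using n by (cases n) (simp_all add: k_def m_def)
    then have "degree (w x) < k" by (intro degree_lessI) (auto simp: wc)
    then have "degree (w x * T) < m" using degree_mult_le[of "w x" T] degT mk by simp
    with 1 show ?thesis unfolding E_def by (rule degree_diff_less)
  qed
  have ker: "A *\<^sub>v vec m x = 0\<^sub>v m \<longleftrightarrow> Q * pcompose (G x) Q = w x * T" for x
  proof
    assume "A *\<^sub>v vec m x = 0\<^sub>v m"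
    then have "coeff (E x) r = 0" if "r < m" for r using row[OF that, of x] that by simp
    then have "E x = 0" using degE[of x] coeff_eq_0 by (metis not_less order_less_le_trans poly_eqI coeff_0)
    then show "Q * pcompose (G x) Q = w x * T" by (simp add: E_def)
  next
    assume "Q * pcompose (G x) Q = w x * T"
    then have "E x = 0" by (simp add: E_def)
    then show "A *\<^sub>v vec m x = 0\<^sub>v m" by (intro eq_vecI) (use A row[of _ x] in auto)
  qed
  show ?thesis
  proof
    assume nz: "Determinant.det (value_matrix n Q) \<noteq> 0"
    show "separated_values Q"
      unfolding separated_values_def
    proof (intro allI impI)
      fix H assume H: "degree H < degree Q" "pCons 0 (pderiv Q) dvd Q * pcompose H Q"
      obtain u where u: "Q * pcompose H Q = T * u" using H(2)[folded T_def] by (rule dvdE)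
      have degu: "coeff u c = 0" if "c \<ge> k" for c
      proof (cases "u = 0")
        case False
        then have "n + degree u = degree (Q * pcompose H Q)" using T0 degT by (simp add: u degree_mult_eq)
        also have "\<dots> \<le> n + degree H * n"
          using degree_mult_le[of Q "pcompose H Q"] degree_pcompose_le[of H Q] deg by simp
        also have "\<dots> \<le> n + (n - 1) * n" using H(1) deg by (intro add_left_mono mult_right_mono) auto
        also have "\<dots> < m" using n by (cases n) (simp_all add: m_def)
        also have "m = n + k" by (rule mk)
        finally show ?thesis using that by (intro coeff_eq_0) simp
      qed simp
      define x where "x = (\<lambda>i. if i < n then coeff H i else coeff u (i - n))"
      have GH: "G x = H"
        by (rule poly_eqI) (use H(1) deg in \<open>auto simp: Gc x_def intro!: coeff_eq_0\<close>)
      have wu: "w x = u" by (rule poly_eqI) (use degu in \<open>auto simp: wc x_def\<close>)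
      have "A *\<^sub>v vec m x = 0\<^sub>v m" unfolding ker GH wu using u by (simp add: mult.commute)
      then have "vec m x = 0\<^sub>v m"
        using nz det_0_iff_vec_prod_zero[OF A] unfolding A_def by (metis vec_carrier)
      then have "vec_index (vec m x) i = 0" if "i < m" for i using that by simp
      then have "x i = 0" if "i < m" for i using that by fastforce
      then have "G x = 0" by (intro poly_eqI) (use mk in \<open>auto simp: Gc\<close>)
      then show "H = 0" by (simp add: GH)
    qed
  next
    assume sep: "separated_values Q"
    show "Determinant.det (value_matrix n Q) \<noteq> 0"
    proof
      assume "Determinant.det (value_matrix n Q) = 0"
      then obtain y where y: "y \<in> carrier_vec m" "y \<noteq> 0\<^sub>v m" "A *\<^sub>v y = 0\<^sub>v m"
        using det_0_iff_vec_prod_zero[OF A] by (auto simp: A_def)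
      define x where "x = (\<lambda>i. vec_index y i)"
      have yx: "y = vec m x" by (rule eq_vecI) (use y(1) in \<open>auto simp: x_def\<close>)
      have eq: "Q * pcompose (G x) Q = w x * T" using y(3) ker unfolding yx by blast
      then have "pCons 0 (pderiv Q) dvd Q * pcompose (G x) Q" unfolding T_def[symmetric] by (metis dvd_triv_right)
      then have G0: "G x = 0" using sep degG[of x] deg by (auto simp: separated_values_def)
      then have "w x = 0" using eq T0 by simp
      have "x i = 0" if "i < m" for i
      proof (cases "i < n")
        case True
        then show ?thesis using Gc[of x i] G0 by simp
      next
        case False
        then have "i - n < k" "n + (i - n) = i" using that mk by auto
        then show ?thesis using wc[of x "i - n"] \<open>w x = 0\<close> by simp
      qed
      then have "y = 0\<^sub>v m" unfolding yx by (intro eq_vecI) auto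
      then show False using y(2) by simp
    qed
  qed
qed

text \<open>
  A multiple root would be a critical point with value \<open>0\<close>, and \<open>Q 0\<close> is nonzero as well; so \<open>Q\<close> has \<open>n\<close>
  distinct nonzero roots.
\<close>

lemma separated_values_roots:
  assumes deg: "degree Q = n" and lead: "lead_coeff Q = 1" and n: "n > 0" and sep: "separated_values Q"
  defines "\<Lambda> \<equiv> {z. poly Q z = 0}"
  shows "Q_poly \<Lambda> = Q" "\<Lambda> \<in> Z_roots n"
proof -
  define C where "C = {k. poly (pCons 0 (pderiv Q)) k = 0}"
  have C: "card C = n" "inj_on (poly Q) C" "\<And>k. k \<in> C \<Longrightarrow> poly Q k \<noteq> 0"
    using separated_values_iff[of Q] deg n sep by (auto simp: C_def)
  have Q0: "Q \<noteq> 0" using lead by auto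
  have Q'0: "pderiv Q \<noteq> 0" using deg n by (simp add: pderiv_eq_0_iff)
  have C_eq: "C = insert 0 {k. poly (pderiv Q) k = 0}" by (auto simp: C_def)
  have "rsquarefree Q"
    unfolding rsquarefree_roots using C(3) by (auto simp: C_eq)
  from complex_poly_decompose_rsquarefree[OF this]
  show QQ: "Q_poly \<Lambda> = Q" by (simp add: Q_poly_def \<Lambda>_def lead)
  have fin: "finite \<Lambda>" unfolding \<Lambda>_def by (rule poly_roots_finite[OF Q0])
  have "degree (Q_poly \<Lambda>) = card \<Lambda>"
    unfolding Q_poly_def by (subst degree_prod_eq_sum_degree) auto
  then have cardL: "card \<Lambda> = n" using QQ deg by simp
  have "0 \<notin> \<Lambda>" using C(3)[of 0] by (simp add: \<Lambda>_def C_def)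
  have finR: "finite {k. poly (pderiv Q) k = 0}" by (rule poly_roots_finite[OF Q'0])
  have "card {k. poly (pderiv Q) k = 0} \<le> n - 1"
    using card_poly_roots_bound[OF Q'0] deg by (simp add: degree_pderiv)
  moreover have "card C \<le> Suc (card {k. poly (pderiv Q) k = 0})"
    unfolding C_eq by (rule card_insert_le_m1) (use C in simp_all)
  ultimately have "card {k. poly (pderiv Q) k = 0} = n - 1" using C(1) by simp
  moreover have "inj_on (poly Q) {k. poly (pderiv Q) k = 0}"
    by (rule inj_on_subset[OF C(2)]) (auto simp: C_eq)
  ultimately show "\<Lambda> \<in> Z_roots n"
    using fin cardL \<open>0 \<notin> \<Lambda>\<close> by (simp add: Z_roots_def root_sets_def QQ)
qed

definition generic_coords :: "nat \<Rightarrow> complex list set"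
  where "generic_coords n = {v. length v = n \<and> separated_values (poly_of_coords n v)}"

lemma zariski_open_generic_coords:
  assumes "n > 0"
  shows "zariski_open n (generic_coords n)"
  unfolding zariski_open_def
proof (intro exI[of _ "{\<lambda>v. Determinant.det (value_matrix n (poly_of_coords n v))}"] conjI)
  show "\<forall>f\<in>{\<lambda>v. Determinant.det (value_matrix n (poly_of_coords n v))}. polynomial_fun n f"
    using polynomial_fun_det_value_matrix by blast
  show "generic_coords n =
      {v. length v = n \<and> \<not> (\<forall>f\<in>{\<lambda>v. Determinant.det (value_matrix n (poly_of_coords n v))}. f v = 0)}"
    unfolding generic_coords_def
    using det_value_matrix_nonzero_iff[OF degree_poly_of_coords assms] by auto
qed

lemma generic_coords_subset:
  assumes "n > 0"
  shows "generic_coords n \<subseteq> coeff_coords n ` Z_roots n"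
proof
  fix v assume "v \<in> generic_coords n"
  then have v: "length v = n" "separated_values (poly_of_coords n v)" by (auto simp: generic_coords_def)
  define \<Lambda> where "\<Lambda> = {z. poly (poly_of_coords n v) z = 0}"
  have lead: "lead_coeff (poly_of_coords n v) = 1" by (simp add: degree_poly_of_coords lead_poly_of_coords)
  note L = separated_values_roots[OF degree_poly_of_coords lead assms v(2), folded \<Lambda>_def]
  have "finite \<Lambda>" "card \<Lambda> = n" using L(2) by (auto simp: Z_roots_def root_sets_def)
  from poly_of_coeff_coords[OF this] have "poly_of_coords n (coeff_coords n \<Lambda>) = poly_of_coords n v"
    using L(1) by simp
  then have "coeff_coords n \<Lambda> = v"
    by (intro poly_of_coords_inj[of _ n]) (use v in \<open>auto simp: coeff_coords_def\<close>)
  then show "v \<in> coeff_coords n ` Z_roots n" using L(2) by blast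
qed

text \<open>
  A member is the normalized polynomial of any vector of critical points at whose value \<open>crit_disc\<close> does
  not vanish.
\<close>

lemma generic_coords_nonempty: "generic_coords (Suc N) \<noteq> {}"
proof -
  obtain x where x: "x \<in> cn N" "crit_disc N (himg N (crit_value N) x) \<noteq> 0"
    using crit_disc_nonzero_somewhere by blast
  define e where "e = himg N (crit_value N) x"
  have e: "\<And>j. j < N \<Longrightarrow> e j \<noteq> 0" "\<And>j. j < N \<Longrightarrow> e j + (-1) ^ Suc N \<noteq> 0" "inj_on e {..<N}"
    using x(2) by (auto simp: crit_disc_nonzero_iff e_def)
  have ej: "e j = poly (crit_primitive N x) (x j)" if "j < N" for j
    using that by (simp add: e_def himg_def crit_value_def)
  define Q where "Q = crit_primitive N x + [:(-1) ^ Suc N:]"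
  have pdQ: "pderiv Q = Polynomial.smult (of_nat (Suc N)) (crit_poly N x)"
    by (simp add: Q_def pderiv_add pderiv_pCons pderiv_crit_primitive del: of_nat_Suc)
  have degQ: "degree Q = Suc N"
    unfolding Q_def by (subst degree_add_eq_left) (auto simp: degree_crit_primitive)
  have leadQ: "coeff Q (Suc N) = 1" by (simp add: Q_def lead_crit_primitive)
  define C where "C = {k. poly (pCons 0 (pderiv Q)) k = 0}"
  have C: "C = insert 0 (x ` {..<N})"
    by (auto simp: C_def pdQ poly_crit_poly_eq_0_iff simp del: of_nat_Suc)
  have xnz: "x j \<noteq> 0" if "j < N" for j using e(1)[OF that] ej[OF that] crit_primitive_0 by auto
  have xinj: "inj_on x {..<N}" using e(3) ej by (auto simp: inj_on_def)
  have Q0: "poly Q 0 = (-1) ^ Suc N" by (simp add: Q_def crit_primitive_0)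
  have Qx: "poly Q (x j) = e j + (-1) ^ Suc N" if "j < N" for j using ej[OF that] by (simp add: Q_def)
  have "card C = Suc N" unfolding C
    using xnz by (subst card_insert_disjoint) (auto simp: card_image[OF xinj] image_iff)
  moreover have "inj_on (poly Q) C"
  proof -
    have "inj_on (poly Q) (x ` {..<N})" using e(3) Qx by (auto simp: inj_on_def)
    moreover have "poly Q 0 \<notin> poly Q ` (x ` {..<N} - {0})" using e(1) Q0 Qx by (auto simp: image_iff)
    ultimately show ?thesis unfolding C by simp
  qed
  moreover have "\<forall>k\<in>C. poly Q k \<noteq> 0" unfolding C using e(2) Q0 Qx by auto
  ultimately have sep: "separated_values Q"
    using separated_values_iff[of Q] degQ by (simp add: C_def)
  define v where "v = map (\<lambda>i. (-1) ^ Suc i * coeff Q (N - i)) [0..<Suc N]"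
  have "poly_of_coords (Suc N) v = Q"
  proof (rule poly_eqI)
    fix r
    show "coeff (poly_of_coords (Suc N) v) r = coeff Q r"
    proof (cases "r < Suc N")
      case True
      then have "v ! (Suc N - r - 1) = (-1) ^ (Suc N - r) * coeff Q r"
        unfolding v_def by (subst nth_map) (auto simp: Suc_diff_le simp del: upt_Suc)
      then show ?thesis using True by (simp add: coeff_poly_of_coords power_mult_distrib[symmetric] mult.assoc[symmetric])
    next
      case False
      then show ?thesis using leadQ degQ by (auto simp: coeff_poly_of_coords coeff_eq_0)
    qed
  qed
  then have "v \<in> generic_coords (Suc N)" using sep by (simp add: generic_coords_def v_def)
  then show ?thesis by blast
qed

section \<open>Orbits in the fibres\<close>

definition point_of_list :: "complex list \<Rightarrow> nat \<Rightarrow> complex"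
  where "point_of_list \<kappa> = (\<lambda>i. if i < length \<kappa> then \<kappa> ! i else 0)"

lemma point_of_list_in_cn: "length \<kappa> = N \<Longrightarrow> point_of_list \<kappa> \<in> cn N"
  by (auto simp: point_of_list_def cn_def)

lemma sigma_tuple_eq: "length \<kappa> = N \<Longrightarrow> sigma_tuple l \<kappa> = esym l (point_of_list \<kappa>) {..<N}"
  unfolding sigma_tuple_def by (auto intro!: esym_cong simp: point_of_list_def)

lemma crit_poly_point_of_list:
  "length \<kappa> = N \<Longrightarrow> crit_poly N (point_of_list \<kappa>) = (\<Prod>k\<leftarrow>\<kappa>. [:- k, 1:])"
  by (simp add: crit_poly_def point_of_list_def prod.list_conv_set_nth atLeast0LessThan)

text \<open>
  The constant term is that of a monic polynomial of degree \<open>N + 1\<close> whose roots have product \<open>1\<close>.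
\<close>

definition normalized_poly :: "nat \<Rightarrow> (nat \<Rightarrow> complex) \<Rightarrow> complex poly"
  where "normalized_poly N x = crit_primitive N x + [:(-1) ^ Suc N:]"

lemma pderiv_normalized_poly:
  "pderiv (normalized_poly N x) = Polynomial.smult (of_nat (Suc N)) (crit_poly N x)"
  by (simp add: normalized_poly_def pderiv_add pderiv_pCons pderiv_crit_primitive del: of_nat_Suc)

lemma degree_normalized_poly: "degree (normalized_poly N x) = Suc N"
  unfolding normalized_poly_def by (subst degree_add_eq_left) (auto simp: degree_crit_primitive)

lemma lead_normalized_poly: "lead_coeff (normalized_poly N x) = 1"
  unfolding degree_normalized_poly by (simp add: normalized_poly_def lead_crit_primitive)

lemma poly_normalized_poly: "poly (normalized_poly N x) t = poly (crit_primitive N x) t + (-1) ^ Suc N"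
  by (simp add: normalized_poly_def)

lemma normalized_poly_rotate:
  "\<zeta> ^ Suc N = 1 \<Longrightarrow> poly (normalized_poly N (\<lambda>i. \<zeta> * x i)) (\<zeta> * t) = poly (normalized_poly N x) t"
  unfolding poly_normalized_poly poly_crit_primitive_scale by simp

lemma Upsilon_nth:
  assumes "length \<kappa> = N" "j < N"
  shows "Upsilon (Suc N) \<kappa> ! j = 1 + (-1) ^ Suc N * crit_value N j (point_of_list \<kappa>)"
proof -
  define x where "x = point_of_list \<kappa>"
  have xj: "x j = \<kappa> ! j" using assms by (simp add: x_def point_of_list_def)
  have set: "{..N} = insert 0 {1..N}" by auto
  have "poly (crit_primitive N x) (\<kappa> ! j) = \<kappa> ! j ^ Suc N +
      (\<Sum>l\<in>{1..N}. (-1) ^ l * (of_nat (Suc N) / of_nat (Suc N - l)) * esym l x {..<N} * \<kappa> ! j ^ (Suc N - l))"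
    unfolding poly_crit_primitive set by (subst sum.insert) (auto simp: esym_0 simp del: of_nat_Suc)
  then have "Upsilon (Suc N) \<kappa> ! j = (-1) ^ Suc N * (poly (crit_primitive N x) (\<kappa> ! j) + (-1) ^ Suc N)"
    using assms by (simp add: Upsilon_def sigma_tuple_eq[OF assms(1)] x_def del: of_nat_Suc power_Suc)
  also have "\<dots> = 1 + (-1) ^ Suc N * crit_value N j x"
    by (simp add: crit_value_def xj distrib_left power_mult_distrib[symmetric] del: power_Suc)
  finally show ?thesis by (simp only: x_def)
qed

lemma length_Upsilon [simp]: "length (Upsilon n \<kappa>) = length \<kappa>"
  by (simp add: Upsilon_def)

text \<open>
  The equation \<open>Upsilon (Suc N) \<kappa> = c\<close>, solved for the critical values of \<open>crit_primitive\<close>.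
\<close>

definition target_values :: "nat \<Rightarrow> complex list \<Rightarrow> nat \<Rightarrow> complex"
  where "target_values N c = (\<lambda>j. if j < N then (-1) ^ Suc N * (c ! j - 1) else 0)"

lemma Upsilon_eq_iff:
  assumes "length \<kappa> = N" "length c = N"
  shows "Upsilon (Suc N) \<kappa> = c \<longleftrightarrow> point_of_list \<kappa> \<in> crit_fibre N (target_values N c)"
proof -
  have s: "(-1) ^ Suc N * ((-1) ^ Suc N * z) = (z :: complex)" for z
    by (simp add: mult.assoc[symmetric] power_mult_distrib[symmetric] del: power_Suc)
  have "Upsilon (Suc N) \<kappa> = c \<longleftrightarrow> (\<forall>j<N. Upsilon (Suc N) \<kappa> ! j = c ! j)"
    using assms by (simp add: list_eq_iff_nth_eq)
  also have "\<dots> \<longleftrightarrow> (\<forall>j<N. crit_value N j (point_of_list \<kappa>) = (-1) ^ Suc N * (c ! j - 1))"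
  proof -
    have "1 + (-1) ^ Suc N * z = w \<longleftrightarrow> z = (-1) ^ Suc N * (w - 1)" for z w :: complex
      using s[of z] s[of "w - 1"] by (metis add_diff_cancel_left' add.commute diff_add_cancel)
    then show ?thesis using Upsilon_nth[OF assms(1)] by auto
  qed
  also have "\<dots> \<longleftrightarrow> point_of_list \<kappa> \<in> crit_fibre N (target_values N c)"
    using point_of_list_in_cn[OF assms(1)]
    by (auto simp: crit_fibre_def himg_def target_values_def fun_eq_iff)
  finally show ?thesis .
qed

lemma Q_poly_root_iff: "finite \<Lambda> \<Longrightarrow> poly (Q_poly \<Lambda>) z = 0 \<longleftrightarrow> z \<in> \<Lambda>"
  by (auto simp: Q_poly_def poly_prod)

lemma normalized_iff_sigma:
  assumes L: "\<Lambda> \<in> V_space (Suc N)" and len: "length \<kappa> = N"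
  shows "(\<forall>l\<in>{1..Suc N - 1}. sigma_set l \<Lambda> = of_nat (Suc N) / of_nat (Suc N - l) * sigma_tuple l \<kappa>) \<longleftrightarrow>
    Q_poly \<Lambda> = normalized_poly N (point_of_list \<kappa>)"
proof -
  define n where "n = Suc N"
  define x where "x = point_of_list \<kappa>"
  have fin: "finite \<Lambda>" "card \<Lambda> = n" and p1: "(\<Prod>l\<in>\<Lambda>. l) = 1"
    using L by (auto simp: V_space_def root_sets_def n_def)
  have cQ: "coeff (Q_poly \<Lambda>) r = (if r \<le> n then (-1) ^ (n - r) * sigma_set (n - r) \<Lambda> else 0)" for r
  proof -
    have "coeff (Q_poly \<Lambda>) r = (\<Sum>l\<le>n. if l = n - r \<and> r \<le> n then (-1) ^ (n - r) * sigma_set (n - r) \<Lambda> else 0)"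
      unfolding Q_poly_esym[OF fin] coeff_sum coeff_monom by (intro sum.cong) auto
    also have "\<dots> = (if r \<le> n then (-1) ^ (n - r) * sigma_set (n - r) \<Lambda> else 0)"
      by (cases "r \<le> n") (auto simp: sum.delta)
    finally show ?thesis .
  qed
  have sn: "sigma_set n \<Lambda> = 1"
  proof -
    have "{I. I \<subseteq> \<Lambda> \<and> card I = n} = {\<Lambda>}" using fin card_subset_eq[OF fin(1)] by auto
    then show ?thesis using p1 by (simp add: sigma_set_def esym_def)
  qed
  have s0: "sigma_set 0 \<Lambda> = 1" using esym_0[OF fin(1)] by (simp add: sigma_set_def)
  have cN: "coeff (normalized_poly N x) r = (if r = 0 then (-1) ^ n else if r \<le> n then
     (-1) ^ (n - r) * (of_nat n / of_nat r) * esym (n - r) x {..<N} else 0)" for r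
    by (auto simp: normalized_poly_def coeff_crit_primitive n_def coeff_pCons split: nat.split simp del: of_nat_Suc power_Suc)
  have "Q_poly \<Lambda> = normalized_poly N x \<longleftrightarrow> (\<forall>r. coeff (Q_poly \<Lambda>) r = coeff (normalized_poly N x) r)"
    by (simp add: poly_eq_iff)
  also have "\<dots> \<longleftrightarrow> (\<forall>r\<in>{1..N}. sigma_set (n - r) \<Lambda> = of_nat n / of_nat r * esym (n - r) x {..<N})"
  proof
    assume R: "\<forall>r. coeff (Q_poly \<Lambda>) r = coeff (normalized_poly N x) r"
    show "\<forall>r\<in>{1..N}. sigma_set (n - r) \<Lambda> = of_nat n / of_nat r * esym (n - r) x {..<N}"
    proof
      fix r assume r: "r \<in> {1..N}"
      then have "(-1) ^ (n - r) * sigma_set (n - r) \<Lambda> = (-1) ^ (n - r) * (of_nat n / of_nat r * esym (n - r) x {..<N})"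
        using R[rule_format, of r] unfolding cQ cN by (simp add: n_def mult.assoc del: of_nat_Suc)
      then show "sigma_set (n - r) \<Lambda> = of_nat n / of_nat r * esym (n - r) x {..<N}"
        by (simp only: mult_cancel_left) simp
    qed
  next
    assume R: "\<forall>r\<in>{1..N}. sigma_set (n - r) \<Lambda> = of_nat n / of_nat r * esym (n - r) x {..<N}"
    show "\<forall>r. coeff (Q_poly \<Lambda>) r = coeff (normalized_poly N x) r"
    proof
      fix r
      consider "r = 0" | "r \<in> {1..N}" | "r = n" | "r > n" by (fastforce simp: n_def)
      then show "coeff (Q_poly \<Lambda>) r = coeff (normalized_poly N x) r"
      proof cases
        case 1
        show ?thesis unfolding cQ cN 1 by (simp add: sn)
      next
        case 2
        then have "r \<le> n" "r \<noteq> 0" by (auto simp: n_def)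
        then show ?thesis unfolding cQ cN using R 2 by (simp add: mult.assoc del: of_nat_Suc)
      next
        case 3
        then show ?thesis unfolding cQ cN by (simp add: s0 esym_0 n_def del: of_nat_Suc)
      qed (simp_all add: cQ cN del: of_nat_Suc power_Suc)
    qed
  qed
  also have "\<dots> \<longleftrightarrow> (\<forall>l\<in>{1..N}. sigma_set l \<Lambda> = of_nat n / of_nat (n - l) * esym l x {..<N})"
  proof -
    have "(\<forall>r\<in>{1..N}. P (n - r) r) \<longleftrightarrow> (\<forall>l\<in>{1..N}. P l (n - l))" for P
    proof
      assume R: "\<forall>r\<in>{1..N}. P (n - r) r"
      show "\<forall>l\<in>{1..N}. P l (n - l)"
      proof
        fix l assume "l \<in> {1..N}"
        then have "n - l \<in> {1..N}" "n - (n - l) = l" by (auto simp: n_def)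
        then show "P l (n - l)" using R by metis
      qed
    next
      assume R: "\<forall>l\<in>{1..N}. P l (n - l)"
      show "\<forall>r\<in>{1..N}. P (n - r) r"
      proof
        fix l assume "l \<in> {1..N}"
        then have "n - l \<in> {1..N}" "n - (n - l) = l" by (auto simp: n_def)
        then show "P (n - l) l" using R by metis
      qed
    qed
    from this[of "\<lambda>l r. sigma_set l \<Lambda> = of_nat n / of_nat r * esym l x {..<N}"] show ?thesis .
  qed
  finally show ?thesis unfolding n_def x_def by (simp add: sigma_tuple_eq[OF len] del: of_nat_Suc)
qed

text \<open>
  This translates the fibres of \<open>Upsilon\<close>, which consist of sets of roots, into fibres of the critical value
  map, which consist of ordered critical points.
\<close>

lemma Upsilon_fiber_eq:
  assumes c: "length c = N"
  shows "Upsilon_fiber (Suc N) c =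
    {\<Lambda> \<in> V_space (Suc N). \<exists>x\<in>crit_fibre N (target_values N c). Q_poly \<Lambda> = normalized_poly N x}"
proof (intro equalityI subsetI)
  fix \<Lambda> assume "\<Lambda> \<in> Upsilon_fiber (Suc N) c"
  then obtain \<kappa> where \<kappa>: "\<Lambda> \<in> V_space (Suc N)" "length \<kappa> = N"
    "\<forall>l\<in>{1..Suc N - 1}. sigma_set l \<Lambda> = of_nat (Suc N) / of_nat (Suc N - l) * sigma_tuple l \<kappa>"
    "Upsilon (Suc N) \<kappa> = c" by (auto simp: Upsilon_fiber_def simp del: of_nat_Suc)
  have "Q_poly \<Lambda> = normalized_poly N (point_of_list \<kappa>)" using normalized_iff_sigma[OF \<kappa>(1,2)] \<kappa>(3) by blast
  moreover have "point_of_list \<kappa> \<in> crit_fibre N (target_values N c)" using Upsilon_eq_iff[OF \<kappa>(2) c] \<kappa>(4) by blast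
  ultimately show "\<Lambda> \<in> {\<Lambda> \<in> V_space (Suc N). \<exists>x\<in>crit_fibre N (target_values N c). Q_poly \<Lambda> = normalized_poly N x}"
    using \<kappa>(1) by blast
next
  fix \<Lambda> assume "\<Lambda> \<in> {\<Lambda> \<in> V_space (Suc N). \<exists>x\<in>crit_fibre N (target_values N c). Q_poly \<Lambda> = normalized_poly N x}"
  then obtain x where x: "\<Lambda> \<in> V_space (Suc N)" "x \<in> crit_fibre N (target_values N c)" "Q_poly \<Lambda> = normalized_poly N x" by blast
  define \<kappa> where "\<kappa> = map x [0..<N]"
  have len: "length \<kappa> = N" by (simp add: \<kappa>_def)
  have px: "point_of_list \<kappa> = x" using x(2) by (auto simp: point_of_list_def \<kappa>_def crit_fibre_def cn_def fun_eq_iff)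
  have "\<forall>l\<in>{1..Suc N - 1}. sigma_set l \<Lambda> = of_nat (Suc N) / of_nat (Suc N - l) * sigma_tuple l \<kappa>"
    using normalized_iff_sigma[OF x(1) len] x(3) px by blast
  moreover have "Upsilon (Suc N) \<kappa> = c" using Upsilon_eq_iff[OF len c] x(2) px by simp
  ultimately show "\<Lambda> \<in> Upsilon_fiber (Suc N) c"
    unfolding Upsilon_fiber_def using x(1) len by (intro CollectI conjI exI[of _ \<kappa>]) auto
qed

text \<open>
  Choose for each orbit of a finite set of orbits a root set in it and a critical vector of this root set.
  Two of these vectors that are rotations of each other would belong to rotated root sets, that is, to the
  same orbit; so \<open>inequivalent_points_bound\<close> applies. The resulting bound is uniform over finite sets of
  orbits, hence there are only finitely many orbits.
\<close>

lemma orbit_count_upper: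
  assumes N: "N > 0" and c: "length c = N"
  shows "finite (fiber_orbits (Suc N) c) \<and> card (fiber_orbits (Suc N) c) \<le> Suc N ^ (N - 1)"
proof (rule finite_if_finite_subsets_card_bdd)
  fix O' assume O': "O' \<subseteq> fiber_orbits (Suc N) c" "finite O'"
  define e where "e = target_values N c"
  have "\<forall>w\<in>O'. \<exists>Lx. fst Lx \<in> V_space (Suc N) \<and> w = Zn_orbit (Suc N) (fst Lx) \<and> snd Lx \<in> crit_fibre N e \<and>
      Q_poly (fst Lx) = normalized_poly N (snd Lx)"
    using O'(1) unfolding fiber_orbits_def Upsilon_fiber_eq[OF c] e_def by fastforce
  from bchoice[OF this] obtain Lx where Lx: "\<And>w. w \<in> O' \<Longrightarrow> fst (Lx w) \<in> V_space (Suc N)"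
    "\<And>w. w \<in> O' \<Longrightarrow> w = Zn_orbit (Suc N) (fst (Lx w))" "\<And>w. w \<in> O' \<Longrightarrow> snd (Lx w) \<in> crit_fibre N e"
    "\<And>w. w \<in> O' \<Longrightarrow> Q_poly (fst (Lx w)) = normalized_poly N (snd (Lx w))" by blast
  have key: "w = w'" if w: "w \<in> O'" "w' \<in> O'" and z: "\<zeta> ^ Suc N = 1" and
    eq: "(\<lambda>i. \<zeta> * snd (Lx w) i) = snd (Lx w')" for w w' \<zeta>
  proof -
    have z0: "\<zeta> \<noteq> 0" using z by auto
    have fin: "finite (fst (Lx w))" "finite (fst (Lx w'))"
      using Lx(1) w by (auto simp: V_space_def root_sets_def)
    have iff: "\<zeta> * t \<in> fst (Lx w') \<longleftrightarrow> t \<in> fst (Lx w)" for t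
      unfolding Q_poly_root_iff[OF fin(1), symmetric] Q_poly_root_iff[OF fin(2), symmetric]
        Lx(4)[OF w(1)] Lx(4)[OF w(2)] eq[symmetric] normalized_poly_rotate[OF z] ..
    have "fst (Lx w') = (\<lambda>t. \<zeta> * t) ` fst (Lx w)"
    proof (intro equalityI subsetI)
      fix u assume u: "u \<in> fst (Lx w')"
      have "u = \<zeta> * (u / \<zeta>)" using z0 by simp
      then show "u \<in> (\<lambda>t. \<zeta> * t) ` fst (Lx w)" using u iff by (metis image_eqI)
    qed (use iff in auto)
    then show "w = w'" using Lx(2)[OF w(1)] Lx(2)[OF w(2)] Zn_orbit_rotate[OF z] by simp
  qed
  have inj: "inj_on (\<lambda>w. snd (Lx w)) O'"
  proof (rule inj_onI)
    fix w w' assume "w \<in> O'" "w' \<in> O'" "snd (Lx w) = snd (Lx w')"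
    then show "w = w'" using key[of w w' 1] by simp
  qed
  have "card ((\<lambda>w. snd (Lx w)) ` O') * Suc N \<le> Suc N ^ N"
  proof (rule inequivalent_points_bound[OF N])
    show "(\<lambda>w. snd (Lx w)) ` O' \<subseteq> crit_fibre N e" using Lx(3) by auto
    fix a b \<zeta> assume "a \<in> (\<lambda>w. snd (Lx w)) ` O'" "b \<in> (\<lambda>w. snd (Lx w)) ` O'" "\<zeta> ^ Suc N = 1" "(\<lambda>i. \<zeta> * a i) = b"
    moreover from this obtain w w' where "w \<in> O'" "w' \<in> O'" "a = snd (Lx w)" "b = snd (Lx w')" by blast
    ultimately show "a = b" using key[of w w' \<zeta>] by simp
  qed (use O' in auto)
  then have "card O' * Suc N \<le> Suc N ^ (N - 1) * Suc N"
    by (simp only: card_image[OF inj] power_minus_mult[OF N])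
  then show "card O' \<le> Suc N ^ (N - 1)" by (simp only: mult_le_cancel2)
qed

text \<open>
  The \<open>(N + 1)\<^sup>N\<close> critical vectors over the value have pairwise distinct sets of roots: the values at
  the critical points are pairwise distinct, so they determine the order of the critical points. An orbit
  contains at most \<open>N + 1\<close> of these sets.
\<close>

lemma orbit_count_lower:
  assumes N: "N > 0" and c: "length c = N" and d: "crit_disc N (target_values N c) \<noteq> 0"
  shows "Suc N ^ (N - 1) \<le> card (fiber_orbits (Suc N) c)"
proof -
  define n where "n = Suc N"
  define e where "e = target_values N c"
  have ecn: "e \<in> cn N" by (simp add: e_def target_values_def cn_def)
  have e: "\<And>j. j < N \<Longrightarrow> e j \<noteq> 0" "\<And>j. j < N \<Longrightarrow> e j + (-1) ^ Suc N \<noteq> 0" "inj_on e {..<N}"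
    using d by (auto simp: crit_disc_nonzero_iff e_def)
  have cardX: "card (crit_fibre N e) = n ^ N" "finite (crit_fibre N e)"
    using card_crit_fibre[OF ecn] d by (auto simp: e_def n_def)
  have val: "poly (crit_primitive N x) (x j) = e j" if "x \<in> crit_fibre N e" "j < N" for x j
  proof -
    have "himg N (crit_value N) x j = e j" using that(1) by (simp add: crit_fibre_def)
    then show ?thesis using that(2) by (simp add: himg_def crit_value_def)
  qed
  define L where "L = (\<lambda>x. {z. poly (normalized_poly N x) z = 0})"
  have QL: "Q_poly (L x) = normalized_poly N x" if x: "x \<in> crit_fibre N e" for x
  proof -
    have "rsquarefree (normalized_poly N x)"
      unfolding rsquarefree_roots
    proof (intro allI notI)
      fix z assume z: "poly (normalized_poly N x) z = 0 \<and> poly (pderiv (normalized_poly N x)) z = 0"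
      then obtain j where j: "j < N" "z = x j"
        by (auto simp: pderiv_normalized_poly poly_crit_poly_eq_0_iff simp del: of_nat_Suc)
      then have "e j + (-1) ^ Suc N = 0" using z val[OF x j(1)] by (simp add: poly_normalized_poly)
      then show False using e(2)[OF j(1)] by simp
    qed
    from complex_poly_decompose_rsquarefree[OF this]
    show ?thesis by (simp add: Q_poly_def L_def lead_normalized_poly)
  qed
  have LV: "L x \<in> V_space n" if x: "x \<in> crit_fibre N e" for x
  proof -
    have nz: "normalized_poly N x \<noteq> 0" using degree_normalized_poly[of N x] by auto
    have fin: "finite (L x)" unfolding L_def by (rule poly_roots_finite[OF nz])
    have "degree (Q_poly (L x)) = card (L x)"
      unfolding Q_poly_def by (subst degree_prod_eq_sum_degree) auto
    then have cd: "card (L x) = n" by (simp add: QL[OF x] degree_normalized_poly n_def)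
    have p0: "poly (normalized_poly N x) 0 = (-1) ^ n"
      by (simp add: poly_normalized_poly crit_primitive_0 n_def)
    have "0 \<notin> L x" unfolding L_def using p0 by simp
    have "poly (Q_poly (L x)) 0 = (-1) ^ n * (\<Prod>l\<in>L x. l)"
    proof -
      have "poly (Q_poly (L x)) 0 = (\<Prod>l\<in>L x. (-1) * l)" by (simp add: Q_poly_def poly_prod)
      also have "\<dots> = (-1) ^ n * (\<Prod>l\<in>L x. l)" unfolding prod.distrib by (simp add: cd)
      finally show ?thesis .
    qed
    then have "(-1) ^ n * (\<Prod>l\<in>L x. l) = (-1) ^ n * 1" using QL[OF x] p0 by simp
    then have "(\<Prod>l\<in>L x. l) = 1" by (simp only: mult_cancel_left) simp
    then show ?thesis using fin cd \<open>0 \<notin> L x\<close> by (simp add: V_space_def root_sets_def)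
  qed
  have LF: "L ` crit_fibre N e \<subseteq> Upsilon_fiber n c"
    unfolding n_def Upsilon_fiber_eq[OF c] using LV QL by (auto simp: n_def e_def)
  have injL: "inj_on L (crit_fibre N e)"
  proof (rule inj_onI)
    fix x y assume xy: "x \<in> crit_fibre N e" "y \<in> crit_fibre N e" "L x = L y"
    have eq: "normalized_poly N x = normalized_poly N y" using QL[OF xy(1)] QL[OF xy(2)] xy(3) by simp
    then have R: "crit_primitive N x = crit_primitive N y" by (simp add: normalized_poly_def)
    have W: "crit_poly N x = crit_poly N y"
    proof -
      have "Polynomial.smult (of_nat (Suc N)) (crit_poly N x - crit_poly N y) = 0"
        using arg_cong[OF eq, of pderiv] unfolding pderiv_normalized_poly smult_diff_right by simp
      then show ?thesis unfolding smult_eq_0_iff of_nat_eq_0_iff by simp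
    qed
    show "x = y"
    proof (rule cn_eqI[of _ N])
      show "x \<in> cn N" "y \<in> cn N" using xy by (auto simp: crit_fibre_def)
      fix j assume j: "j < N"
      have "poly (crit_poly N x) (x j) = 0" using j by (auto simp: poly_crit_poly_eq_0_iff)
      then obtain i where i: "i < N" "x j = y i" unfolding W by (auto simp: poly_crit_poly_eq_0_iff)
      have "e j = e i" using val[OF xy(1) j] val[OF xy(2) i(1)] R i(2) by simp
      then have "j = i" using e(3) i j by (auto dest: inj_onD)
      then show "x j = y j" using i by simp
    qed
  qed
  have finO: "finite (fiber_orbits n c)" using orbit_count_upper[OF N c] by (simp add: n_def)
  have n0: "n > 0" by (simp add: n_def)
  have U: "card {z :: complex. z ^ n = 1} = n" by (rule card_roots_unity_eq[OF n0])
  then have fU: "finite {z :: complex. z ^ n = 1}" using n0 by (metis card_ge_0_finite)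
  have orb: "finite (Zn_orbit n \<Lambda>) \<and> card (Zn_orbit n \<Lambda>) \<le> n" for \<Lambda>
  proof -
    have "Zn_orbit n \<Lambda> = (\<lambda>\<zeta>. (\<lambda>z. \<zeta> * z) ` \<Lambda>) ` {z. z ^ n = 1}" by (auto simp: Zn_orbit_def)
    then show ?thesis using U fU card_image_le[OF fU] by simp
  qed
  have sub: "Upsilon_fiber n c \<subseteq> \<Union> (fiber_orbits n c)"
    using Zn_orbit_self by (auto simp: fiber_orbits_def)
  have finU: "finite (\<Union> (fiber_orbits n c))"
    using finO orb by (auto simp: fiber_orbits_def)
  have "n ^ N = card (L ` crit_fibre N e)" using cardX card_image[OF injL] by simp
  also have "\<dots> \<le> card (\<Union> (fiber_orbits n c))"
    by (rule card_mono[OF finU]) (use LF sub in blast)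
  also have "\<dots> \<le> (\<Sum>w\<in>fiber_orbits n c. card w)"
    using card_Union_le_sum_card[of "fiber_orbits n c"] by simp
  also have "\<dots> \<le> card (fiber_orbits n c) * n"
    using sum_bounded_above[of "fiber_orbits n c" card n] orb by (auto simp: fiber_orbits_def)
  finally have "n ^ (N - 1) * n \<le> card (fiber_orbits n c) * n" by (simp only: power_minus_mult[OF N])
  then show ?thesis unfolding n_def by (simp only: mult_le_cancel2)
qed

text \<open>
  On a fibre the set of leading coefficients depends on \<open>c\<close> only. A critical point \<open>0\<close>, which is left out
  of \<open>polar_coeffs\<close>, would contribute the value \<open>rho0 \<Lambda>\<close>, which is included separately.
\<close>

lemma critical_values_of_fiber:
  assumes c: "length c = N" and L: "\<Lambda> \<in> Upsilon_fiber (Suc N) c"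
  shows "insert (rho0 \<Lambda>) (polar_coeffs \<Lambda>) = (\<lambda>w. (-1) ^ Suc N * w) ` insert 1 (set c)"
    and "rho0 \<Lambda> = (-1) ^ Suc N"
proof -
  obtain x where x: "\<Lambda> \<in> V_space (Suc N)" "x \<in> crit_fibre N (target_values N c)" "Q_poly \<Lambda> = normalized_poly N x"
    using L unfolding Upsilon_fiber_eq[OF c] by blast
  show rho: "rho0 \<Lambda> = (-1) ^ Suc N"
    using x(1) by (simp add: rho0_def V_space_def root_sets_def)
  have s: "(-1) ^ Suc N * ((-1) ^ Suc N * z) = (z :: complex)" for z
    by (simp add: mult.assoc[symmetric] power_mult_distrib[symmetric] del: power_Suc)
  have Q0: "poly (Q_poly \<Lambda>) 0 = (-1) ^ Suc N"
    by (simp add: x(3) poly_normalized_poly crit_primitive_0)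
  have Qx: "poly (Q_poly \<Lambda>) (x j) = (-1) ^ Suc N * c ! j" if j: "j < N" for j
  proof -
    have "poly (crit_primitive N x) (x j) = (-1) ^ Suc N * (c ! j - 1)"
    proof -
      have "himg N (crit_value N) x j = target_values N c j" using x(2) by (simp add: crit_fibre_def)
      then show ?thesis using j by (simp add: himg_def crit_value_def target_values_def)
    qed
    then show ?thesis by (simp add: x(3) poly_normalized_poly right_diff_distrib del: power_Suc)
  qed
  have "insert (rho0 \<Lambda>) (polar_coeffs \<Lambda>) = insert ((-1) ^ Suc N) (poly (Q_poly \<Lambda>) ` x ` {..<N})"
  proof -
    have "polar_coeffs \<Lambda> = poly (Q_poly \<Lambda>) ` (x ` {..<N} - {0})"
      by (auto simp: polar_coeffs_def x(3) pderiv_normalized_poly poly_crit_poly_eq_0_iff simp del: of_nat_Suc)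
    then show ?thesis using rho Q0 by (auto simp: image_iff)
  qed
  also have "poly (Q_poly \<Lambda>) ` x ` {..<N} = (\<lambda>w. (-1) ^ Suc N * w) ` set c"
    using Qx c by (auto simp: set_conv_nth image_iff)
  finally show "insert (rho0 \<Lambda>) (polar_coeffs \<Lambda>) = (\<lambda>w. (-1) ^ Suc N * w) ` insert 1 (set c)" by simp
qed

text \<open>
  The roots need not have product \<open>1\<close>. Dividing by an \<open>(N + 1)\<close>-st root \<open>\<mu>\<close> of their product
  normalizes them; it divides the critical points by \<open>\<mu>\<close> and leaves the quotients of the critical values by
  \<open>rho0 \<Lambda>\<close> unchanged.
\<close>

lemma generic_HP_tuple:
  assumes N: "N > 0" and L: "\<Lambda> \<in> root_sets (Suc N)" and sep: "separated_values (Q_poly \<Lambda>)"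
    and \<kappa>: "critical_tuple \<Lambda> \<kappa>"
  shows "length (HP_tuple \<Lambda> \<kappa>) = N" "HP_tuple \<Lambda> \<kappa> \<in> HP_III (Suc N)"
    "crit_disc N (target_values N (HP_tuple \<Lambda> \<kappa>)) \<noteq> 0"
proof -
  have fin: "finite \<Lambda>" "card \<Lambda> = Suc N" "0 \<notin> \<Lambda>" using L by (auto simp: root_sets_def)
  have degQ: "degree (Q_poly \<Lambda>) = Suc N"
    unfolding Q_poly_def by (subst degree_prod_eq_sum_degree) (auto simp: fin)
  have pd: "pderiv (Q_poly \<Lambda>) = Polynomial.smult (of_nat (Suc N)) (\<Prod>k\<leftarrow>\<kappa>. [:- k, 1:])"
    using \<kappa> fin by (simp add: critical_tuple_def del: of_nat_Suc)
  have deg_list: "degree (\<Prod>k\<leftarrow>\<kappa>. [:- k, 1::complex:]) = length \<kappa> \<and> (\<Prod>k\<leftarrow>\<kappa>. [:- k, 1::complex:]) \<noteq> 0" for \<kappa>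
    by (induction \<kappa>) (auto simp: degree_mult_eq simp del: mult_pCons_left)
  have len: "length \<kappa> = N"
  proof -
    have "N = degree (pderiv (Q_poly \<Lambda>))" by (simp add: degree_pderiv degQ)
    also have "\<dots> = length \<kappa>" unfolding pd using deg_list by (simp del: of_nat_Suc)
    finally show ?thesis by simp
  qed
  define x where "x = point_of_list \<kappa>"
  have xk: "x j = \<kappa> ! j" if "j < N" for j using that len by (simp add: x_def point_of_list_def)
  define \<rho> where "\<rho> = rho0 \<Lambda>"
  have rho: "\<rho> = poly (Q_poly \<Lambda>) 0"
  proof -
    have "poly (Q_poly \<Lambda>) 0 = (\<Prod>l\<in>\<Lambda>. (-1) * l)" by (simp add: Q_poly_def poly_prod)
    then show ?thesis unfolding prod.distrib by (simp add: \<rho>_def rho0_def)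
  qed
  have Q: "Q_poly \<Lambda> = crit_primitive N x + [:\<rho>:]"
  proof -
    define P where "P = Q_poly \<Lambda> - crit_primitive N x"
    have "pderiv P = 0"
      by (simp add: P_def pderiv_diff pd pderiv_crit_primitive crit_poly_point_of_list[OF len] x_def del: of_nat_Suc)
    then obtain a where a: "P = [:a:]" by (metis pderiv_iszero)
    have "a = poly P 0" by (simp add: a)
    also have "\<dots> = \<rho>" by (simp add: P_def rho crit_primitive_0)
    finally show ?thesis using a by (simp add: P_def algebra_simps)
  qed
  define C where "C = {k. poly (pCons 0 (pderiv (Q_poly \<Lambda>))) k = 0}"
  have C: "card C = Suc N" "inj_on (poly (Q_poly \<Lambda>)) C" "\<And>k. k \<in> C \<Longrightarrow> poly (Q_poly \<Lambda>) k \<noteq> 0"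
    using separated_values_iff[of "Q_poly \<Lambda>"] sep degQ by (auto simp: C_def)
  have C_eq: "C = insert 0 (x ` {..<N})"
    unfolding C_def pd crit_poly_point_of_list[OF len, symmetric] x_def[symmetric]
    by (auto simp: poly_crit_poly_eq_0_iff simp del: of_nat_Suc)
  have cx: "card (x ` {..<N}) \<le> N" using card_image_le[of "{..<N}" x] by simp
  have nz: "0 \<notin> x ` {..<N}"
  proof
    assume "0 \<in> x ` {..<N}"
    then have "C = x ` {..<N}" using C_eq by auto
    then show False using C(1) cx by simp
  qed
  have cx': "card (x ` {..<N}) = card {..<N}" using C(1) nz by (simp add: C_eq)
  have injx: "inj_on x {..<N}" by (rule eq_card_imp_inj_on[OF _ cx']) simp
  have rho0: "\<rho> \<noteq> 0" using C(3)[of 0] by (simp add: C_eq rho)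
  obtain \<mu> where mu: "\<mu> ^ Suc N = (\<Prod>l\<in>\<Lambda>. l)" using exists_complex_root[of "Suc N" "\<Prod>l\<in>\<Lambda>. l"] by (metis nat.distinct(2))
  have rho_mu: "\<rho> = (-1) ^ Suc N * \<mu> ^ Suc N" by (simp add: \<rho>_def rho0_def fin mu del: power_Suc)
  have mu0: "\<mu> \<noteq> 0" using rho_mu rho0 by auto
  \<comment> \<open>the critical points of the normalized polynomial\<close>
  define \<kappa>' where "\<kappa>' = map (\<lambda>k. (1 / \<mu>) * k) \<kappa>"
  have len': "length \<kappa>' = N" by (simp add: \<kappa>'_def len)
  have pk': "point_of_list \<kappa>' = (\<lambda>i. (1 / \<mu>) * x i)"
    by (auto simp: \<kappa>'_def x_def point_of_list_def)
  have sgn: "(-1) ^ Suc N * ((-1) ^ Suc N * z) = (z :: complex)" for z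
    by (simp add: mult.assoc[symmetric] power_mult_distrib[symmetric] del: power_Suc)
  have HPj: "HP_tuple \<Lambda> \<kappa> ! j = 1 + crit_value N j x / \<rho>" if j: "j < N" for j
  proof -
    have "HP_tuple \<Lambda> \<kappa> ! j = poly (Q_poly \<Lambda>) (x j) / \<rho>"
      using j by (simp add: HP_tuple_def \<rho>_def xk len)
    also have "\<dots> = (crit_value N j x + \<rho>) / \<rho>" by (simp add: Q crit_value_def)
    also have "\<dots> = 1 + crit_value N j x / \<rho>" using rho0 by (simp add: field_simps)
    finally show ?thesis .
  qed
  have scal: "crit_value N j (\<lambda>i. (1 / \<mu>) * x i) = (-1) ^ Suc N * (crit_value N j x / \<rho>)" for j
  proof -
    have "crit_value N j (\<lambda>i. (1 / \<mu>) * x i) = crit_value N j x / \<mu> ^ Suc N"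
      unfolding crit_value_scale power_divide by simp
    also have "\<mu> ^ Suc N = (-1) ^ Suc N * \<rho>" by (simp only: rho_mu sgn)
    also have "crit_value N j x / ((-1) ^ Suc N * \<rho>) = (-1) ^ Suc N * (crit_value N j x / \<rho>)"
      by (cases "even N") auto
    finally show ?thesis .
  qed
  show lenHP: "length (HP_tuple \<Lambda> \<kappa>) = N" by (simp add: HP_tuple_def len)
  have "Upsilon (Suc N) \<kappa>' = HP_tuple \<Lambda> \<kappa>"
  proof (rule nth_equalityI)
    fix j assume "j < length (Upsilon (Suc N) \<kappa>')"
    then have j: "j < N" by (simp add: len')
    show "Upsilon (Suc N) \<kappa>' ! j = HP_tuple \<Lambda> \<kappa> ! j"
      unfolding Upsilon_nth[OF len' j] pk' scal sgn HPj[OF j] ..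
  qed (simp add: len' lenHP)
  then show "HP_tuple \<Lambda> \<kappa> \<in> HP_III (Suc N)"
    unfolding HP_III_def using len' by (intro image_eqI[of _ _ \<kappa>']) auto
  define t where "t = target_values N (HP_tuple \<Lambda> \<kappa>)"
  have tj: "t j = (-1) ^ Suc N * (crit_value N j x / \<rho>)" if "j < N" for j
    using that by (simp add: t_def target_values_def HPj del: power_Suc)
  have cv: "crit_value N j x = poly (Q_poly \<Lambda>) (x j) - \<rho>" for j by (simp add: crit_value_def Q)
  have "inj_on t {..<N}"
  proof (rule inj_onI)
    fix i j assume ij: "i \<in> {..<N}" "j \<in> {..<N}" "t i = t j"
    then have "crit_value N i x = crit_value N j x" using tj[of i] tj[of j] rho0 by simp
    then have "poly (Q_poly \<Lambda>) (x i) = poly (Q_poly \<Lambda>) (x j)" by (simp add: cv)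
    then have "x i = x j" using C(2) ij by (auto simp: C_eq dest!: inj_onD)
    then show "i = j" using injx ij by (auto dest: inj_onD)
  qed
  moreover have "t j \<noteq> 0" if j: "j < N" for j
  proof
    assume "t j = 0"
    then have "crit_value N j x = 0" using tj[OF j] rho0 by simp
    then have "poly (Q_poly \<Lambda>) (x j) = poly (Q_poly \<Lambda>) 0" by (simp add: cv rho)
    then have "x j = 0" by (rule inj_onD[OF C(2)]) (use j in \<open>auto simp: C_eq\<close>)
    then show False using nz j by (metis image_eqI lessThan_iff)
  qed
  moreover have "t j + (-1) ^ Suc N \<noteq> 0" if j: "j < N" for j
  proof
    assume "t j + (-1) ^ Suc N = 0"
    then have "(-1) ^ Suc N * (crit_value N j x / \<rho> + 1) = 0"
      using tj[OF j] by (simp add: distrib_left del: power_Suc)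
    then have "crit_value N j x / \<rho> + 1 = 0" by simp
    then have "poly (Q_poly \<Lambda>) (x j) = 0" using rho0 by (simp add: cv field_simps)
    then show False using C(3)[of "x j"] j by (auto simp: C_eq)
  qed
  ultimately show "crit_disc N (target_values N (HP_tuple \<Lambda> \<kappa>)) \<noteq> 0"
    by (simp add: crit_disc_nonzero_iff t_def[symmetric] del: power_Suc)
qed

lemma bij_betw_images:
  assumes "\<And>a b. a \<in> T \<Longrightarrow> b \<in> T \<Longrightarrow> f a = f b \<longleftrightarrow> g a = g b"
  shows "\<exists>F. bij_betw F (f ` T) (g ` T) \<and> (\<forall>a\<in>T. F (f a) = g a)"
proof -
  define F where "F = (\<lambda>y. g (SOME a. a \<in> T \<and> f a = y))"
  have F: "F (f a) = g a" if "a \<in> T" for a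
  proof -
    have "(SOME b. b \<in> T \<and> f b = f a) \<in> T \<and> f (SOME b. b \<in> T \<and> f b = f a) = f a"
      by (rule someI[of _ a]) (use that in auto)
    then show ?thesis using assms that unfolding F_def by metis
  qed
  have "bij_betw F (f ` T) (g ` T)"
    by (rule bij_betw_imageI) (use F assms in \<open>auto simp: inj_on_def image_image\<close>)
  then show ?thesis using F by blast
qed

theorem theorem4p4:
  fixes p q n d :: nat
  assumes "1 < p" and "p < q" and "coprime p q" and "n \<ge> 2" and "d = n * p * q"
  shows "(\<forall>c\<in>HP_III n.
      germs_with_HP p q n c \<subseteq> H_pq p q d
    \<and> (\<forall>\<Lambda>\<in>Upsilon_fiber n c. \<forall>\<Lambda>'\<in>Upsilon_fiber n c. same_HP_invariant p q n \<Lambda> \<Lambda>')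
    \<and> (\<exists>F. bij_betw F (fiber_orbits n c) (analytic_types_with_HP p q n c)
          \<and> (\<forall>\<Lambda>\<in>Upsilon_fiber n c. F (Zn_orbit n \<Lambda>) = analytic_type (qh_poly p q \<Lambda>)))
    \<and> finite (analytic_types_with_HP p q n c)
    \<and> finite (fiber_orbits n c)
    \<and> card (analytic_types_with_HP p q n c) = card (fiber_orbits n c)
    \<and> card (fiber_orbits n c) \<le> n ^ (n - 2))
  \<and> generic_in_Z n (\<lambda>\<Lambda>. \<forall>\<kappa>. critical_tuple \<Lambda> \<kappa> \<longrightarrow>
      HP_tuple \<Lambda> \<kappa> \<in> HP_III n \<and> card (fiber_orbits n (HP_tuple \<Lambda> \<kappa>)) = n ^ (n - 2))"
proof
  define N where "N = n - 1"
  have n: "n = Suc N" and N: "N > 0" and n2: "n - 2 = N - 1" using assms(4) by (auto simp: N_def)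
  have n0: "n > 0" using n by simp
  show "\<forall>c\<in>HP_III n.
      germs_with_HP p q n c \<subseteq> H_pq p q d
    \<and> (\<forall>\<Lambda>\<in>Upsilon_fiber n c. \<forall>\<Lambda>'\<in>Upsilon_fiber n c. same_HP_invariant p q n \<Lambda> \<Lambda>')
    \<and> (\<exists>F. bij_betw F (fiber_orbits n c) (analytic_types_with_HP p q n c)
          \<and> (\<forall>\<Lambda>\<in>Upsilon_fiber n c. F (Zn_orbit n \<Lambda>) = analytic_type (qh_poly p q \<Lambda>)))
    \<and> finite (analytic_types_with_HP p q n c)
    \<and> finite (fiber_orbits n c)
    \<and> card (analytic_types_with_HP p q n c) = card (fiber_orbits n c)
    \<and> card (fiber_orbits n c) \<le> n ^ (n - 2)"
  proof
    fix c assume "c \<in> HP_III n"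
    then have c: "length c = N" by (auto simp: HP_III_def N_def)
    have V: "\<Lambda> \<in> V_space n" if "\<Lambda> \<in> Upsilon_fiber n c" for \<Lambda> using that by (auto simp: Upsilon_fiber_def)
    have 1: "germs_with_HP p q n c \<subseteq> H_pq p q d"
      using V assms(5) by (fastforce simp: germs_with_HP_def H_pq_def V_space_def)
    have 2: "same_HP_invariant p q n \<Lambda> \<Lambda>'" if LL: "\<Lambda> \<in> Upsilon_fiber n c" "\<Lambda>' \<in> Upsilon_fiber n c" for \<Lambda> \<Lambda>'
    proof -
      have "insert (rho0 \<Lambda>') (polar_coeffs \<Lambda>') = insert (rho0 \<Lambda>) (polar_coeffs \<Lambda>)"
        using critical_values_of_fiber(1)[OF c] LL unfolding n by metis
      then show ?thesis unfolding same_HP_invariant_def by (intro exI[of _ 1]) simp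
    qed
    have ex: "\<exists>F. bij_betw F (fiber_orbits n c) (analytic_types_with_HP p q n c)
          \<and> (\<forall>\<Lambda>\<in>Upsilon_fiber n c. F (Zn_orbit n \<Lambda>) = analytic_type (qh_poly p q \<Lambda>))"
      unfolding fiber_orbits_def analytic_types_with_HP_def germs_with_HP_def image_image
      by (rule bij_betw_images) (use analytic_type_eq_iff_orbit_eq[OF assms(1-3) n0] V in blast)
    then obtain F where F: "bij_betw F (fiber_orbits n c) (analytic_types_with_HP p q n c)" by blast
    have up: "finite (fiber_orbits n c)" "card (fiber_orbits n c) \<le> n ^ (n - 2)"
      using orbit_count_upper[OF N c] by (auto simp: n)
    have 3: "finite (analytic_types_with_HP p q n c)" using bij_betw_finite[OF F] up(1) by simp
    have 4: "card (analytic_types_with_HP p q n c) = card (fiber_orbits n c)"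
      using bij_betw_same_card[OF F] by simp
    from 1 2 ex 3 4 up show "germs_with_HP p q n c \<subseteq> H_pq p q d
    \<and> (\<forall>\<Lambda>\<in>Upsilon_fiber n c. \<forall>\<Lambda>'\<in>Upsilon_fiber n c. same_HP_invariant p q n \<Lambda> \<Lambda>')
    \<and> (\<exists>F. bij_betw F (fiber_orbits n c) (analytic_types_with_HP p q n c)
          \<and> (\<forall>\<Lambda>\<in>Upsilon_fiber n c. F (Zn_orbit n \<Lambda>) = analytic_type (qh_poly p q \<Lambda>)))
    \<and> finite (analytic_types_with_HP p q n c)
    \<and> finite (fiber_orbits n c)
    \<and> card (analytic_types_with_HP p q n c) = card (fiber_orbits n c)
    \<and> card (fiber_orbits n c) \<le> n ^ (n - 2)" by blast
  qed
  show "generic_in_Z n (\<lambda>\<Lambda>. \<forall>\<kappa>. critical_tuple \<Lambda> \<kappa> \<longrightarrow>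
      HP_tuple \<Lambda> \<kappa> \<in> HP_III n \<and> card (fiber_orbits n (HP_tuple \<Lambda> \<kappa>)) = n ^ (n - 2))"
    unfolding generic_in_Z_def
  proof (intro exI[of _ "generic_coords n"] conjI ballI impI allI)
    show "zariski_open n (generic_coords n)" by (rule zariski_open_generic_coords[OF n0])
    show "generic_coords n \<noteq> {}" unfolding n by (rule generic_coords_nonempty)
    show "generic_coords n \<subseteq> coeff_coords n ` Z_roots n" by (rule generic_coords_subset[OF n0])
    fix \<Lambda> \<kappa> assume L: "\<Lambda> \<in> Z_roots n" "coeff_coords n \<Lambda> \<in> generic_coords n" "critical_tuple \<Lambda> \<kappa>"
    have r: "\<Lambda> \<in> root_sets (Suc N)" using L(1) by (simp add: Z_roots_def n)
    have "poly_of_coords n (coeff_coords n \<Lambda>) = Q_poly \<Lambda>"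
      by (rule poly_of_coeff_coords) (use r in \<open>auto simp: root_sets_def n\<close>)
    then have sep: "separated_values (Q_poly \<Lambda>)" using L(2) by (simp add: generic_coords_def)
    note H = generic_HP_tuple[OF N r sep L(3)]
    show "HP_tuple \<Lambda> \<kappa> \<in> HP_III n" using H(2) by (simp add: n)
    show "card (fiber_orbits n (HP_tuple \<Lambda> \<kappa>)) = n ^ (n - 2)"
      using orbit_count_upper[OF N H(1)] orbit_count_lower[OF N H(1,3)] unfolding n2 n by simp
  qed
qed

end
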